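(* Let $\lambda>0$, $v_0\in\mathbb{R}$, and let $\mu:[0,1]\to[0,\infty)$ be measurable with $\mu\in L^1(0,1)$, $\int_0^1\mu(\alpha)\,d\alpha>0$ and $\int_0^1\frac{\mu(\alpha)}{\alpha}\,d\alpha<\infty$. Then the unique absolutely continuous solution of $$D^{(\mu)}v+\lambda v=0,\qquad v(0)=v_0,$$ is given by $$v(t)=v_0\frac{\lambda}{\pi}\int_0^\infty\frac{e^{-rt}}{r}\,\frac{\int_0^1 r^\alpha\sin(\pi\alpha)\mu(\alpha)\,d\alpha}{\big(\lambda+\int_0^1r^\alpha\cos(\pi\alpha)\mu(\alpha)\,d\alpha\big)^2+\big(\int_0^1r^\alpha\sin(\pi\alpha)\mu(\alpha)\,d\alpha\big)^2}\,dr .$$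
   Context: For absolutely continuous $f$, the distributed order Caputo derivative is $D^{(\mu)}f(t)=\int_0^1 (D^\alpha f)(t)\mu(\alpha)\,d\alpha=\int_0^t k(t-\tau)f'(\tau)\,d\tau$, where $k(t)=\int_0^1\frac{\mu(\alpha)}{\Gamma(1-\alpha)}t^{-\alpha}\,d\alpha$ and $D^\alpha$ is the Caputo derivative of order $\alpha\in(0,1)$. A solution means a function absolutely continuous on $[0,T]$ for every $T>0$ satisfying the equation a.e. and $v(0)=v_0$. *)

theory Defs
  imports "HOL-Analysis.Analysis"
begin

definition abs_cont_on :: "real \<Rightarrow> real \<Rightarrow> (real \<Rightarrow> real) \<Rightarrow> bool" where
  "abs_cont_on a b f \<longleftrightarrow>
     (\<forall>\<epsilon>>0. \<exists>\<delta>>0. \<forall>(n::nat) (x::nat \<Rightarrow> real) (y::nat \<Rightarrow> real).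
        (\<forall>i<n. a \<le> x i \<and> x i \<le> y i \<and> y i \<le> b) \<and>
        (\<forall>i<n. \<forall>j<n. i \<noteq> j \<longrightarrow> y i \<le> x j \<or> y j \<le> x i) \<and>
        (\<Sum>i<n. y i - x i) < \<delta>
        \<longrightarrow> (\<Sum>i<n. \<bar>f (y i) - f (x i)\<bar>) < \<epsilon>)"

definition dkernel :: "(real \<Rightarrow> real) \<Rightarrow> real \<Rightarrow> real" where
  "dkernel \<mu> s = (LINT \<alpha>:{0<..<1}|lborel. \<mu> \<alpha> / Gamma (1 - \<alpha>) * s powr (- \<alpha>))"

definition dcaputo :: "(real \<Rightarrow> real) \<Rightarrow> (real \<Rightarrow> real) \<Rightarrow> real \<Rightarrow> real" where
  "dcaputo \<mu> f t = (LINT \<tau>:{0..t}|lborel. dkernel \<mu> (t - \<tau>) * deriv f \<tau>)"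

definition is_dsol :: "(real \<Rightarrow> real) \<Rightarrow> real \<Rightarrow> real \<Rightarrow> (real \<Rightarrow> real) \<Rightarrow> bool" where
  "is_dsol \<mu> lam v0 v \<longleftrightarrow>
     (\<forall>T>0. abs_cont_on 0 T v) \<and> v 0 = v0 \<and>
     (AE t in lborel. 0 < t \<longrightarrow>
        set_integrable lborel {0..t} (\<lambda>\<tau>. dkernel \<mu> (t - \<tau>) * deriv v \<tau>) \<and>
        dcaputo \<mu> v t + lam * v t = 0)"

end

theory Submission
  imports Defs "HOL-Complex_Analysis.Complex_Analysis" "HOL-Real_Asymp.Real_Asymp"
begin

text \<open>
  Let \<open>\<Phi> z\<close> be the integral of \<open>z powr \<alpha>\<close> against \<open>\<mu>\<close>. In the variable \<open>w = ln z\<close> the function \<open>\<Phi>\<close> is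
  entire, and \<open>G = 1 / (lam + \<Phi>)\<close> is holomorphic near the strip \<open>0 \<le> Im w \<le> pi\<close>, whose upper edge carries
  \<open>-Im G (ln r + \<i> pi) = S r / ((lam + C r)^2 + (S r)^2)\<close>. Cauchy's theorem on long rectangles in the
  strip, applied to \<open>G\<close> and to \<open>(G w - G (ln s)) / (s - exp w)\<close>, gives \<open>v 0 = v0\<close> and the Laplace
  transform \<open>v0 * \<Phi> s / (s * (lam + \<Phi> s))\<close> of \<open>v\<close>. The kernel has the transform \<open>\<Phi> s / s\<close>, so both sides of
  the equation have equal Laplace transforms and agree almost everywhere.

  For uniqueness take \<open>v0 = 1\<close> and put \<open>h = -v'\<close>, so that \<open>h * k = lam v\<close> and \<open>v = 1 - 1 * h\<close>, where \<open>*\<close> is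
  convolution. If \<open>u\<close> is absolutely continuous, \<open>u 0 = 0\<close> and \<open>k * u' = -lam u\<close>, then convolving with \<open>h\<close> yields
  \<open>-h * u = v * u' = u - h * u\<close>, hence \<open>u = 0\<close>. Here \<open>u\<close> is recovered from \<open>u'\<close> by the fundamental theorem of
  calculus for absolutely continuous functions: such a function is a difference of monotone ones, whose
  Stieltjes measures have Lebesgue densities.
\<close>

section \<open>Absolutely continuous functions as indefinite integrals\<close>

text \<open>The delicate point is the denominator: once \<open>Im w\<close> exceeds pi/2 the
  integrand of \<open>Psi w\<close> can have negative real part, so \<open>lam + Psi w\<close> might
  vanish or fail to grow. A rotation by half the angle bounds its modulus below by
  \<open>Slog\<close>, which is positive and grows at least linearly; this gives holomorphy on the
  strip and decay at its right end. At the left end \<open>Psi\<close> tends to 0, so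
  \<open>G\<close> tends to 1/lam, and this limit supplies the value of both contour integrals. The
  lower edge drops out on taking imaginary parts, because both integrands are real there. In the
  second one, subtracting \<open>G (ln s)\<close> removes the singularity on that edge, and on the
  upper edge 1/(s - exp w) becomes 1/(s + r), the Laplace transform of exp(-r t). The density on the
  upper edge is nonnegative, so limits of truncated contour integrals are Lebesgue integrals.
  Laplace transforms settle existence. A competing solution comes with no growth bound, hence with
  no transform; this is why uniqueness uses convolutions of functions cut off to a finite
  interval.\<close>

lemma AE_lborel_reflect:
  assumes "AE x in lborel. P x"
  shows "AE x in lborel. P (t - x :: real)"
proof -
  have "AE x in density (distr lborel borel (\<lambda>x. t + (-1) * x)) (\<lambda>_. ennreal \<bar>-1\<bar>). P x"
    using assms(1) lborel_real_affine[of "-1" t] by (metis zero_neq_neg_one)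
  then have "AE x in distr lborel borel (\<lambda>x. t + (-1) * x). P x"
    by (subst (asm) AE_density) auto
  from AE_distrD[OF _ this] show ?thesis by simp
qed

section \<open>Lebesgue differentiation on the line\<close>

lemma lebesgue_differentiation_right:
  fixes f :: "real \<Rightarrow> real"
  assumes f: "integrable lborel f"
  shows "AE x in lborel. ((\<lambda>h. (LINT y:{x..x+h}|lborel. f y) / h) \<longlongrightarrow> f x) (at_right 0)"
proof -
  have fi: "f integrable_on cbox a b" for a b
    using integrable_on_lborel[OF f] integrable_on_subcbox by blast
  have seti: "set_integrable lborel {a..b} f" for a b
    using f unfolding set_integrable_def by (intro integrable_mult_indicator) auto
  \<comment> \<open>The averages are taken over boxes with lower corner \<open>x\<close>, hence only
    to the right of \<open>x\<close>.\<close>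
  obtain N where N: "negligible N"
    "\<And>x e. \<lbrakk>x \<notin> N; 0 < e\<rbrakk> \<Longrightarrow> \<exists>d>0. \<forall>h. 0 < h \<and> h < d \<longrightarrow>
        norm (integral (cbox x (x + h *\<^sub>R One)) f /\<^sub>R h ^ DIM(real) - f x) < e"
    using integrable_ccontinuous_explicit[OF fi] by blast
  have "AE x in lebesgue. x \<notin> N"
    using N(1) by (simp add: AE_not_in negligible_iff_null_sets)
  then have "AE x in lebesgue. ((\<lambda>h. (LINT y:{x..x+h}|lborel. f y) / h) \<longlongrightarrow> f x) (at_right 0)"
  proof eventually_elim
    case (elim x)
    show ?case
    proof (rule tendstoI)
      fix e :: real assume "e > 0"
      from N(2)[OF elim this] obtain d where d: "d > 0"
        "\<And>h. 0 < h \<Longrightarrow> h < d \<Longrightarrow> \<bar>integral {x..x+h} f / h - f x\<bar> < e"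
        by (auto simp: field_simps)
      show "\<forall>\<^sub>F h in at_right 0. dist ((LINT y:{x..x+h}|lborel. f y) / h) (f x) < e"
        using eventually_at_right_real[OF d(1)]
        by eventually_elim (use d(2) in \<open>simp add: dist_real_def set_borel_integral_eq_integral(2)[OF seti]\<close>)
    qed
  qed
  then show ?thesis by (simp add: AE_completion_iff)
qed

lemma lebesgue_differentiation:
  fixes f :: "real \<Rightarrow> real"
  \<comment> \<open>The left-hand difference quotient at \<open>x\<close> is a right-hand average of
    the reflected function at \<open>-x\<close>, so the one-sided result for both functions gives a
    two-sided derivative.\<close>
  assumes f: "integrable lborel f"
  shows "AE x in lborel. ((\<lambda>t. LINT y:{..t}|lborel. f y) has_real_derivative f x) (at x)"
proof -
  have seti: "set_integrable lborel S f" if "S \<in> sets borel" for S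
    using f that unfolding set_integrable_def by (intro integrable_mult_indicator) auto
  let ?F = "\<lambda>t. LINT y:{..t}|lborel. f y"
  have diff: "?F b - ?F a = (LINT y:{a..b}|lborel. f y)" if "a \<le> b" for a b
  proof -
    have "?F b = ?F a + (LINT y:{a<..b}|lborel. f y)"
      using that by (subst set_integral_Un[symmetric]) (auto intro!: seti simp: ivl_disj_un_one)
    moreover have "(LINT y:{a<..b}|lborel. f y) = (LINT y:{a..b}|lborel. f y)"
      by (rule set_integral_null_delta) (use that in \<open>auto simp: f intro!: finite_imp_null_set_lborel finite_subset[of _ "{a}"]\<close>)
    ultimately show ?thesis by simp
  qed
  have g: "integrable lborel (\<lambda>x. f (- x))"
    using lborel_integrable_real_affine[OF f, of "-1" 0] by simp
  have "AE x in lborel. ((\<lambda>h. (LINT y:{x..x+h}|lborel. f (- y)) / h) \<longlongrightarrow> f (- x)) (at_right 0)"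
    by (rule lebesgue_differentiation_right[OF g])
  from AE_lborel_reflect[OF this, of 0]
  have L: "AE x in lborel. ((\<lambda>h. (LINT y:{-x..-x+h}|lborel. f (- y)) / h) \<longlongrightarrow> f x) (at_right 0)"
    by simp
  have refl: "(LINT y:{-x..-x+h}|lborel. f (- y)) = (LINT y:{x-h..x}|lborel. f y)" for x h
  proof -
    have "(\<integral>y. indicator {x-h..x} y * f y \<partial>lborel) = (\<integral>y. indicator {x-h..x} (- y) * f (- y) \<partial>lborel)"
      using lborel_integral_real_affine[of "-1" "\<lambda>y. indicator {x-h..x} y * f y" 0] by simp
    also have "(\<lambda>y. indicator {x-h..x} (- y) * f (- y)) = (\<lambda>y. indicator {-x..-x+h} y * f (- y))"
      by (auto simp: fun_eq_iff indicator_def)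
    finally show ?thesis by (simp add: set_lebesgue_integral_def)
  qed
  from lebesgue_differentiation_right[OF f] L show ?thesis
  proof eventually_elim
    case (elim x)
    have R: "((\<lambda>h. (?F (x + h) - ?F x) / h) \<longlongrightarrow> f x) (at_right 0)"
    proof (rule Lim_transform_eventually[OF elim(1)])
      show "\<forall>\<^sub>F h in at_right 0. (LINT y:{x..x+h}|lborel. f y) / h = (?F (x + h) - ?F x) / h"
        using eventually_at_right_real[of 0 1, OF zero_less_one] by eventually_elim (simp add: diff)
    qed
    have "((\<lambda>h. (?F x - ?F (x - h)) / h) \<longlongrightarrow> f x) (at_right 0)"
    proof (rule Lim_transform_eventually[OF elim(2)])
      show "\<forall>\<^sub>F h in at_right 0. (LINT y:{-x..-x+h}|lborel. f (- y)) / h = (?F x - ?F (x - h)) / h"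
        using eventually_at_right_real[of 0 1, OF zero_less_one] by eventually_elim (simp only: refl, simp add: diff)
    qed
    then have "((\<lambda>h. (?F (x + h) - ?F x) / h) \<longlongrightarrow> f x) (at_left 0)"
      by (subst filterlim_at_left_to_right) (simp add: minus_divide_left)
    with R show ?case unfolding DERIV_def by (simp add: filterlim_at_split)
  qed
qed

section \<open>Finite families of nonoverlapping intervals\<close>

definition nonoverlapping :: "real \<times> real \<Rightarrow> real \<times> real \<Rightarrow> bool" where
  "nonoverlapping p q \<longleftrightarrow> snd p \<le> fst q \<or> snd q \<le> fst p"

text \<open>Lists replace the indexed families of \<open>abs_cont_on\<close> so that families can be
  concatenated, refined and handled by induction. As \<open>nonoverlapping\<close> is symmetric,
  \<open>sorted_wrt\<close> merely expresses a pairwise condition; the intervals may be listed in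
  any order.\<close>

definition intervals :: "real \<Rightarrow> real \<Rightarrow> (real \<times> real) list \<Rightarrow> bool" where
  "intervals a b xs \<longleftrightarrow>
     (\<forall>p\<in>set xs. a \<le> fst p \<and> fst p \<le> snd p \<and> snd p \<le> b) \<and> sorted_wrt nonoverlapping xs"

definition total_length :: "(real \<times> real) list \<Rightarrow> real" where
  "total_length xs = (\<Sum>p\<leftarrow>xs. snd p - fst p)"

definition increment :: "(real \<Rightarrow> real) \<Rightarrow> (real \<times> real) list \<Rightarrow> real" where
  "increment w xs = (\<Sum>p\<leftarrow>xs. w (snd p) - w (fst p))"

definition variation :: "(real \<Rightarrow> real) \<Rightarrow> (real \<times> real) list \<Rightarrow> real" where
  "variation w xs = (\<Sum>p\<leftarrow>xs. \<bar>w (snd p) - w (fst p)\<bar>)"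

text \<open>A family need not cover the interval, so decreasing stretches can be left out of the
  supremum; this makes it the positive variation although the increments carry their sign.\<close>

definition positive_variation :: "(real \<Rightarrow> real) \<Rightarrow> real \<Rightarrow> real \<Rightarrow> real" where
  "positive_variation w a b = (SUP xs\<in>{xs. intervals a b xs}. increment w xs)"

definition ac_lists :: "real \<Rightarrow> real \<Rightarrow> (real \<Rightarrow> real) \<Rightarrow> bool" where
  "ac_lists a b w \<longleftrightarrow>
     (\<forall>\<epsilon>>0. \<exists>\<delta>>0. \<forall>xs. intervals a b xs \<and> total_length xs < \<delta> \<longrightarrow> variation w xs < \<epsilon>)"

lemma intervals_Nil [simp]: "intervals a b []"
  by (simp add: intervals_def)

lemma increment_le_variation: "increment w xs \<le> variation w xs"
  unfolding increment_def variation_def by (rule sum_list_mono) simp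

lemma intervals_mono: "intervals c d xs \<Longrightarrow> a \<le> c \<Longrightarrow> d \<le> b \<Longrightarrow> intervals a b xs"
  by (force simp: intervals_def)

lemma abs_cont_on_imp_ac_lists:
  assumes "abs_cont_on a b w"
  shows "ac_lists a b w"
  unfolding ac_lists_def
proof (intro allI impI)
  fix \<epsilon> :: real assume "\<epsilon> > 0"
  from assms[unfolded abs_cont_on_def, rule_format, OF this] obtain \<delta> where \<delta>: "\<delta> > 0" and
    *: "\<forall>(n::nat) x y. (\<forall>i<n. a \<le> x i \<and> x i \<le> y i \<and> y i \<le> b) \<and>
        (\<forall>i<n. \<forall>j<n. i \<noteq> j \<longrightarrow> y i \<le> x j \<or> y j \<le> x i) \<and>
        (\<Sum>i<n. y i - x i) < \<delta> \<longrightarrow> (\<Sum>i<n. \<bar>w (y i) - w (x i)\<bar>) < \<epsilon>"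
    by blast
  show "\<exists>\<delta>>0. \<forall>xs. intervals a b xs \<and> total_length xs < \<delta> \<longrightarrow> variation w xs < \<epsilon>"
  proof (intro exI conjI allI impI, fact \<delta>)
    fix xs assume xs: "intervals a b xs \<and> total_length xs < \<delta>"
    have no: "nonoverlapping (xs ! i) (xs ! j)" if "i < length xs" "j < length xs" "i \<noteq> j" for i j
    proof (cases "i < j")
      case True
      with xs that show ?thesis by (auto simp: intervals_def sorted_wrt_iff_nth_less)
    next
      case False
      with xs that have "nonoverlapping (xs ! j) (xs ! i)"
        by (auto simp: intervals_def sorted_wrt_iff_nth_less)
      then show ?thesis by (auto simp: nonoverlapping_def)
    qed
    have "(\<Sum>i<length xs. \<bar>w (snd (xs ! i)) - w (fst (xs ! i))\<bar>) < \<epsilon>"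
      using xs no
      by (intro *[rule_format])
        (auto simp: intervals_def nonoverlapping_def total_length_def sum_list_sum_nth atLeast0LessThan)
    then show "variation w xs < \<epsilon>"
      by (simp add: variation_def sum_list_sum_nth atLeast0LessThan)
  qed
qed

text \<open>Open intervals are used because neighbours in a family may share an endpoint, which
  closed ones would count twice.\<close>

lemma sum_indicator_intervals_le:
  assumes "sorted_wrt nonoverlapping xs"
  shows "(\<Sum>p\<leftarrow>xs. indicator {fst p<..<snd p} t :: real) \<le> 1"
  using assms
proof (induction xs)
  case (Cons p xs)
  show ?case
  proof (cases "t \<in> {fst p<..<snd p}")
    case True
    have "(\<Sum>q\<leftarrow>xs. indicator {fst q<..<snd q} t :: real) = (\<Sum>q\<leftarrow>xs. 0)"
      using Cons.prems True
      by (intro arg_cong[where f=sum_list] map_cong) (auto simp: nonoverlapping_def indicator_def)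
    then show ?thesis by (simp add: indicator_def)
  qed (use Cons in simp)
qed simp

lemma set_integral_Ioo_eq_Icc:
  fixes h :: "real \<Rightarrow> real"
  shows "(LINT t:{a<..<b}|lborel. h t) = (LINT t:{a..b}|lborel. h t)"
  by (rule set_integral_discrete_difference[where X="{a, b}"]) auto

text \<open>Endpoints are null, so closed intervals may be opened; a point then lies in at most one
  of them and the integrands add up to at most \<open>h\<close>.\<close>

lemma sum_set_integral_intervals_le:
  assumes xs: "intervals a b xs" and h: "set_integrable lborel {a..b} h"
    and nn: "\<And>t. t \<in> {a..b} \<Longrightarrow> h t \<ge> 0"
  shows "(\<Sum>p\<leftarrow>xs. LINT t:{fst p..snd p}|lborel. h t) \<le> (LINT t:{a..b}|lborel. (h t :: real))"
proof -
  let ?I = "\<lambda>xs t. \<Sum>p\<leftarrow>xs. indicator {fst p<..<snd p} t * h t"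
  have int: "set_integrable lborel {fst p<..<snd p} h" if "p \<in> set xs" for p
    by (rule set_integrable_subset[OF h]) (use xs that in \<open>auto simp: intervals_def\<close>)
  then have I: "integrable lborel (?I xs) \<and>
      (\<integral>t. ?I xs t \<partial>lborel) = (\<Sum>p\<leftarrow>xs. LINT t:{fst p<..<snd p}|lborel. h t)"
    by (induction xs) (auto simp: set_integrable_def set_lebesgue_integral_def)
  have le: "?I xs t \<le> indicator {a..b} t * h t" for t
  proof -
    have eq: "?I xs t = (\<Sum>p\<leftarrow>xs. indicator {fst p<..<snd p} t) * h t"
      by (simp add: sum_list_mult_const)
    show ?thesis
    proof (cases "t \<in> {a..b}")
      case True
      then show ?thesis unfolding eq
        using mult_right_mono[OF sum_indicator_intervals_le[of xs t] nn[OF True]] xs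
        by (simp add: intervals_def)
    next
      case False
      then have "(\<Sum>p\<leftarrow>xs. indicator {fst p<..<snd p} t :: real) = (\<Sum>p\<leftarrow>xs. 0)"
        using xs
        by (intro arg_cong[where f=sum_list] map_cong) (force simp: intervals_def indicator_def)+
      then show ?thesis unfolding eq using False by simp
    qed
  qed
  have "integrable lborel (\<lambda>t. indicator {a..b} t * h t)"
    using h by (simp add: set_integrable_def)
  with I have "(\<Sum>p\<leftarrow>xs. LINT t:{fst p<..<snd p}|lborel. h t) \<le> (\<integral>t. indicator {a..b} t * h t \<partial>lborel)"
    using integral_mono[OF conjunct1[OF I] _ le] by simp
  then show ?thesis
    by (simp add: set_lebesgue_integral_def[of lborel "{a..b}"] set_integral_Ioo_eq_Icc)
qed

lemma total_length_le:
  assumes "intervals a b xs" and "a \<le> b"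
  shows "total_length xs \<le> b - a"
proof -
  have "set_integrable lborel {a..b} (\<lambda>t. 1 :: real)"
    by (intro borel_integrable_atLeastAtMost') auto
  from sum_set_integral_intervals_le[OF assms(1) this]
  have "(\<Sum>p\<leftarrow>xs. LINT t:{fst p..snd p}|lborel. 1) \<le> b - a"
    using assms(2) by (simp add: set_lebesgue_integral_def)
  moreover have "(\<Sum>p\<leftarrow>xs. LINT t:{fst p..snd p}|lborel. 1) = total_length xs"
    unfolding total_length_def using assms(1)
    by (intro arg_cong[where f=sum_list] map_cong) (auto simp: intervals_def set_lebesgue_integral_def)
  ultimately show ?thesis by simp
qed

text \<open>With \<open>min c\<close> and \<open>max c\<close> in place of \<open>m\<close> this
  cuts a family at \<open>c\<close>; intervals on the wrong side collapse to the point
  \<open>c\<close> and contribute nothing.\<close>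

definition clip :: "(real \<Rightarrow> real) \<Rightarrow> (real \<times> real) list \<Rightarrow> (real \<times> real) list" where
  "clip m xs = map (\<lambda>p. (m (fst p), m (snd p))) xs"

lemma intervals_clip:
  assumes "intervals a b xs" and "mono m" and "\<And>x. x \<in> {a..b} \<Longrightarrow> m x \<in> {c..d}"
  shows "intervals c d (clip m xs)"
proof -
  have "nonoverlapping (m (fst p), m (snd p)) (m (fst q), m (snd q))" if "nonoverlapping p q" for p q
    using that monoD[OF assms(2), of "snd p" "fst q"] monoD[OF assms(2), of "snd q" "fst p"]
    by (auto simp: nonoverlapping_def)
  then have "sorted_wrt (\<lambda>p q. nonoverlapping (m (fst p), m (snd p)) (m (fst q), m (snd q))) xs"
  proof (rule sorted_wrt_mono_rel)
    show "sorted_wrt nonoverlapping xs" using assms(1) by (simp add: intervals_def)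
  qed
  moreover have "c \<le> m (fst p) \<and> m (fst p) \<le> m (snd p) \<and> m (snd p) \<le> d" if "p \<in> set xs" for p
    using assms(1) that assms(3)[of "fst p"] assms(3)[of "snd p"] monoD[OF assms(2), of "fst p" "snd p"]
    by (auto simp: intervals_def)
  ultimately show ?thesis
    unfolding clip_def by (auto simp: intervals_def sorted_wrt_map)
qed

text \<open>One of \<open>min c x\<close> and \<open>max c x\<close> is \<open>x\<close> and the
  other is \<open>c\<close>, so the extra value \<open>w c\<close> cancels in every
  difference.\<close>

lemma increment_split:
  "increment w xs = increment w (clip (min c) xs) + increment w (clip (max c) xs)"
proof (induction xs)
  case (Cons p xs)
  have "w x = w (min c x) + w (max c x) - w c" for x
    by (auto simp: min_def max_def)
  then have "w (snd p) - w (fst p) =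
      (w (min c (snd p)) - w (min c (fst p))) + (w (max c (snd p)) - w (max c (fst p)))"
    by (smt (verit))
  with Cons show ?case by (simp add: increment_def clip_def)
qed (simp add: increment_def clip_def)

text \<open>Absolute continuity with epsilon = 1 bounds the increment by 1 on each piece of length
  delta/2; finitely many such pieces cover the interval.\<close>

lemma bdd_above_increment:
  assumes ac: "ac_lists a b w"
  shows "bdd_above (increment w ` {xs. intervals a b xs})"
proof (cases "a \<le> b")
  case False
  then have "{xs. intervals a b xs} \<subseteq> {[]}"
    by (auto simp: intervals_def) (metis list.set_intros(1) neq_Nil_conv order_trans)
  then show ?thesis by (meson bdd_above_finite finite.emptyI finite.insertI finite_imageI finite_subset)
next
  case True
  from ac obtain \<delta> where \<delta>: "\<delta> > 0" and
    *: "\<And>xs. intervals a b xs \<Longrightarrow> total_length xs < \<delta> \<Longrightarrow> variation w xs < 1"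
    unfolding ac_lists_def by (metis zero_less_one)
  have bound: "increment w xs \<le> real n" if "intervals a c xs" "c \<le> b" "c \<le> a + n * (\<delta>/2)" "a \<le> c" for n c xs
    using that
  proof (induction n arbitrary: c xs)
    case 0
    then have "\<forall>p\<in>set xs. fst p = a \<and> snd p = a"
      by (force simp: intervals_def)
    then have "increment w xs = (\<Sum>p\<leftarrow>xs. 0)"
      unfolding increment_def by (intro arg_cong[where f=sum_list] map_cong) auto
    then show ?case by simp
  next
    case (Suc n)
    \<comment> \<open>Splits off the last piece, of length at most delta/2 so that total lengths
      there stay strictly below delta.\<close>
    define e where "e = max a (c - \<delta>/2)"
    have e: "a \<le> e" "e \<le> c" "c - e \<le> \<delta>/2" "e \<le> a + n * (\<delta>/2)"
      using Suc.prems \<delta> by (auto simp: e_def max_def field_simps)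
    have 1: "intervals a e (clip (min e) xs)"
      by (rule intervals_clip[OF Suc.prems(1)]) (use e in \<open>auto simp: mono_def min_def\<close>)
    have 2: "intervals e c (clip (max e) xs)"
      by (rule intervals_clip[OF Suc.prems(1)]) (use e in \<open>auto simp: mono_def max_def\<close>)
    have "total_length (clip (max e) xs) < \<delta>"
      using total_length_le[OF 2] e \<delta> by linarith
    then have "increment w (clip (max e) xs) < 1"
      using *[OF intervals_mono[OF 2]] e Suc.prems increment_le_variation[of w "clip (max e) xs"] by force
    moreover have "increment w (clip (min e) xs) \<le> n"
      using Suc.IH[OF 1] e Suc.prems by auto
    ultimately show ?case using increment_split[of w xs e] by simp
  qed
  obtain n :: nat where "(b - a) / (\<delta>/2) \<le> n" using real_arch_simple by blast
  then have "b \<le> a + n * (\<delta>/2)" using \<delta> by (simp add: field_simps)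
  then show ?thesis using bound[of b] True by (intro bdd_aboveI2[where M="real n"]) auto
qed

section \<open>Positive variation as a function of the right endpoint\<close>

lemma ac_lists_subset: "ac_lists a b w \<Longrightarrow> a \<le> c \<Longrightarrow> d \<le> b \<Longrightarrow> ac_lists c d w"
  unfolding ac_lists_def by (meson intervals_mono)

lemma increment_le_positive_variation:
  "ac_lists a b w \<Longrightarrow> intervals a b xs \<Longrightarrow> increment w xs \<le> positive_variation w a b"
  unfolding positive_variation_def by (intro cSUP_upper bdd_above_increment) auto

lemma positive_variation_least:
  "(\<And>xs. intervals a b xs \<Longrightarrow> increment w xs \<le> K) \<Longrightarrow> positive_variation w a b \<le> K"
  unfolding positive_variation_def by (intro cSUP_least) (auto intro: exI[of _ "[]"])

text \<open>A family on \<open>[a, c]\<close> can be kept or extended by the interval from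
  \<open>c\<close> to \<open>d\<close>. The term with \<open>max 0\<close> therefore makes both P
  and P - w nondecreasing, where P is the positive variation from \<open>a\<close>: the
  decomposition of \<open>w\<close> into monotone functions.\<close>

lemma positive_variation_mono:
  assumes "ac_lists a b w" "a \<le> c" "c \<le> d" "d \<le> b"
  shows "positive_variation w a c + max 0 (w d - w c) \<le> positive_variation w a d"
proof -
  have ac: "ac_lists a d w" using assms ac_lists_subset by blast
  have "increment w xs + max 0 (w d - w c) \<le> positive_variation w a d" if xs: "intervals a c xs" for xs
  proof -
    have "intervals a d xs" using intervals_mono[OF xs] assms by simp
    moreover have "intervals a d (xs @ [(c, d)])"
      using xs assms by (force simp: intervals_def sorted_wrt_append nonoverlapping_def)
    ultimately show ?thesis
      using increment_le_positive_variation[OF ac, of xs] increment_le_positive_variation[OF ac, of "xs @ [(c, d)]"]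
      by (simp add: increment_def max_def)
  qed
  then have "positive_variation w a c \<le> positive_variation w a d - max 0 (w d - w c)"
    by (intro positive_variation_least) (simp add: le_diff_eq)
  then show ?thesis by simp
qed

lemma positive_variation_subadditive:
  assumes "ac_lists a b w" "a \<le> c" "c \<le> d" "d \<le> b"
  shows "positive_variation w a d \<le> positive_variation w a c + positive_variation w c d"
proof (rule positive_variation_least)
  fix xs assume xs: "intervals a d xs"
  have "intervals a c (clip (min c) xs)"
    by (rule intervals_clip[OF xs]) (use assms in \<open>auto simp: mono_def min_def\<close>)
  moreover have "intervals c d (clip (max c) xs)"
    by (rule intervals_clip[OF xs]) (use assms in \<open>auto simp: mono_def max_def\<close>)
  moreover have "ac_lists a c w" "ac_lists c d w" using assms ac_lists_subset by force+
  ultimately show "increment w xs \<le> positive_variation w a c + positive_variation w c d"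
    unfolding increment_split[of w xs c] by (intro add_mono increment_le_positive_variation)
qed

text \<open>Refines every interval of a family by a family inside it. The last conjunct carries the
  induction: a new interval lies inside an old one, so it inherits nonoverlapping from it.\<close>

lemma intervals_concat:
  assumes "list_all2 (\<lambda>p. intervals (fst p) (snd p)) xs yss" and "intervals a b xs"
  shows "intervals a b (concat yss) \<and> total_length (concat yss) \<le> total_length xs
     \<and> (\<forall>q\<in>set (concat yss). \<exists>p\<in>set xs. fst p \<le> fst q \<and> snd q \<le> snd p)"
  using assms
proof (induction rule: list_all2_induct)
  case (Cons p xs ys yss)
  have "intervals a b xs" using Cons.prems by (simp add: intervals_def)
  from Cons.IH[OF this]
  have IH: "intervals a b (concat yss)" "total_length (concat yss) \<le> total_length xs"
      "\<forall>q\<in>set (concat yss). \<exists>p\<in>set xs. fst p \<le> fst q \<and> snd q \<le> snd p"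
    by blast+
  have p: "a \<le> fst p" "fst p \<le> snd p" "snd p \<le> b" "\<And>r. r \<in> set xs \<Longrightarrow> nonoverlapping p r"
    using Cons.prems by (auto simp: intervals_def)
  have ys: "intervals a b ys" using Cons.hyps p intervals_mono by blast
  have "nonoverlapping q r" if "q \<in> set ys" "r \<in> set (concat yss)" for q r
  proof -
    from that IH(3) obtain s where s: "s \<in> set xs" "fst s \<le> fst r" "snd r \<le> snd s" by blast
    have "fst p \<le> fst q" "snd q \<le> snd p" using Cons.hyps(1) that by (auto simp: intervals_def)
    with p(4)[OF s(1)] s show ?thesis by (auto simp: nonoverlapping_def)
  qed
  then have "intervals a b (concat (ys # yss))"
    using IH(1) ys by (auto simp: intervals_def sorted_wrt_append)
  moreover have "total_length (concat (ys # yss)) \<le> total_length (p # xs)"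
    using total_length_le[OF Cons.hyps(1) p(2)] IH(2) by (simp add: total_length_def)
  moreover have "\<exists>r\<in>set (p # xs). fst r \<le> fst q \<and> snd q \<le> snd r" if "q \<in> set (concat (ys # yss))" for q
    using that IH(3) Cons.hyps(1) by (auto simp: intervals_def)
  ultimately show ?case by blast
qed (simp add: total_length_def)

text \<open>A bound for all simultaneous refinements bounds the sum of suprema; the induction passes
  to one supremum at a time, moving the rest to the right-hand side.\<close>

lemma sum_positive_variation_le:
  assumes "\<And>yss. list_all2 (\<lambda>p. intervals (fst p) (snd p)) xs yss \<Longrightarrow> increment w (concat yss) \<le> K"
  shows "(\<Sum>p\<leftarrow>xs. positive_variation w (fst p) (snd p)) \<le> K"
  using assms
proof (induction xs arbitrary: K)
  case (Cons p xs)
  have "increment w ys \<le> K - (\<Sum>p\<leftarrow>xs. positive_variation w (fst p) (snd p))"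
    if ys: "intervals (fst p) (snd p) ys" for ys
  proof -
    have "increment w (concat yss) \<le> K - increment w ys"
      if "list_all2 (\<lambda>p. intervals (fst p) (snd p)) xs yss" for yss
      using Cons.prems[of "ys # yss"] ys that by (simp add: increment_def)
    from Cons.IH[OF this] show ?thesis by simp
  qed
  from positive_variation_least[of "fst p" "snd p" w, OF this] show ?case by simp
qed (simp add: increment_def)

text \<open>The growth of the positive variation over an interval is at most the positive variation
  inside it. Approximating each by a family and concatenating yields a refinement of no greater
  total length, to which absolute continuity of \<open>w\<close> applies.\<close>

lemma ac_lists_positive_variation:
  assumes ac: "ac_lists a b w"
  shows "ac_lists a b (positive_variation w a)"
  unfolding ac_lists_def
proof (intro allI impI)
  fix \<epsilon> :: real assume "\<epsilon> > 0"
  \<comment> \<open>Half of epsilon, because the strict bound becomes a weak one when suprema are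
    taken.\<close>
  with ac obtain \<delta> where \<delta>: "\<delta> > 0" and
    *: "\<And>xs. intervals a b xs \<Longrightarrow> total_length xs < \<delta> \<Longrightarrow> variation w xs < \<epsilon> / 2"
    unfolding ac_lists_def by (meson half_gt_zero)
  show "\<exists>\<delta>>0. \<forall>xs. intervals a b xs \<and> total_length xs < \<delta> \<longrightarrow> variation (positive_variation w a) xs < \<epsilon>"
  proof (intro exI conjI allI impI, fact \<delta>)
    fix xs assume xs: "intervals a b xs \<and> total_length xs < \<delta>"
    have "\<bar>positive_variation w a (snd p) - positive_variation w a (fst p)\<bar> \<le> positive_variation w (fst p) (snd p)"
      if "p \<in> set xs" for p
    proof -
      have "a \<le> fst p" "fst p \<le> snd p" "snd p \<le> b" using xs that by (auto simp: intervals_def)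
      from positive_variation_mono[OF ac this] positive_variation_subadditive[OF ac this] show ?thesis by simp
    qed
    then have "variation (positive_variation w a) xs \<le> (\<Sum>p\<leftarrow>xs. positive_variation w (fst p) (snd p))"
      unfolding variation_def by (rule sum_list_mono)
    also have "\<dots> \<le> \<epsilon> / 2"
    proof (rule sum_positive_variation_le)
      fix yss assume "list_all2 (\<lambda>p. intervals (fst p) (snd p)) xs yss"
      from intervals_concat[OF this, of a b] xs have "variation w (concat yss) < \<epsilon> / 2" by (intro *) auto
      then show "increment w (concat yss) \<le> \<epsilon> / 2"
        using increment_le_variation[of w "concat yss"] by simp
    qed
    finally show "variation (positive_variation w a) xs < \<epsilon>" using \<open>\<epsilon> > 0\<close> by simp
  qed
qed

lemma ac_lists_diff:
  assumes "ac_lists a b f" "ac_lists a b g"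
  shows "ac_lists a b (\<lambda>x. f x - g x)"
  unfolding ac_lists_def
proof (intro allI impI)
  fix \<epsilon> :: real assume "\<epsilon> > 0"
  then have "\<epsilon>/2 > 0" by simp
  from assms(1)[unfolded ac_lists_def, rule_format, OF this] obtain d1 where d1: "d1 > 0"
    "\<forall>xs. intervals a b xs \<and> total_length xs < d1 \<longrightarrow> variation f xs < \<epsilon> / 2" by blast
  from assms(2)[unfolded ac_lists_def, rule_format, OF \<open>\<epsilon>/2 > 0\<close>] obtain d2 where d2: "d2 > 0"
    "\<forall>xs. intervals a b xs \<and> total_length xs < d2 \<longrightarrow> variation g xs < \<epsilon> / 2" by blast
  have le: "variation (\<lambda>x. f x - g x) xs \<le> variation f xs + variation g xs" for xs
    by (induction xs) (auto simp: variation_def)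
  show "\<exists>\<delta>>0. \<forall>xs. intervals a b xs \<and> total_length xs < \<delta> \<longrightarrow> variation (\<lambda>x. f x - g x) xs < \<epsilon>"
  proof (intro exI[of _ "min d1 d2"] conjI allI impI)
    fix xs assume "intervals a b xs \<and> total_length xs < min d1 d2"
    with d1 d2 have "variation f xs < \<epsilon> / 2" "variation g xs < \<epsilon> / 2" by auto
    with le[of xs] show "variation (\<lambda>x. f x - g x) xs < \<epsilon>" by simp
  qed (use d1 d2 in simp)
qed

section \<open>Densities of Stieltjes measures and the fundamental theorem\<close>

lemma set_integrable_lborel_subset:
  fixes f :: "real \<Rightarrow> real"
  assumes "integrable lborel f" "S \<in> sets borel"
  shows "set_integrable lborel S f"
  using assms unfolding set_integrable_def by (intro integrable_mult_indicator) auto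

text \<open>A bounded null set is covered by countably many nonoverlapping intervals of total length
  below delta. The Stieltjes measure of a finite subfamily is at most the variation over it, hence
  at most epsilon, and continuity from below passes this to the whole cover.\<close>

lemma ac_mono_absolutely_continuous:
  assumes mono: "\<And>x y. x \<le> y \<Longrightarrow> F x \<le> F y" and cont: "continuous_on UNIV F"
    and ac: "\<And>\<epsilon>. \<epsilon> > 0 \<Longrightarrow>
      \<exists>\<delta>>0. \<forall>c d xs. intervals c d xs \<and> total_length xs < \<delta> \<longrightarrow> variation F xs < \<epsilon>"
  shows "absolutely_continuous lborel (interval_measure F)"
  unfolding absolutely_continuous_def
proof
  fix N :: "real set" assume N: "N \<in> null_sets lborel"
  let ?M = "interval_measure F"
  have bounded: "N \<inter> {-real (Suc n)..real (Suc n)} \<in> null_sets ?M" for n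
  proof -
    define r where "r = real (Suc n)"
    have r: "r > 0" by (simp add: r_def)
    let ?S = "N \<inter> cbox (-r) r"
    have S0: "?S \<in> null_sets lborel" using N by (intro null_set_Int2) auto
    then have "negligible ?S"
      using null_sets_completionI negligible_iff_null_sets by blast
    then have S: "?S \<in> lmeasurable" "measure lebesgue ?S = 0"
      by (rule negligible_imp_measurable, rule negligible_imp_measure0)
    have "emeasure ?M ?S \<le> ennreal \<epsilon>" if "\<epsilon> > 0" for \<epsilon>
    proof -
      from ac[OF that] obtain \<delta> where \<delta>: "\<delta> > 0"
        "\<forall>c d xs. intervals c d xs \<and> total_length xs < \<delta> \<longrightarrow> variation F xs < \<epsilon>" by blast
      obtain D where D: "countable D"
        "\<And>K. K \<in> D \<Longrightarrow> K \<subseteq> cbox (-r) r \<and> K \<noteq> {} \<and> (\<exists>c d. K = cbox c d)"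
        "pairwise (\<lambda>A B. interior A \<inter> interior B = {}) D"
        "?S \<subseteq> \<Union>D" "\<Union>D \<in> lmeasurable" "measure lebesgue (\<Union>D) \<le> measure lebesgue ?S + \<delta>/2"
        "\<And>K. \<lbrakk>K \<in> D; box (-r) r \<noteq> {}\<rbrakk> \<Longrightarrow> interior K \<noteq> {}"
      proof (rule measurable_outer_intervals_bounded[OF S(1) Int_lower2 half_gt_zero[OF \<delta>(1)]], goal_cases)
        case (1 D)
        show ?case by (rule that[OF 1(2,3,4,7,8,9,6)])
      qed
      have Icc: "{Inf K..Sup K} = K" "Inf K \<le> Sup K" if "K \<in> D" for K
        using D(2)[OF that] by (auto simp: cbox_interval)
      \<comment> \<open>Nondegeneracy matters: a single point inside another interval has empty
        interior, so disjoint interiors alone would not give \<open>nonoverlapping\<close>.\<close>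
      have lt: "Inf K < Sup K" if "K \<in> D" for K
      proof -
        have "interior {Inf K..Sup K} \<noteq> {}"
          using D(7)[OF that] r Icc(1)[OF that] by (simp add: box_real)
        then show ?thesis by (simp add: interior_atLeastAtMost_real)
      qed
      have KB: "K \<in> sets borel" if "K \<in> D" for K
        using atLeastAtMost_borel[of "Inf K" "Sup K"] Icc(1)[OF that] by simp
      have UB: "(\<Union>D) \<in> sets borel"
        using D(1) KB by (intro sets.countable_Union) auto
      have US: "(\<Union>D) \<subseteq> {-r..r}" using D(2) by (auto simp: cbox_interval)
      have eq: "indicator {-r..r} t *\<^sub>R indicator (\<Union>D) t = (indicator (\<Union>D) t::real)" for t
        using US by (auto simp: indicator_def)
      have fin: "emeasure lborel (\<Union>D) < \<infinity>"
        by (rule le_less_trans[OF emeasure_mono[OF US]]) (simp_all add: emeasure_lborel_Icc_eq)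
      have h: "set_integrable lborel {-r..r} (indicator (\<Union>D) :: real \<Rightarrow> real)"
        unfolding set_integrable_def eq using integrable_real_indicator[of "\<Union>D" lborel] UB fin by simp
      have h2: "(LINT t:{-r..r}|lborel. indicator (\<Union>D) t) = measure lborel (\<Union>D)"
        unfolding set_lebesgue_integral_def eq by simp
      \<comment> \<open>Variation is controlled for finite lists only, so finite subfamilies come
        first.\<close>
      have fin: "emeasure ?M (\<Union>D') \<le> ennreal \<epsilon>" if D': "finite D'" "D' \<subseteq> D" for D'
      proof -
        obtain Ks where Ks: "set Ks = D'" "distinct Ks" using finite_distinct_list[OF D'(1)] by blast
        define xs where "xs = map (\<lambda>K. (Inf K, Sup K)) Ks"
        have no: "nonoverlapping (Inf A, Sup A) (Inf B, Sup B)" if "A \<in> D'" "B \<in> D'" "A \<noteq> B" for A B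
        proof -
          have AB: "A \<in> D" "B \<in> D" using that D' by auto
          have "interior A \<inter> interior B = {}"
            using D(3) AB that(3) by (simp add: pairwise_def)
          then have "interior {Inf A..Sup A} \<inter> interior {Inf B..Sup B} = {}"
            by (simp add: Icc(1) AB)
          then have "{max (Inf A) (Inf B)<..<min (Sup A) (Sup B)} = {}"
            by (auto simp: interior_atLeastAtMost_real)
          then have "min (Sup A) (Sup B) \<le> max (Inf A) (Inf B)" by (simp add: not_less)
          then show ?thesis using lt[OF AB(1)] lt[OF AB(2)]
            by (auto simp: nonoverlapping_def min_def max_def split: if_splits)
        qed
        have "sorted_wrt (\<lambda>A B. nonoverlapping (Inf A, Sup A) (Inf B, Sup B)) Ks"
        proof (rule sorted_wrt_mono_rel)
          show "sorted_wrt (\<noteq>) Ks" using Ks(2) by (simp add: distinct_conv_nth sorted_wrt_iff_nth_less)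
        qed (use no Ks in auto)
        moreover have sub: "-r \<le> Inf K" "Inf K \<le> Sup K" "Sup K \<le> r" if "K \<in> D'" for K
        proof -
          have K: "K \<in> D" using that D' by auto
          have "{Inf K..Sup K} \<subseteq> {-r..r}" using D(2)[OF K] Icc(1)[OF K] by (simp add: cbox_interval)
          then show "-r \<le> Inf K" "Inf K \<le> Sup K" "Sup K \<le> r" using Icc(2)[OF K] by simp_all
        qed
        ultimately have ivs: "intervals (-r) r xs"
          unfolding xs_def using Ks by (auto simp: intervals_def sorted_wrt_map)
        have "total_length xs = (\<Sum>p\<leftarrow>xs. LINT t:{fst p..snd p}|lborel. indicator (\<Union>D) t)"
          unfolding total_length_def
        proof (intro arg_cong[where f=sum_list] map_cong refl)
          fix p assume "p \<in> set xs"
          then obtain K where K: "K \<in> D" "p = (Inf K, Sup K)" using Ks D' by (auto simp: xs_def)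
          have "(LINT t:{fst p..snd p}|lborel. indicator (\<Union>D) t) = (LINT t:{Inf K..Sup K}|lborel. 1 :: real)"
            unfolding K(2) fst_conv snd_conv Icc(1)[OF K(1)]
            using K(1) by (intro set_lebesgue_integral_cong) (auto simp: KB indicator_def)
          also have "\<dots> = Sup K - Inf K"
            using Icc(2)[OF K(1)] by (simp add: set_lebesgue_integral_def)
          finally show "snd p - fst p = (LINT t:{fst p..snd p}|lborel. indicator (\<Union>D) t)"
            using K(2) by simp
        qed
        also have "\<dots> \<le> measure lborel (\<Union>D)"
          using sum_set_integral_intervals_le[OF ivs h] h2 by simp
        also have "\<dots> < \<delta>"
          using D(6) S(2) \<delta>(1) UB by simp
        finally have var: "variation F xs < \<epsilon>" using \<delta>(2) ivs by blast
        have "emeasure ?M (\<Union>D') \<le> (\<Sum>K\<in>D'. emeasure ?M K)"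
          using emeasure_subadditive_finite[of D' "\<lambda>K. K" ?M] D' KB by auto
        also have "\<dots> = (\<Sum>K\<in>D'. ennreal (F (Sup K) - F (Inf K)))"
        proof (intro sum.cong refl)
          fix K assume "K \<in> D'"
          then have K: "K \<in> D" using D' by auto
          show "emeasure ?M K = ennreal (F (Sup K) - F (Inf K))"
            using emeasure_interval_measure_Icc[OF Icc(2)[OF K] mono cont] Icc(1)[OF K] by simp
        qed
        also have "\<dots> = ennreal (\<Sum>K\<in>D'. F (Sup K) - F (Inf K))"
          using sub mono by (intro sum_ennreal) auto
        also have "(\<Sum>K\<in>D'. F (Sup K) - F (Inf K)) = (\<Sum>K\<leftarrow>Ks. F (Sup K) - F (Inf K))"
          using Ks by (simp add: sum_list_distinct_conv_sum_set)
        also have "\<dots> \<le> variation F xs"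
          unfolding variation_def xs_def by (simp add: o_def sum_list_mono)
        finally show ?thesis using var by (meson ennreal_leI less_imp_le order_trans)
      qed
      show ?thesis
      proof (cases "D = {}")
        case True then show ?thesis using D(4) by simp
      next
        \<comment> \<open>The cover is enumerated with \<open>from_nat_into\<close>, possibly with
          repetitions, and exhausted by finite unions.\<close>
        case False
        define A where "A = (\<lambda>n. \<Union>(from_nat_into D ` {..<n}))"
        have rng: "from_nat_into D i \<in> D" for i using False by (rule from_nat_into)
        have A: "range A \<subseteq> sets ?M"
          using KB[OF rng] by (auto simp: A_def)
        have A2: "incseq A" unfolding A_def incseq_def by fastforce
        have "\<Union>D = (\<Union>n. A n)"
          using range_from_nat_into[OF False D(1)] by (auto simp: A_def) blast
        then have "emeasure ?M (\<Union>D) = (SUP n. emeasure ?M (A n))"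
          using SUP_emeasure_incseq[OF A A2] by simp
        also have "\<dots> \<le> ennreal \<epsilon>"
          unfolding A_def by (intro SUP_least fin) (use rng in auto)
        finally have "emeasure ?M (\<Union>D) \<le> ennreal \<epsilon>" .
        moreover have "emeasure ?M ?S \<le> emeasure ?M (\<Union>D)"
          using D(4) UB by (intro emeasure_mono) auto
        ultimately show ?thesis by simp
      qed
    qed
    then have "emeasure ?M ?S \<le> 0 + ennreal \<epsilon>" if "\<epsilon> > 0" for \<epsilon> using that by simp
    then have "emeasure ?M ?S \<le> 0" by (rule ennreal_le_epsilon)
    then show ?thesis using N by (auto simp: null_sets_def cbox_interval r_def)
  qed
  have eq: "N = (\<Union>n. N \<inter> {-real (Suc n)..real (Suc n)})"
  proof -
    have "\<exists>n. x \<in> {-real (Suc n)..real (Suc n)}" for x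
    proof -
      obtain n where "\<bar>x\<bar> \<le> real n" using real_arch_simple by blast
      then show ?thesis by (intro exI[of _ n]) auto
    qed
    then show ?thesis by blast
  qed
  show "N \<in> null_sets ?M" by (subst eq) (rule null_sets_UN[OF bounded])
qed

text \<open>\<open>F\<close> is extended by constants to a monotone, absolutely continuous function
  on the line; the density is the Radon-Nikodym derivative of its Stieltjes measure. By continuity
  this measure gives a closed interval exactly the increment of \<open>F\<close>.\<close>

lemma ac_mono_density:
  assumes ac: "ac_lists a b F" and mono: "\<And>x y. a \<le> x \<Longrightarrow> x \<le> y \<Longrightarrow> y \<le> b \<Longrightarrow> F x \<le> F y"
    and ab: "a \<le> b"
  obtains f where "integrable lborel f" "\<And>t. t \<in> {a..b} \<Longrightarrow> F t = F a + (LINT s:{a..t}|lborel. f s)"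
proof -
  define cl where "cl = (\<lambda>x. max a (min b x))"
  define G where "G = (\<lambda>x. F (cl x))"
  have cl: "cl x \<in> {a..b}" "x \<in> {a..b} \<Longrightarrow> cl x = x" "x \<le> y \<Longrightarrow> cl x \<le> cl y"
      "x \<le> y \<Longrightarrow> cl y - cl x \<le> y - x" for x y
    using ab by (auto simp: cl_def)
  have monoG: "G x \<le> G y" if "x \<le> y" for x y
    unfolding G_def using cl(1)[of x] cl(1)[of y] cl(3)[OF that] by (intro mono) auto
  have acG: "\<exists>\<delta>>0. \<forall>c d xs. intervals c d xs \<and> total_length xs < \<delta> \<longrightarrow> variation G xs < \<epsilon>"
    if "\<epsilon> > 0" for \<epsilon>
  proof -
    from ac[unfolded ac_lists_def, rule_format, OF that] obtain \<delta> where \<delta>: "\<delta> > 0"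
      "\<forall>xs. intervals a b xs \<and> total_length xs < \<delta> \<longrightarrow> variation F xs < \<epsilon>" by blast
    show ?thesis
    proof (intro exI[of _ \<delta>] conjI allI impI)
      fix c d xs assume xs: "intervals c d xs \<and> total_length xs < \<delta>"
      have "intervals a b (clip cl xs)"
        by (rule intervals_clip[of c d]) (use xs cl in \<open>auto simp: mono_def\<close>)
      moreover have "total_length (clip cl xs) \<le> total_length xs"
        unfolding total_length_def clip_def using xs cl(4)
        by (auto simp: o_def intervals_def intro!: sum_list_mono)
      ultimately have "variation F (clip cl xs) < \<epsilon>" using \<delta>(2) xs by auto
      then show "variation G xs < \<epsilon>"
        by (simp add: variation_def clip_def G_def o_def)
    qed (use \<delta> in auto)
  qed
  have cont: "continuous_on UNIV G"
  proof (clarsimp simp: continuous_on_iff dist_real_def)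
    fix x \<epsilon> :: real assume "\<epsilon> > 0"
    from acG[OF this] obtain \<delta> where \<delta>: "\<delta> > 0"
      "\<forall>c d xs. intervals c d xs \<and> total_length xs < \<delta> \<longrightarrow> variation G xs < \<epsilon>" by blast
    have "\<bar>G y - G x\<bar> < \<epsilon>" if "\<bar>y - x\<bar> < \<delta>" for y
      using \<delta>(2)[rule_format, of "min x y" "max x y" "[(min x y, max x y)]"] that
      by (cases "x \<le> y") (auto simp: intervals_def total_length_def variation_def abs_minus_commute)
    with \<delta>(1) show "\<exists>d>0. \<forall>x'. \<bar>x' - x\<bar> < d \<longrightarrow> \<bar>G x' - G x\<bar> < \<epsilon>" by blast
  qed
  have ac': "absolutely_continuous lborel (interval_measure G)"
    by (rule ac_mono_absolutely_continuous[OF monoG cont acG])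
  obtain f where f: "f \<in> borel_measurable borel" "density lborel f = interval_measure G"
    using sigma_finite_measure.Radon_Nikodym[OF sigma_finite_lborel ac'] by auto
  have ind: "(\<integral>\<^sup>+s. f s * indicator {a..t} s \<partial>lborel) = ennreal (F t - F a)" if "t \<in> {a..b}" for t
  proof -
    have "(\<integral>\<^sup>+s. f s * indicator {a..t} s \<partial>lborel) = emeasure (interval_measure G) {a..t}"
      using f by (simp add: emeasure_density flip: f(2))
    also have "\<dots> = ennreal (G t - G a)"
      using that by (intro emeasure_interval_measure_Icc monoG cont) auto
    finally show ?thesis using that cl(2)[of t] cl(2)[of a] ab by (simp add: G_def)
  qed
  define g where "g = (\<lambda>s. enn2real (f s * indicator {a..b} s))"
  have g[measurable]: "g \<in> borel_measurable borel" using f(1) by (simp add: g_def)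
  \<comment> \<open>The derivative takes extended values; its finite integral over
    \<open>{a..b}\<close> makes it finite almost everywhere there, so it equals a real function
    \<open>g\<close>.\<close>
  have "AE s in lborel. f s * indicator {a..b} s \<noteq> \<infinity>"
    using f(1) ind[of b] ab by (intro nn_integral_noteq_infinite) auto
  then have ae: "AE s in lborel. ennreal (g s) = f s * indicator {a..b} s"
    by eventually_elim (auto simp: g_def less_top)
  have g0: "g s \<ge> 0" for s by (simp add: g_def)
  have nn: "(\<integral>\<^sup>+s. ennreal (indicator {a..t} s * g s) \<partial>lborel) = ennreal (F t - F a)" if "t \<in> {a..b}" for t
  proof -
    have "(\<integral>\<^sup>+s. ennreal (indicator {a..t} s * g s) \<partial>lborel) = (\<integral>\<^sup>+s. f s * indicator {a..t} s \<partial>lborel)"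
    proof (rule nn_integral_cong_AE)
      show "AE s in lborel. ennreal (indicator {a..t} s * g s) = f s * indicator {a..t} s"
        using ae by eventually_elim (use that in \<open>auto simp: indicator_def\<close>)
    qed
    then show ?thesis using ind[OF that] by simp
  qed
  have "(\<integral>\<^sup>+s. ennreal (norm (g s)) \<partial>lborel) = (\<integral>\<^sup>+s. ennreal (indicator {a..b} s * g s) \<partial>lborel)"
    by (intro nn_integral_cong) (auto simp: g_def indicator_def)
  then have int: "integrable lborel g"
    using nn[of b] ab by (intro integrableI_bounded) auto
  have "F t = F a + (LINT s:{a..t}|lborel. g s)" if "t \<in> {a..b}" for t
  proof -
    have "ennreal (LINT s:{a..t}|lborel. g s) = ennreal (F t - F a)"
      unfolding nn[OF that, symmetric] set_lebesgue_integral_def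
      using set_integrable_lborel_subset[OF int, of "{a..t}"] g0
      by (subst nn_integral_eq_integral) (auto simp: set_integrable_def)
    moreover have "F t \<ge> F a" using mono[of a t] that by auto
    moreover have "(LINT s:{a..t}|lborel. g s) \<ge> 0"
      unfolding set_lebesgue_integral_def by (rule integral_nonneg_AE) (auto simp: g0)
    ultimately show ?thesis by simp
  qed
  with int show ?thesis by (rule that)
qed

text \<open>\<open>w\<close> is the difference of P and P - w, with P its positive variation. Both
  are nondecreasing and absolutely continuous, so the difference of their densities serves, and
  Lebesgue differentiation identifies it with the derivative.\<close>

lemma abs_cont_on_FTC:
  assumes w: "abs_cont_on a b w" and ab: "a \<le> b"
  obtains f where "integrable lborel f" "\<And>t. t \<in> {a..b} \<Longrightarrow> w t = w a + (LINT s:{a..t}|lborel. f s)"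
    "AE t in lborel. t \<in> {a<..<b} \<longrightarrow> (w has_real_derivative f t) (at t)"
proof -
  have ac: "ac_lists a b w" by (rule abs_cont_on_imp_ac_lists[OF w])
  define P where "P = positive_variation w a"
  have acP: "ac_lists a b P" unfolding P_def by (rule ac_lists_positive_variation[OF ac])
  have acN: "ac_lists a b (\<lambda>x. P x - w x)" by (rule ac_lists_diff[OF acP ac])
  have P: "P x + max 0 (w y - w x) \<le> P y" if "a \<le> x" "x \<le> y" "y \<le> b" for x y
    unfolding P_def by (rule positive_variation_mono[OF ac that])
  obtain p where p: "integrable lborel p" "\<And>t. t \<in> {a..b} \<Longrightarrow> P t = P a + (LINT s:{a..t}|lborel. p s)"
  proof (rule ac_mono_density[OF acP _ ab])
    show "P x \<le> P y" if "a \<le> x" "x \<le> y" "y \<le> b" for x y using P[OF that] by simp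
  qed blast
  obtain q where q: "integrable lborel q"
    "\<And>t. t \<in> {a..b} \<Longrightarrow> P t - w t = P a - w a + (LINT s:{a..t}|lborel. q s)"
  proof (rule ac_mono_density[OF acN _ ab])
    show "P x - w x \<le> P y - w y" if "a \<le> x" "x \<le> y" "y \<le> b" for x y using P[OF that] by simp
  qed blast
  \<comment> \<open>Vanishing outside \<open>{a..b}\<close> makes the integral from minus infinity,
    which Lebesgue differentiation uses, equal to the integral from \<open>a\<close>.\<close>
  define f where "f = (\<lambda>s. indicator {a..b} s * (p s - q s))"
  have pq: "integrable lborel (\<lambda>s. p s - q s)"
    by (rule Bochner_Integration.integrable_diff[OF p(1) q(1)])
  have f: "integrable lborel f"
    using set_integrable_lborel_subset[OF pq, of "{a..b}"] by (simp add: f_def set_integrable_def)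
  have w_eq: "w t = w a + (LINT s:{a..t}|lborel. f s)" if "t \<in> {a..b}" for t
  proof -
    have "(LINT s:{a..t}|lborel. f s) = (LINT s:{a..t}|lborel. p s - q s)"
      using that by (intro set_lebesgue_integral_cong) (auto simp: f_def)
    also have "\<dots> = (LINT s:{a..t}|lborel. p s) - (LINT s:{a..t}|lborel. q s)"
      by (intro set_integral_diff set_integrable_lborel_subset p q) auto
    finally show ?thesis using p(2)[OF that] q(2)[OF that] by simp
  qed
  have "(w has_real_derivative f t) (at t)" if t: "t \<in> {a<..<b}"
    and D: "((\<lambda>t. LINT y:{..t}|lborel. f y) has_real_derivative f t) (at t)" for t
  proof (rule has_field_derivative_transform_within_open[OF _ open_greaterThanLessThan t])
    show "((\<lambda>t. w a + (LINT y:{..t}|lborel. f y)) has_real_derivative f t) (at t)"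
      using DERIV_add[OF DERIV_const D] by simp
    fix x assume "x \<in> {a<..<b}"
    have "(LINT y:{..x}|lborel. f y) = (LINT y:{a..x}|lborel. f y)"
      unfolding set_lebesgue_integral_def
      by (intro Bochner_Integration.integral_cong) (auto simp: f_def indicator_def)
    then show "w a + (LINT y:{..x}|lborel. f y) = w x"
      using w_eq[of x] \<open>x \<in> {a<..<b}\<close> by simp
  qed
  with lebesgue_differentiation[OF f]
  have "AE t in lborel. t \<in> {a<..<b} \<longrightarrow> (w has_real_derivative f t) (at t)"
    by (auto elim: eventually_mono)
  with f w_eq show ?thesis by (rule that)
qed

section \<open>Convolution of integrable functions\<close>

text \<open>The integral runs over the whole line; for factors vanishing on the negative half line
  it is the integral from 0 to \<open>t\<close>. Where it diverges its value is 0 by convention, so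
  additivity and associativity are claimed only almost everywhere.\<close>

definition convolution :: "(real \<Rightarrow> real) \<Rightarrow> (real \<Rightarrow> real) \<Rightarrow> real \<Rightarrow> real" where
  "convolution f g t = (\<integral>\<tau>. f (t - \<tau>) * g \<tau> \<partial>lborel)"

lemma lborel_integral_reflect:
  fixes f :: "real \<Rightarrow> real"
  shows "(\<integral>\<tau>. f (t - \<tau>) \<partial>lborel) = (\<integral>\<tau>. f \<tau> \<partial>lborel)"
  using lborel_integral_real_affine[of "-1" f t] by simp

lemma integrable_convolution_pair:
  fixes f g :: "real \<Rightarrow> real"
  assumes f: "integrable lborel f" and g: "integrable lborel g"
  shows "integrable (lborel \<Otimes>\<^sub>M lborel) (\<lambda>(t, \<tau>). f (t - \<tau>) * g \<tau>)"
proof -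
  have [measurable]: "f \<in> borel_measurable borel" "g \<in> borel_measurable borel"
    using borel_measurable_integrable[OF f] borel_measurable_integrable[OF g] by auto
  show ?thesis
  proof (rule integrableI_bounded)
    show "(\<lambda>(t, \<tau>). f (t - \<tau>) * g \<tau>) \<in> borel_measurable (lborel \<Otimes>\<^sub>M lborel)" by measurable
    have sh: "(\<integral>\<^sup>+ t. ennreal \<bar>f (t - \<tau>)\<bar> \<partial>lborel) = (\<integral>\<^sup>+ t. ennreal \<bar>f t\<bar> \<partial>lborel)" for \<tau> :: real
      using nn_integral_real_affine[of "\<lambda>t. ennreal \<bar>f t\<bar>" 1 "-\<tau>"] by simp
    have "(\<integral>\<^sup>+ z. ennreal (norm (case z of (t, \<tau>) \<Rightarrow> f (t - \<tau>) * g \<tau>)) \<partial>(lborel \<Otimes>\<^sub>M lborel))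
        = (\<integral>\<^sup>+ \<tau>. \<integral>\<^sup>+ t. ennreal \<bar>f (t - \<tau>)\<bar> * ennreal \<bar>g \<tau>\<bar> \<partial>lborel \<partial>lborel)"
      by (subst lborel_pair.nn_integral_snd[symmetric]) (auto simp: abs_mult ennreal_mult')
    also have "\<dots> = (\<integral>\<^sup>+ \<tau>. (\<integral>\<^sup>+ t. ennreal \<bar>f t\<bar> \<partial>lborel) * ennreal \<bar>g \<tau>\<bar> \<partial>lborel)"
      by (subst nn_integral_multc) (auto simp: sh)
    also have "\<dots> = (\<integral>\<^sup>+ t. ennreal \<bar>f t\<bar> \<partial>lborel) * (\<integral>\<^sup>+ \<tau>. ennreal \<bar>g \<tau>\<bar> \<partial>lborel)"
      by (subst nn_integral_cmult) auto
    also have "\<dots> < \<infinity>"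
      using f g by (auto simp: integrable_iff_bounded ennreal_mult_less_top)
    finally show "(\<integral>\<^sup>+ z. ennreal (norm (case z of (t, \<tau>) \<Rightarrow> f (t - \<tau>) * g \<tau>)) \<partial>(lborel \<Otimes>\<^sub>M lborel)) < \<infinity>" .
  qed
qed

lemma AE_integrable_convolution:
  fixes f g :: "real \<Rightarrow> real"
  assumes "integrable lborel f" and "integrable lborel g"
  shows "AE t in lborel. integrable lborel (\<lambda>\<tau>. f (t - \<tau>) * g \<tau> :: real)"
  using lborel_pair.AE_integrable_fst'[OF integrable_convolution_pair[OF assms]] by simp

lemma integrable_convolution:
  assumes "integrable lborel f" and "integrable lborel g"
  shows "integrable lborel (convolution f g)"
  unfolding convolution_def
  using lborel_pair.integrable_fst'[OF integrable_convolution_pair[OF assms]] by simp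

lemma integral_convolution:
  assumes f: "integrable lborel f" and g: "integrable lborel g"
  shows "(\<integral>t. convolution f g t \<partial>lborel) = (\<integral>t. f t \<partial>lborel) * (\<integral>t. g t \<partial>lborel)"
proof -
  have sh: "(\<integral> t. f (t - \<tau>) \<partial>lborel) = (\<integral> t. f t \<partial>lborel)" for \<tau> :: real
    using lborel_integral_real_affine[of "1" f "-\<tau>"] by simp
  have "(\<integral>t. convolution f g t \<partial>lborel) = (\<integral>\<tau>. \<integral>t. f (t - \<tau>) * g \<tau> \<partial>lborel \<partial>lborel)"
    unfolding convolution_def
    using lborel_pair.Fubini_integral[OF integrable_convolution_pair[OF assms]] by simp
  then show ?thesis by (simp add: sh)
qed

lemma convolution_commute: "convolution f g t = convolution g f t"
  unfolding convolution_def
  using lborel_integral_reflect[of "\<lambda>\<tau>. g (t - \<tau>) * f \<tau>" t] by (simp add: mult.commute)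

text \<open>Fubini at a fixed \<open>t\<close> needs the iterated convolution of the absolute values
  to converge there, and this holds for almost every \<open>t\<close>.\<close>

lemma convolution_assoc_AE:
  assumes f: "integrable lborel f" and g: "integrable lborel g" and h: "integrable lborel h"
  shows "AE t in lborel. convolution f (convolution g h) t = convolution (convolution f g) h t"
proof -
  have [measurable]: "f \<in> borel_measurable borel" "g \<in> borel_measurable borel" "h \<in> borel_measurable borel"
    using borel_measurable_integrable[OF f] borel_measurable_integrable[OF g]
      borel_measurable_integrable[OF h] by auto
  let ?a = "\<lambda>f x. \<bar>f x\<bar> :: real"
  have abs: "integrable lborel (?a f)" "integrable lborel (?a g)" "integrable lborel (?a h)"
    using f g h by auto
  have "AE t in lborel. integrable lborel (\<lambda>\<tau>. ?a f (t - \<tau>) * convolution (?a g) (?a h) \<tau>)"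
    by (intro AE_integrable_convolution integrable_convolution abs)
  then show ?thesis
  proof eventually_elim
    case (elim t)
    have int: "integrable (lborel \<Otimes>\<^sub>M lborel) (\<lambda>(\<tau>, \<sigma>). f (t - \<tau>) * (g (\<tau> - \<sigma>) * h \<sigma>))"
    proof (rule lborel_pair.Fubini_integrable)
      show "(\<lambda>(\<tau>, \<sigma>). f (t - \<tau>) * (g (\<tau> - \<sigma>) * h \<sigma>)) \<in> borel_measurable (lborel \<Otimes>\<^sub>M lborel)"
        by measurable
      show "integrable lborel (\<lambda>x. \<integral> y. norm (case (x, y) of (\<tau>, \<sigma>) \<Rightarrow> f (t - \<tau>) * (g (\<tau> - \<sigma>) * h \<sigma>)) \<partial>lborel)"
        using elim by (simp add: convolution_def abs_mult)
      show "AE x in lborel. integrable lborel (\<lambda>y. case (x, y) of (\<tau>, \<sigma>) \<Rightarrow> f (t - \<tau>) * (g (\<tau> - \<sigma>) * h \<sigma>))"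
        using AE_integrable_convolution[OF g h] by eventually_elim simp
    qed
    have inner: "convolution f g (t - \<sigma>) = (\<integral>\<tau>. f (t - \<tau>) * g (\<tau> - \<sigma>) \<partial>lborel)" for \<sigma>
      unfolding convolution_def
      using lborel_integral_real_affine[of 1 "\<lambda>\<rho>. f (t - \<sigma> - \<rho>) * g \<rho>" "-\<sigma>"]
      by (simp add: algebra_simps)
    have "convolution f (convolution g h) t = (\<integral>\<tau>. \<integral>\<sigma>. f (t - \<tau>) * (g (\<tau> - \<sigma>) * h \<sigma>) \<partial>lborel \<partial>lborel)"
      by (simp add: convolution_def)
    also have "\<dots> = (\<integral>\<sigma>. \<integral>\<tau>. f (t - \<tau>) * (g (\<tau> - \<sigma>) * h \<sigma>) \<partial>lborel \<partial>lborel)"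
      using lborel_pair.Fubini_integral[OF int] by simp
    also have "\<dots> = (\<integral>\<sigma>. convolution f g (t - \<sigma>) * h \<sigma> \<partial>lborel)"
      by (simp add: inner mult.assoc[symmetric])
    finally show ?case by (simp add: convolution_def)
  qed
qed

text \<open>At \<open>t\<close> up to \<open>T\<close> causal factors are evaluated only on
  \<open>{0..T}\<close>, and null sets are invisible to the integral. Almost everywhere equal
  factors thus give equality at every such \<open>t\<close>.\<close>

lemma convolution_causal_cong:
  assumes [measurable]: "f \<in> borel_measurable borel" "g \<in> borel_measurable borel"
      "f' \<in> borel_measurable borel" "g' \<in> borel_measurable borel"
    and f: "AE x in lborel. x \<le> T \<longrightarrow> f x = f' x" and g: "AE x in lborel. x \<le> T \<longrightarrow> g x = g' x"
    and z: "\<And>x. x < 0 \<Longrightarrow> f x = 0" "\<And>x. x < 0 \<Longrightarrow> g x = 0"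
           "\<And>x. x < 0 \<Longrightarrow> f' x = 0" "\<And>x. x < 0 \<Longrightarrow> g' x = 0"
    and t: "t \<le> T"
  shows "convolution f g t = convolution f' g' t"
  unfolding convolution_def
proof (rule integral_cong_AE)
  have "AE x in lborel. t - x \<le> T \<longrightarrow> f (t - x) = f' (t - x)"
    by (rule AE_lborel_reflect[OF f])
  with g show "AE \<tau> in lborel. f (t - \<tau>) * g \<tau> = f' (t - \<tau>) * g' \<tau>"
  proof eventually_elim
    case (elim \<tau>)
    consider "\<tau> < 0" | "\<tau> > t" | "0 \<le> \<tau>" "\<tau> \<le> t" by linarith
    then show ?case using elim t z by cases auto
  qed
qed measurable

section \<open>Injectivity of the Laplace transform\<close>

text \<open>In x = exp(-t) the hypotheses say that \<open>f\<close> annihilates all monomials.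
  Weierstrass approximation extends this to continuous functions of \<open>x\<close>, a limit of
  ramps to indicators of half lines, and differentiating the resulting zero primitive gives
  \<open>f\<close>.\<close>

lemma lerch:
  fixes f :: "real \<Rightarrow> real"
  assumes f: "integrable lborel f" and neg: "\<And>t. t < 0 \<Longrightarrow> f t = 0"
    and zero: "\<And>n::nat. (\<integral>t. exp (- (real n * t)) * f t \<partial>lborel) = 0"
  shows "AE t in lborel. f t = 0"
proof -
  have [measurable]: "f \<in> borel_measurable borel" using borel_measurable_integrable[OF f] by simp
  have bnd: "integrable lborel (\<lambda>t. \<phi> (exp (- t)) * f t)"
    if "continuous_on UNIV \<phi>" "\<And>x. x \<in> {0..1} \<Longrightarrow> \<bar>\<phi> x\<bar> \<le> B" for \<phi> :: "real \<Rightarrow> real" and B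
  proof (rule Bochner_Integration.integrable_bound)
    show "integrable lborel (\<lambda>t. B * f t)" using f by simp
    have [measurable]: "\<phi> \<in> borel_measurable borel" by (rule borel_measurable_continuous_onI[OF that(1)])
    show "(\<lambda>t. \<phi> (exp (- t)) * f t) \<in> borel_measurable lborel" by measurable
    have "\<bar>\<phi> (exp (- t)) * f t\<bar> \<le> \<bar>B * f t\<bar>" for t
    proof (cases "t < 0")
      case False
      then have "\<bar>\<phi> (exp (- t))\<bar> \<le> \<bar>B\<bar>" using that(2)[of "exp (-t)"] by auto
      then show ?thesis by (simp add: abs_mult mult_right_mono)
    qed (simp add: neg)
    then show "AE t in lborel. norm (\<phi> (exp (- t)) * f t) \<le> norm (B * f t)" by simp
  qed
  have cont: "(\<integral>t. \<phi> (exp (- t)) * f t \<partial>lborel) = 0" if \<phi>: "continuous_on UNIV \<phi>" for \<phi> :: "real \<Rightarrow> real"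
  proof -
    have "continuous_on {0..1} \<phi>" using \<phi> continuous_on_subset by blast
    then have "bounded (\<phi> ` {0..1})" by (intro compact_imp_bounded compact_continuous_image) auto
    then obtain B where "\<forall>y\<in>\<phi> ` {0..1}. norm y \<le> B" unfolding bounded_iff by blast
    then have B: "\<And>x. x \<in> {0..1} \<Longrightarrow> \<bar>\<phi> x\<bar> \<le> B" by simp
    have small: "\<bar>\<integral>t. \<phi> (exp (- t)) * f t \<partial>lborel\<bar> \<le> 0 + \<epsilon> * (\<integral>t. \<bar>f t\<bar> \<partial>lborel)" if "\<epsilon> > 0" for \<epsilon>
    proof -
      obtain p where p: "real_polynomial_function p" "\<And>x. x \<in> {0..1} \<Longrightarrow> \<bar>\<phi> x - p x\<bar> < \<epsilon>"
      proof (rule Stone_Weierstrass_real_polynomial_function[OF compact_Icc \<open>continuous_on {0..1} \<phi>\<close> \<open>\<epsilon> > 0\<close>], goal_cases)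
        case (1 g)
        show ?case by (rule that[OF 1(2,3)])
      qed
      obtain a n where an: "p = (\<lambda>x. \<Sum>i\<le>(n::nat). a i * x ^ i)"
        using p(1) real_polynomial_function_iff_sum by blast
      have expi: "integrable lborel (\<lambda>t. exp (- (real i * t)) * f t)" for i :: nat
      proof -
        have "continuous_on UNIV (\<lambda>x::real. x ^ i)" by (intro continuous_intros)
        moreover have "\<bar>x ^ i\<bar> \<le> 1" if "x \<in> {0..1}" for x :: real
          using that by (simp add: power_abs power_le_one)
        ultimately have "integrable lborel (\<lambda>t. exp (- t) ^ i * f t)" by (rule bnd)
        then show ?thesis by (simp add: exp_of_nat_mult[symmetric])
      qed
      have "(\<integral>t. p (exp (- t)) * f t \<partial>lborel) = (\<integral>t. (\<Sum>i\<le>n. a i * (exp (- (real i * t)) * f t)) \<partial>lborel)"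
        by (intro Bochner_Integration.integral_cong refl)
          (simp add: an sum_distrib_right exp_of_nat_mult[symmetric] mult.assoc)
      also have "\<dots> = (\<Sum>i\<le>n. a i * (\<integral>t. exp (- (real i * t)) * f t \<partial>lborel))"
        using expi by (subst Bochner_Integration.integral_sum) auto
      also have "\<dots> = 0" using zero by simp
      finally have p0: "(\<integral>t. p (exp (- t)) * f t \<partial>lborel) = 0" .
      have contp: "continuous_on UNIV p" unfolding an by (intro continuous_intros)
      have "\<bar>\<phi> x - p x\<bar> \<le> \<epsilon>" if "x \<in> {0..1}" for x using p(2)[OF that] by simp
      then have id: "integrable lborel (\<lambda>t. (\<phi> (exp (- t)) - p (exp (- t))) * f t)"
        by (intro bnd[of "\<lambda>x. \<phi> x - p x" \<epsilon>]) (auto intro!: continuous_intros \<phi> contp)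
      have i\<phi>: "integrable lborel (\<lambda>t. \<phi> (exp (- t)) * f t)" by (rule bnd[OF \<phi> B])
      have "integrable lborel (\<lambda>t. p (exp (- t)) * f t)"
        using Bochner_Integration.integrable_diff[OF i\<phi> id] by (simp add: algebra_simps)
      then have "(\<integral>t. \<phi> (exp (- t)) * f t \<partial>lborel) = (\<integral>t. (\<phi> (exp (- t)) - p (exp (- t))) * f t \<partial>lborel)"
        using p0 i\<phi> by (simp add: left_diff_distrib)
      also have "\<bar>\<dots>\<bar> \<le> (\<integral>t. \<bar>(\<phi> (exp (- t)) - p (exp (- t))) * f t\<bar> \<partial>lborel)"
        using integral_norm_bound[of lborel "\<lambda>t. (\<phi> (exp (- t)) - p (exp (- t))) * f t"] by simp
      also have "\<dots> \<le> (\<integral>t. \<epsilon> * \<bar>f t\<bar> \<partial>lborel)"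
      proof (rule integral_mono)
        show "\<bar>(\<phi> (exp (- t)) - p (exp (- t))) * f t\<bar> \<le> \<epsilon> * \<bar>f t\<bar>" for t
        proof (cases "t < 0")
          case False
          then have "\<bar>\<phi> (exp (- t)) - p (exp (- t))\<bar> \<le> \<epsilon>" using p(2)[of "exp (-t)"] by auto
          then show ?thesis by (simp add: abs_mult mult_right_mono)
        qed (simp add: neg)
      qed (use id f in auto)
      finally show ?thesis by simp
    qed
    have "\<bar>\<integral>t. \<phi> (exp (- t)) * f t \<partial>lborel\<bar> \<le> 0"
    proof -
      let ?A = "\<bar>\<integral>t. \<phi> (exp (- t)) * f t \<partial>lborel\<bar>" and ?N = "\<integral>t. \<bar>f t\<bar> \<partial>lborel"
      have N: "?N \<ge> 0" by simp
      have "?A \<le> 0 + e" if "e > 0" for e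
      proof -
        \<comment> \<open>The summand 1 avoids division by zero when the norm of \<open>f\<close>
          vanishes.\<close>
        have "?A \<le> 0 + e / (?N + 1) * ?N"
          using N that by (intro small) (simp add: add_nonneg_pos)
        also have "\<dots> = e * (?N / (?N + 1))" by simp
        also have "\<dots> \<le> e * 1"
        proof (rule mult_left_mono)
          have "x / (x + 1) \<le> 1" if "x \<ge> 0" for x :: real using that by (simp add: divide_le_eq)
          from this[OF N] show "?N / (?N + 1) \<le> 1" .
        qed (use that in simp)
        finally show ?thesis by simp
      qed
      then show ?thesis by (rule field_le_epsilon)
    qed
    then show ?thesis by simp
  qed
  have half: "(LINT t:{..<b}|lborel. f t) = 0" for b
  proof -
    \<comment> \<open>Continuous ramps that increase to the indicator of x > exp(-b), that is, of t
      < b.\<close>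
    define \<phi> where "\<phi> = (\<lambda>n::nat. \<lambda>x. min 1 (max 0 (real n * (x - exp (- b)))))"
    have lim: "(\<lambda>n. \<phi> n (exp (- t))) \<longlonglongrightarrow> indicator {..<b} t" for t
    proof (cases "t < b")
      case True
      then have pos: "exp (- t) - exp (- b) > 0" by simp
      obtain N where N: "1 / (exp (- t) - exp (- b)) \<le> real N" using real_arch_simple by blast
      have "\<phi> n (exp (- t)) = 1" if "n \<ge> N" for n
      proof -
        have "1 / (exp (- t) - exp (- b)) \<le> real n" using N that by linarith
        then have "1 \<le> real n * (exp (- t) - exp (- b))" using pos by (simp add: field_simps)
        then show ?thesis by (simp add: \<phi>_def)
      qed
      then have "\<forall>\<^sub>F n in sequentially. \<phi> n (exp (- t)) = 1" by (auto simp: eventually_sequentially)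
      then show ?thesis using True by (simp add: tendsto_eventually)
    next
      case False
      then have "\<phi> n (exp (- t)) = 0" for n
        by (simp add: \<phi>_def mult_nonneg_nonpos)
      then show ?thesis using False by simp
    qed
    have "(\<lambda>n. \<integral>t. \<phi> n (exp (- t)) * f t \<partial>lborel) \<longlonglongrightarrow> (\<integral>t. indicator {..<b} t * f t \<partial>lborel)"
    proof (rule integral_dominated_convergence[where w="\<lambda>t. \<bar>f t\<bar>"])
      show "AE t in lborel. (\<lambda>n. \<phi> n (exp (- t)) * f t) \<longlonglongrightarrow> indicator {..<b} t * f t"
        by (intro AE_I2 tendsto_mult_right lim)
      show "AE t in lborel. norm (\<phi> n (exp (- t)) * f t) \<le> \<bar>f t\<bar>" for n
        by (intro AE_I2) (auto simp: \<phi>_def abs_mult intro!: mult_left_le_one_le)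
      have [measurable]: "\<phi> n \<in> borel_measurable borel" for n unfolding \<phi>_def by measurable
      show "(\<lambda>t. \<phi> n (exp (- t)) * f t) \<in> borel_measurable lborel" for n by measurable
    qed (use f in auto)
    moreover have "(\<integral>t. \<phi> n (exp (- t)) * f t \<partial>lborel) = 0" for n
      by (rule cont) (auto simp: \<phi>_def intro!: continuous_intros)
    ultimately show ?thesis
      unfolding set_lebesgue_integral_def using LIMSEQ_unique[OF _ tendsto_const] by fastforce
  qed
  have half': "(LINT t:{..b}|lborel. f t) = 0" for b
    using half[of b] by (subst set_integral_discrete_difference[where X="{b}" and B="{..<b}"]) auto
  have "AE x in lborel. ((\<lambda>t. LINT y:{..t}|lborel. f y) has_real_derivative f x) (at x)"
    by (rule lebesgue_differentiation[OF f])
  then show ?thesis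
  proof eventually_elim
    case (elim x)
    then have "((\<lambda>t. 0) has_real_derivative f x) (at x)" by (simp add: half')
    then show ?case using DERIV_unique[OF _ DERIV_const] by blast
  qed
qed

section \<open>A rectangle contour in a horizontal strip\<close>

lemma contour_integral_linepath_shift:
  "contour_integral (linepath (a + c) (b + c)) f = contour_integral (linepath a b) (\<lambda>w. f (w + c))"
proof -
  have "linepath (a + c) (b + c) t = linepath a b t + c" for t
    by (simp add: linepath_def algebra_simps)
  then show ?thesis by (simp add: contour_integral_integral)
qed

text \<open>The imaginary part of Cauchy's identity: the lower side is real and disappears, and on
  the vertical sides the factor i from dw turns imaginary parts into real ones.\<close>

lemma strip_rectangle:
  fixes Q :: "complex \<Rightarrow> complex"
  assumes holo: "Q holomorphic_on {w. 0 \<le> Im w \<and> Im w \<le> pi}"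
    and real: "\<And>x. Im (Q (of_real x)) = 0" and R: "R > 0"
  shows "integral {-R..R} (\<lambda>x. Im (Q (Complex x pi))) =
         integral {0..pi} (\<lambda>\<theta>. Re (Q (Complex R \<theta>)) - Re (Q (Complex (-R) \<theta>)))"
proof -
  let ?S = "{w. 0 \<le> Im w \<and> Im w \<le> pi}"
  have contQ: "continuous_on ?S Q" by (rule holomorphic_on_imp_continuous_on[OF holo])
  let ?a = "of_real (-R) :: complex" and ?b = "of_real R :: complex"
  let ?c = "of_real R + \<i> * of_real pi" and ?d = "of_real (-R) + \<i> * of_real pi"
  let ?g = "linepath ?a ?b +++ linepath ?b ?c +++ linepath ?c ?d +++ linepath ?d ?a"
  have conv: "convex ?S"
  proof -
    have "?S = {w. Im w \<ge> 0} \<inter> {w. Im w \<le> pi}" by auto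
    then show ?thesis by (simp add: convex_Int convex_halfspace_Im_ge convex_halfspace_Im_le)
  qed
  have seg: "closed_segment u v \<subseteq> ?S" if "u \<in> ?S" "v \<in> ?S" for u v
    using that conv by (intro closed_segment_subset)
  have sub: "path_image ?g \<subseteq> ?S"
  proof -
    have "closed_segment ?a ?b \<subseteq> ?S" "closed_segment ?b ?c \<subseteq> ?S"
        "closed_segment ?c ?d \<subseteq> ?S" "closed_segment ?d ?a \<subseteq> ?S"
      by (rule seg; simp)+
    then show ?thesis by (simp add: path_image_join)
  qed
  have "(Q has_contour_integral 0) ?g"
    by (rule Cauchy_theorem_convex_simple[OF holo conv _ sub]) auto
  then have sum0: "contour_integral (linepath ?a ?b) Q + contour_integral (linepath ?b ?c) Q +
      contour_integral (linepath ?c ?d) Q + contour_integral (linepath ?d ?a) Q = 0"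
    by (rule has_chain_integral_chain_integral4)
  have int_h: "(\<lambda>x. Q (Complex x y)) integrable_on {a..b}" if "0 \<le> y" "y \<le> pi" for y a b
    by (intro integrable_continuous_interval continuous_on_compose2[OF contQ])
      (use that in \<open>auto intro!: continuous_intros simp: Complex_eq\<close>)
  have int_v: "(\<lambda>y. Q (Complex x y)) integrable_on {0..pi}" for x
    by (intro integrable_continuous_interval continuous_on_compose2[OF contQ])
      (auto intro!: continuous_intros simp: Complex_eq)
  have rev: "contour_integral (linepath v u) Q = - contour_integral (linepath u v) Q"
    if "u \<in> ?S" "v \<in> ?S" for u v
    using contour_integral_reverse_linepath[of u v Q] continuous_on_subset[OF contQ seg[OF that]] by simp
  have Reals: "contour_integral (linepath ?a ?b) f = integral {-R..R} (\<lambda>x. f (of_real x))" for f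
    using contour_integral_linepath_Reals_eq[of ?a ?b f] R by simp
  have 1: "contour_integral (linepath ?a ?b) Q = integral {-R..R} (\<lambda>x. Q (Complex x 0))"
    unfolding Reals by (simp add: Complex_eq)
  have 2: "contour_integral (linepath ?b ?c) Q = \<i> * integral {0..pi} (\<lambda>y. Q (Complex R y))"
    by (rule contour_integral_linepath_same_Re) (auto simp: pi_gt_zero)
  have 3: "contour_integral (linepath ?c ?d) Q = - integral {-R..R} (\<lambda>x. Q (Complex x pi))"
  proof -
    have "contour_integral (linepath ?c ?d) Q = - contour_integral (linepath ?d ?c) Q"
      by (rule rev) auto
    also have "contour_integral (linepath ?d ?c) Q = contour_integral (linepath ?a ?b) (\<lambda>w. Q (w + \<i> * of_real pi))"
      by (rule contour_integral_linepath_shift)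
    also have "\<dots> = integral {-R..R} (\<lambda>x. Q (of_real x + \<i> * of_real pi))"
      by (rule Reals)
    finally show ?thesis by (simp add: Complex_eq)
  qed
  have 4: "contour_integral (linepath ?d ?a) Q = - (\<i> * integral {0..pi} (\<lambda>y. Q (Complex (-R) y)))"
  proof -
    have "contour_integral (linepath ?d ?a) Q = - contour_integral (linepath ?a ?d) Q"
      by (rule rev) auto
    also have "contour_integral (linepath ?a ?d) Q = \<i> * integral {0..pi} (\<lambda>y. Q (Complex (-R) y))"
      by (rule contour_integral_linepath_same_Re) (auto simp: pi_gt_zero)
    finally show ?thesis .
  qed
  have ImI: "Im (integral S f) = integral S (\<lambda>x. Im (f x))" if "f integrable_on S" for f :: "real \<Rightarrow> complex" and S
    using integral_linear[OF that bounded_linear_Im] by (simp add: o_def)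
  have ReI: "Re (integral S f) = integral S (\<lambda>x. Re (f x))" if "f integrable_on S" for f :: "real \<Rightarrow> complex" and S
    using integral_linear[OF that bounded_linear_Re] by (simp add: o_def)
  have "Im (integral {-R..R} (\<lambda>x. Q (Complex x 0))) = 0"
    using real by (subst ImI[OF int_h]) (auto simp: Complex_eq)
  then have "Re (integral {0..pi} (\<lambda>y. Q (Complex R y))) - Im (integral {-R..R} (\<lambda>x. Q (Complex x pi)))
       - Re (integral {0..pi} (\<lambda>y. Q (Complex (-R) y))) = 0"
    using arg_cong[OF sum0, of Im] unfolding 1 2 3 4 by simp
  then have "integral {-R..R} (\<lambda>x. Im (Q (Complex x pi))) =
      integral {0..pi} (\<lambda>y. Re (Q (Complex R y))) - integral {0..pi} (\<lambda>y. Re (Q (Complex (-R) y)))"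
    by (simp add: ReI[OF int_v] ImI[OF int_h])
  also have "\<dots> = integral {0..pi} (\<lambda>\<theta>. Re (Q (Complex R \<theta>)) - Re (Q (Complex (-R) \<theta>)))"
    by (rule Henstock_Kurzweil_Integration.integral_diff[symmetric])
      (use integrable_linear[OF int_v bounded_linear_Re] in \<open>auto simp: o_def\<close>)
  finally show ?thesis .
qed

text \<open>On the vertical sides the integrand of the rectangle identity tends to \<open>-L\<close>
  uniformly over an interval of length pi. The sign condition makes the truncated integrals
  monotone, so their limit is a Lebesgue integral and not just a symmetric improper one.\<close>

lemma strip_integral:
  fixes Q :: "complex \<Rightarrow> complex"
  assumes holo: "Q holomorphic_on {w. 0 \<le> Im w \<and> Im w \<le> pi}"
    and real: "\<And>x. Im (Q (of_real x)) = 0"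
    and left: "\<And>x \<theta>. x \<ge> x0 \<Longrightarrow> 0 \<le> \<theta> \<Longrightarrow> \<theta> \<le> pi \<Longrightarrow> cmod (Q (Complex (-x) \<theta>) - of_real L) \<le> e x"
    and right: "\<And>x \<theta>. x \<ge> x0 \<Longrightarrow> 0 \<le> \<theta> \<Longrightarrow> \<theta> \<le> pi \<Longrightarrow> cmod (Q (Complex x \<theta>)) \<le> e x"
    and e: "(e \<longlongrightarrow> 0) at_top"
    and sgn: "\<And>x. Im (Q (Complex x pi)) \<le> 0"
  shows "has_bochner_integral lborel (\<lambda>x. - Im (Q (Complex x pi))) (pi * L)"
proof -
  let ?S = "{w. 0 \<le> Im w \<and> Im w \<le> pi}"
  let ?h = "\<lambda>x. - Im (Q (Complex x pi))"
  have contQ: "continuous_on ?S Q" by (rule holomorphic_on_imp_continuous_on[OF holo])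
  have conth: "continuous_on UNIV ?h"
    by (intro continuous_intros continuous_on_compose2[OF contQ]) (auto intro!: continuous_intros simp: Complex_eq)
  have h[measurable]: "?h \<in> borel_measurable borel" by (rule borel_measurable_continuous_onI[OF conth])
  have seth: "set_integrable lborel {-R..R} ?h" for R
    by (intro borel_integrable_atLeastAtMost' continuous_on_subset[OF conth]) auto
  have bound: "\<bar>(LINT x:{-R..R}|lborel. ?h x) - pi * L\<bar> \<le> 2 * pi * e R" if R: "R > 0" "R \<ge> x0" for R
  proof -
    have int_v: "(\<lambda>y. Q (Complex x y)) integrable_on {0..pi}" for x
      by (intro integrable_continuous_interval continuous_on_compose2[OF contQ])
        (auto intro!: continuous_intros simp: Complex_eq)
    let ?k = "\<lambda>\<theta>. Re (Q (Complex R \<theta>)) - Re (Q (Complex (-R) \<theta>))"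
    have ki: "?k integrable_on {0..pi}"
      by (rule Henstock_Kurzweil_Integration.integrable_diff)
        (use integrable_linear[OF int_v bounded_linear_Re] in \<open>auto simp: o_def\<close>)
    have "(LINT x:{-R..R}|lborel. ?h x) = - integral {-R..R} (\<lambda>x. Im (Q (Complex x pi)))"
      using set_borel_integral_eq_integral(2)[OF seth] by simp
    also have "\<dots> = - integral {0..pi} ?k"
      using strip_rectangle[OF holo real R(1)] by simp
    finally have eq: "(LINT x:{-R..R}|lborel. ?h x) - pi * L = - (integral {0..pi} ?k + pi * L)" by simp
    have "((\<lambda>\<theta>. ?k \<theta> + L) has_integral (integral {0..pi} ?k + pi * L)) {0..pi}"
      using has_integral_add[OF integrable_integral[OF ki] has_integral_const_real[of L 0 pi]] by simp
    \<comment> \<open>One \<open>e R\<close> comes from each vertical side.\<close>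
    moreover have "norm (?k \<theta> + L) \<le> 2 * e R" if "\<theta> \<in> {0..pi}" for \<theta>
    proof -
      have "\<bar>Re (Q (Complex R \<theta>))\<bar> \<le> e R"
        using right[OF R(2), of \<theta>] that abs_Re_le_cmod[of "Q (Complex R \<theta>)"] by auto
      moreover have "\<bar>Re (Q (Complex (-R) \<theta>)) - L\<bar> \<le> e R"
        using left[OF R(2), of \<theta>] that abs_Re_le_cmod[of "Q (Complex (-R) \<theta>) - of_real L"] by auto
      ultimately show ?thesis by (simp add: abs_if split: if_splits)
    qed
    moreover have "0 \<le> 2 * e R" using order_trans[OF norm_ge_zero right[OF R(2), of 0]] by simp
    ultimately have "norm (integral {0..pi} ?k + pi * L) \<le> 2 * e R * measure lborel {0..pi}"
      by (intro has_integral_bound_real[where f="\<lambda>\<theta>. ?k \<theta> + L"]) auto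
    then show ?thesis unfolding eq by (simp add: mult_ac)
  qed
  have e_seq: "(\<lambda>n::nat. 2 * pi * e (real n)) \<longlonglongrightarrow> 0"
    using tendsto_mult_right_zero[OF filterlim_compose[OF e filterlim_real_sequentially], of "2 * pi"] by simp
  have "(\<lambda>n::nat. (LINT x:{-real n..real n}|lborel. ?h x) - pi * L) \<longlonglongrightarrow> 0"
  proof (rule Lim_null_comparison[OF _ e_seq])
    obtain N where N: "x0 \<le> real N" using real_arch_simple by blast
    show "\<forall>\<^sub>F n in sequentially. norm ((LINT x:{-real n..real n}|lborel. ?h x) - pi * L) \<le> 2 * pi * e (real n)"
      using eventually_ge_at_top[of "Suc N"]
    proof eventually_elim
      case (elim n)
      then show ?case using bound[of "real n"] N by (simp add: order_trans[of x0 "real N"])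
    qed
  qed
  then have lim: "(\<lambda>n::nat. (\<integral>x. indicator {-real n..real n} x * ?h x \<partial>lborel)) \<longlonglongrightarrow> pi * L"
    unfolding set_lebesgue_integral_def by (simp add: LIM_zero_iff)
  show ?thesis
  proof (rule has_bochner_integral_monotone_convergence[OF _ _ _ lim])
    show "integrable lborel (\<lambda>x. indicator {-real n..real n} x * ?h x)" for n
      using seth[of "real n"] by (simp add: set_integrable_def)
    show "AE x in lborel. mono (\<lambda>n. indicator {-real n..real n} x * ?h x)"
    proof (intro AE_I2 monoI)
      fix x and m n :: nat assume "m \<le> n"
      then show "indicator {-real m..real m} x * ?h x \<le> indicator {-real n..real n} x * ?h x"
        using sgn[of x] by (auto simp: indicator_def)
    qed
    show "AE x in lborel. (\<lambda>n. indicator {-real n..real n} x * ?h x) \<longlonglongrightarrow> ?h x"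
    proof (intro AE_I2 tendsto_eventually)
      fix x :: real
      obtain N where N: "\<bar>x\<bar> \<le> real N" using real_arch_simple by blast
      show "\<forall>\<^sub>F n in sequentially. indicator {-real n..real n} x * ?h x = ?h x"
        using eventually_ge_at_top[of N]
      proof eventually_elim
        case (elim n)
        then have "\<bar>x\<bar> \<le> real n" using N by linarith
        then show ?case by (auto simp: indicator_def abs_le_iff)
      qed
    qed
    show "?h \<in> borel_measurable lborel" using h by (simp only: measurable_lborel2)
  qed
qed

section \<open>The resolvent of a distributed order\<close>

text \<open>\<open>M\<close> stands for mu(alpha) d alpha. It gives no mass to 0 and 1, so sin(pi
  alpha) is positive almost everywhere; as \<open>M\<close> is nonzero, \<open>Slog\<close> is then
  positive.\<close>

locale distributed_order = finite_measure M for M :: "real measure" +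
  fixes lam :: real
  assumes sets_M [measurable_cong, simp]: "sets M = sets borel"
    and AE_M: "AE \<alpha> in M. 0 < \<alpha> \<and> \<alpha> < 1"
    and M_pos: "emeasure M (space M) \<noteq> 0"
    and lam_pos: "lam > 0"
begin

definition Psi :: "complex \<Rightarrow> complex" where
  "Psi w = (\<integral>\<alpha>. exp (of_real \<alpha> * w) \<partial>M)"

definition G :: "complex \<Rightarrow> complex" where
  "G w = 1 / (of_real lam + Psi w)"

definition Phi :: "real \<Rightarrow> real" where
  "Phi s = (\<integral>\<alpha>. s powr \<alpha> \<partial>M)"

text \<open>\<open>Slog x\<close> and \<open>Clog x\<close> are the integrals \<open>S\<close> and
  \<open>C\<close> of the theorem at r = exp x.\<close>

definition Slog :: "real \<Rightarrow> real" where
  "Slog x = (\<integral>\<alpha>. exp (\<alpha> * x) * sin (pi * \<alpha>) \<partial>M)"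

definition Clog :: "real \<Rightarrow> real" where
  "Clog x = (\<integral>\<alpha>. exp (\<alpha> * x) * cos (pi * \<alpha>) \<partial>M)"

text \<open>The density of the theorem in x = ln r; its factor 1/r is absorbed by dr/r = dx.\<close>

definition spectral :: "real \<Rightarrow> real" where
  "spectral x = Slog x / ((lam + Clog x)\<^sup>2 + (Slog x)\<^sup>2)"

section \<open>The function Psi is entire\<close>

lemma integrable_AE_bounded:
  fixes f :: "real \<Rightarrow> 'b::{banach, second_countable_topology}"
  assumes "f \<in> borel_measurable borel" and "\<And>\<alpha>. 0 < \<alpha> \<Longrightarrow> \<alpha> < 1 \<Longrightarrow> norm (f \<alpha>) \<le> B"
  shows "integrable M f"
proof (rule integrable_const_bound)
  show "AE \<alpha> in M. norm (f \<alpha>) \<le> B"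
    using AE_M by eventually_elim (use assms in auto)
qed (use assms in simp)

lemma exp_mult_le: "0 < \<alpha> \<Longrightarrow> \<alpha> < 1 \<Longrightarrow> exp (\<alpha> * x) \<le> exp \<bar>x\<bar>" for \<alpha> x :: real
proof -
  assume "0 < \<alpha>" "\<alpha> < 1"
  then have "\<bar>\<alpha> * x\<bar> \<le> \<bar>x\<bar>" by (simp add: abs_mult mult_left_le_one_le)
  then show ?thesis by simp
qed

lemma integrable_exp_complex: "integrable M (\<lambda>\<alpha>. exp (of_real \<alpha> * w))" for w :: complex
proof (rule integrable_AE_bounded)
  show "norm (exp (of_real \<alpha> * w)) \<le> exp \<bar>Re w\<bar>" if "0 < \<alpha>" "\<alpha> < 1" for \<alpha>
    using exp_mult_le[OF that, of "Re w"] by simp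
qed (auto intro!: borel_measurable_continuous_onI continuous_intros)

lemma integrable_exp_real:
  assumes "f \<in> borel_measurable borel" "\<And>\<alpha>. \<bar>f \<alpha>\<bar> \<le> 1"
  shows "integrable M (\<lambda>\<alpha>. exp (\<alpha> * x) * f \<alpha>)"
proof (rule integrable_AE_bounded)
  show "norm (exp (\<alpha> * x) * f \<alpha>) \<le> exp \<bar>x\<bar> * 1" if "0 < \<alpha>" "\<alpha> < 1" for \<alpha>
    unfolding norm_mult using exp_mult_le[OF that, of x] assms(2)[of \<alpha>] by (intro mult_mono) auto
qed (use assms in measurable)

lemma integrable_exp: "integrable M (\<lambda>\<alpha>. exp (\<alpha> * x))"
  using integrable_exp_real[of "\<lambda>_. 1" x] by simp

text \<open>The first-order Taylor remainder of the exponential is bounded by a multiple of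
  \<open>(cmod h)\<^sup>2\<close> uniformly for alpha in (0,1), so integrating against the finite
  measure \<open>M\<close> leaves an error of order \<open>h\<close> in the difference
  quotient.\<close>

lemma Psi_deriv: "(Psi has_field_derivative (\<integral>\<alpha>. of_real \<alpha> * exp (of_real \<alpha> * w) \<partial>M)) (at w)"
proof -
  let ?D = "\<integral>\<alpha>. of_real \<alpha> * exp (of_real \<alpha> * w) \<partial>M"
  \<comment> \<open>The factors bound exp(alpha w), the exponential in the Taylor remainder for
    \<open>cmod h < 1\<close>, and the total mass.\<close>
  define K where "K = exp (cmod w) * exp 1 * measure M (space M)"
  have iD: "integrable M (\<lambda>\<alpha>. of_real \<alpha> * exp (of_real \<alpha> * w))"
  proof (rule integrable_AE_bounded)
    show "norm (of_real \<alpha> * exp (of_real \<alpha> * w)) \<le> 1 * exp \<bar>Re w\<bar>" if "0 < \<alpha>" "\<alpha> < 1" for \<alpha>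
      unfolding norm_mult using exp_mult_le[OF that, of "Re w"] that by (intro mult_mono) auto
  qed (auto intro!: borel_measurable_continuous_onI continuous_intros)
  have bound: "cmod ((Psi (w + h) - Psi w) / h - ?D) \<le> K * cmod h" if h: "h \<noteq> 0" "cmod h < 1" for h
  proof -
    let ?r = "\<lambda>\<alpha>. exp (of_real \<alpha> * (w + h)) - exp (of_real \<alpha> * w) - h * (of_real \<alpha> * exp (of_real \<alpha> * w))"
    have ir: "integrable M ?r"
      by (intro Bochner_Integration.integrable_diff integrable_exp_complex integrable_mult_right iD)
    have pt: "cmod (?r \<alpha>) \<le> exp (cmod w) * exp 1 * (cmod h)\<^sup>2" if elim: "0 < \<alpha>" "\<alpha> < 1" for \<alpha>
    proof -
      let ?z = "of_real \<alpha> * h"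
      have "?r \<alpha> = exp (of_real \<alpha> * w) * (exp ?z - (\<Sum>k\<le>1. ?z ^ k / fact k))"
      proof -
        have "exp (of_real \<alpha> * (w + h)) = exp (of_real \<alpha> * w) * exp ?z"
          by (metis distrib_left exp_add)
        moreover have "(\<Sum>k\<le>1. ?z ^ k / fact k) = 1 + ?z" by simp
        moreover have "a * b - a - h * (c * a) = a * (b - (1 + c * h))" for a b c :: complex
          by (simp add: algebra_simps)
        ultimately show ?thesis by (simp only:)
      qed
      then have "cmod (?r \<alpha>) = cmod (exp (of_real \<alpha> * w)) * cmod (exp ?z - (\<Sum>k\<le>1. ?z ^ k / fact k))"
        by (simp only: norm_mult)
      also have "\<dots> \<le> exp (cmod w) * (exp 1 * (cmod h)\<^sup>2)"
      proof (intro mult_mono)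
        have "exp (\<alpha> * Re w) \<le> exp \<bar>Re w\<bar>" using exp_mult_le elim by blast
        also have "\<dots> \<le> exp (cmod w)" using abs_Re_le_cmod by simp
        finally show "cmod (exp (of_real \<alpha> * w)) \<le> exp (cmod w)" by simp
        have z: "cmod ?z \<le> cmod h" using elim by (simp add: norm_mult mult_left_le_one_le)
        have "cmod (exp ?z - (\<Sum>k\<le>1. ?z ^ k / fact k)) \<le> exp \<bar>Re ?z\<bar> * cmod ?z ^ Suc 1 / fact 1"
          by (rule Taylor_exp)
        also have "\<dots> = exp \<bar>Re ?z\<bar> * (cmod ?z)\<^sup>2" by (simp add: power2_eq_square)
        also have "\<dots> \<le> exp 1 * (cmod h)\<^sup>2"
          using z h(2) abs_Re_le_cmod[of ?z] by (intro mult_mono power_mono) auto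
        finally show "cmod (exp ?z - (\<Sum>k\<le>1. ?z ^ k / fact k)) \<le> exp 1 * (cmod h)\<^sup>2" .
      qed auto
      finally show ?thesis by (simp add: mult.assoc)
    qed
    have eq: "Psi (w + h) - Psi w - h * ?D = (\<integral>\<alpha>. ?r \<alpha> \<partial>M)"
      unfolding Psi_def using integrable_exp_complex iD
      by (subst Bochner_Integration.integral_diff) (auto simp: Bochner_Integration.integral_diff)
    have "cmod (Psi (w + h) - Psi w - h * ?D) \<le> (\<integral>\<alpha>. cmod (?r \<alpha>) \<partial>M)"
      unfolding eq by (rule integral_norm_bound)
    also have "\<dots> \<le> (\<integral>\<alpha>. exp (cmod w) * exp 1 * (cmod h)\<^sup>2 \<partial>M)"
    proof (rule integral_mono_AE[OF integrable_norm[OF ir] integrable_const])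
      show "AE \<alpha> in M. cmod (?r \<alpha>) \<le> exp (cmod w) * exp 1 * (cmod h)\<^sup>2"
        by (rule eventually_mono[OF AE_M], rule pt) simp_all
    qed
    also have "\<dots> = K * (cmod h)\<^sup>2" by (simp add: K_def mult_ac)
    finally have main: "cmod (Psi (w + h) - Psi w - h * ?D) \<le> K * (cmod h)\<^sup>2" .
    have "(Psi (w + h) - Psi w) / h - ?D = (Psi (w + h) - Psi w - h * ?D) / h"
      using h by (simp add: diff_divide_distrib)
    then have "cmod ((Psi (w + h) - Psi w) / h - ?D) = cmod (Psi (w + h) - Psi w - h * ?D) / cmod h"
      by (simp only: norm_divide)
    also have "\<dots> \<le> K * (cmod h)\<^sup>2 / cmod h" by (intro divide_right_mono main) simp
    also have "\<dots> = K * cmod h" using h by (simp add: power2_eq_square)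
    finally show ?thesis .
  qed
  have "(\<lambda>h. (Psi (w + h) - Psi w) / h - ?D) \<midarrow>0\<rightarrow> 0"
  proof (rule Lim_null_comparison)
    show "\<forall>\<^sub>F h in at 0. norm ((Psi (w + h) - Psi w) / h - ?D) \<le> K * cmod h"
      unfolding eventually_at by (rule exI[of _ 1]) (use bound in \<open>auto simp: dist_norm\<close>)
    show "(\<lambda>h. K * cmod h) \<midarrow>0\<rightarrow> 0" by (auto intro!: tendsto_eq_intros)
  qed
  then show ?thesis unfolding DERIV_def by (simp add: LIM_zero_iff)
qed

lemma Psi_Complex: "Re (Psi (Complex x \<theta>)) = (\<integral>\<alpha>. exp (\<alpha> * x) * cos (\<alpha> * \<theta>) \<partial>M)"
    "Im (Psi (Complex x \<theta>)) = (\<integral>\<alpha>. exp (\<alpha> * x) * sin (\<alpha> * \<theta>) \<partial>M)"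
  unfolding Psi_def using integrable_exp_complex[of "Complex x \<theta>"]
  by (simp_all add: integral_Re[symmetric] integral_Im[symmetric] Re_exp Im_exp)

lemma Psi_of_real: "Psi (of_real x) = of_real (\<integral>\<alpha>. exp (\<alpha> * x) \<partial>M)"
  using Psi_Complex[of x 0] by (simp add: complex_eq_iff complex_of_real_def)

lemma Psi_pi: "Psi (Complex x pi) = Complex (Clog x) (Slog x)"
  using Psi_Complex[of x pi] by (simp add: complex_eq_iff Slog_def Clog_def mult.commute)

lemma Phi_eq: "s > 0 \<Longrightarrow> Psi (of_real (ln s)) = of_real (Phi s)"
  by (simp add: Psi_of_real Phi_def powr_def)

lemma integral_pos_AE:
  assumes "integrable M f" "\<And>\<alpha>. 0 < \<alpha> \<Longrightarrow> \<alpha> < 1 \<Longrightarrow> f \<alpha> > (0::real)"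
  shows "(\<integral>\<alpha>. f \<alpha> \<partial>M) > 0"
proof -
  have ae: "AE \<alpha> in M. f \<alpha> > 0" using AE_M by eventually_elim (use assms in auto)
  then have "(\<integral>\<alpha>. f \<alpha> \<partial>M) \<ge> 0" by (intro integral_nonneg_AE) (auto elim: eventually_mono)
  moreover have "(\<integral>\<alpha>. f \<alpha> \<partial>M) \<noteq> 0"
  proof
    assume "(\<integral>\<alpha>. f \<alpha> \<partial>M) = 0"
    moreover have "AE \<alpha> in M. 0 \<le> f \<alpha>" using ae by eventually_elim simp
    ultimately have "AE \<alpha> in M. f \<alpha> = 0"
      using integral_nonneg_eq_0_iff_AE[OF assms(1)] by simp
    with ae have "AE \<alpha> in M. False" by eventually_elim simp
    then show False using M_pos by (simp add: eventually_False ae_filter_eq_bot_iff)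
  qed
  ultimately show ?thesis by simp
qed

section \<open>Lower bounds for the denominator on the strip\<close>

lemma sin_pi_pos: "0 < \<alpha> \<Longrightarrow> \<alpha> < 1 \<Longrightarrow> sin (pi * \<alpha>) > 0"
  by (rule sin_gt_zero) auto

lemma integrable_Slog: "integrable M (\<lambda>\<alpha>. exp (\<alpha> * x) * sin (pi * \<alpha>))"
  by (rule integrable_exp_real) auto

lemma Slog_pos: "Slog x > 0"
  unfolding Slog_def by (rule integral_pos_AE[OF integrable_Slog]) (simp add: sin_pi_pos)

text \<open>Rotating by \<open>exp (- \<i> \<theta> / 2)\<close> centres the arguments \<open>\<alpha> \<theta>\<close> of the integrand
  around zero, so that no cancellation can occur in the half plane of positive real part.\<close>
lemma cmod_denominator_ge:
  assumes "0 \<le> \<theta>" "\<theta> \<le> pi"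
  shows "cmod (of_real lam + Psi (Complex x \<theta>)) \<ge> Slog x"
proof -
  let ?u = "cis (- (\<theta> / 2))"
  have "Re (?u * Psi (Complex x \<theta>)) =
      cos (\<theta> / 2) * Re (Psi (Complex x \<theta>)) + sin (\<theta> / 2) * Im (Psi (Complex x \<theta>))"
    by simp
  also have "\<dots> = (\<integral>\<alpha>. cos (\<theta> / 2) * (exp (\<alpha> * x) * cos (\<alpha> * \<theta>)) +
      sin (\<theta> / 2) * (exp (\<alpha> * x) * sin (\<alpha> * \<theta>)) \<partial>M)"
    unfolding Psi_Complex
    by (subst Bochner_Integration.integral_add) (auto intro!: integrable_mult_right integrable_exp_real)
  also have "\<dots> = (\<integral>\<alpha>. exp (\<alpha> * x) * cos (\<alpha> * \<theta> - \<theta> / 2) \<partial>M)"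
    by (intro Bochner_Integration.integral_cong refl) (simp add: cos_diff algebra_simps)
  also have "\<dots> \<ge> Slog x"
    unfolding Slog_def
  proof (rule integral_mono_AE[OF integrable_Slog])
    show "integrable M (\<lambda>\<alpha>. exp (\<alpha> * x) * cos (\<alpha> * \<theta> - \<theta> / 2))"
      by (rule integrable_exp_real) auto
    show "AE \<alpha> in M. exp (\<alpha> * x) * sin (pi * \<alpha>) \<le> exp (\<alpha> * x) * cos (\<alpha> * \<theta> - \<theta> / 2)"
      using AE_M
    proof eventually_elim
      case (elim \<alpha>)
      \<comment> \<open>For fixed alpha the modulus of this argument is largest at theta = pi, where
        its cosine is sin(pi alpha).\<close>
      have "\<alpha> * \<theta> - \<theta> / 2 = (\<alpha> - 1/2) * \<theta>" by (simp add: algebra_simps)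
      then have "\<bar>\<alpha> * \<theta> - \<theta> / 2\<bar> = \<bar>\<alpha> - 1/2\<bar> * \<theta>" using assms by (simp add: abs_mult)
      also have "\<dots> \<le> \<bar>\<alpha> - 1/2\<bar> * pi" using assms by (intro mult_left_mono) auto
      finally have le: "\<bar>\<alpha> * \<theta> - \<theta> / 2\<bar> \<le> \<bar>\<alpha> - 1/2\<bar> * pi" .
      have "\<bar>\<alpha> - 1/2\<bar> * pi \<le> 1 * pi" using elim by (intro mult_right_mono) auto
      then have "cos (\<bar>\<alpha> - 1/2\<bar> * pi) \<le> cos \<bar>\<alpha> * \<theta> - \<theta> / 2\<bar>"
        by (intro cos_monotone_0_pi_le le) auto
      moreover have "cos (\<bar>\<alpha> - 1/2\<bar> * pi) = cos (\<alpha> * pi - pi / 2)"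
        by (simp add: abs_if algebra_simps cos_diff)
      moreover have "cos (\<alpha> * pi - pi / 2) = sin (pi * \<alpha>)"
        by (simp add: cos_diff mult.commute)
      ultimately show ?case by (intro mult_left_mono) auto
    qed
  qed
  finally have "Slog x \<le> Re (?u * Psi (Complex x \<theta>))" .
  \<comment> \<open>Half the angle is at most pi/2, so the rotated \<open>lam\<close> keeps a
    nonnegative real part.\<close>
  moreover have "0 \<le> Re (?u * of_real lam)"
    using lam_pos assms by (auto intro!: mult_nonneg_nonneg cos_ge_zero)
  ultimately have "Slog x \<le> Re (?u * (of_real lam + Psi (Complex x \<theta>)))"
    by (simp add: distrib_left)
  also have "\<dots> \<le> cmod (?u * (of_real lam + Psi (Complex x \<theta>)))" by (rule complex_Re_le_cmod)
  finally show ?thesis by (simp add: norm_mult)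
qed

lemma denominator_nonzero:
  assumes "0 \<le> Im w" "Im w \<le> pi"
  shows "of_real lam + Psi w \<noteq> 0"
  using cmod_denominator_ge[OF assms, of "Re w"] Slog_pos[of "Re w"] by auto

lemma cmod_G_le: "0 \<le> \<theta> \<Longrightarrow> \<theta> \<le> pi \<Longrightarrow> cmod (G (Complex x \<theta>)) \<le> 1 / Slog x"
  unfolding G_def norm_divide using cmod_denominator_ge[of \<theta> x] Slog_pos[of x]
  by (simp add: frac_le)

text \<open>The slope of a linear lower bound for \<open>Slog\<close>, from exp y >= y. Linear
  growth already makes \<open>G\<close> vanish at the right end of the strip.\<close>

definition growth :: real where "growth = (\<integral>\<alpha>. \<alpha> * sin (pi * \<alpha>) \<partial>M)"

lemma integrable_growth: "integrable M (\<lambda>\<alpha>. \<alpha> * sin (pi * \<alpha>))"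
proof (rule integrable_AE_bounded)
  show "norm (\<alpha> * sin (pi * \<alpha>)) \<le> 1 * 1" if "0 < \<alpha>" "\<alpha> < 1" for \<alpha>
    unfolding norm_mult using that by (intro mult_mono) auto
qed measurable

lemma growth_pos: "growth > 0"
  unfolding growth_def by (rule integral_pos_AE[OF integrable_growth]) (simp add: sin_pi_pos)

lemma Slog_ge: "x * growth \<le> Slog x"
proof -
  have "x * growth = (\<integral>\<alpha>. x * (\<alpha> * sin (pi * \<alpha>)) \<partial>M)" by (simp add: growth_def)
  also have "\<dots> \<le> Slog x"
    unfolding Slog_def
  proof (rule integral_mono_AE[OF _ integrable_Slog])
    show "AE \<alpha> in M. x * (\<alpha> * sin (pi * \<alpha>)) \<le> exp (\<alpha> * x) * sin (pi * \<alpha>)"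
      using AE_M
    proof eventually_elim
      case (elim \<alpha>)
      have "\<alpha> * x \<le> exp (\<alpha> * x)" using exp_ge_add_one_self[of "\<alpha> * x"] by linarith
      then have "(\<alpha> * x) * sin (pi * \<alpha>) \<le> exp (\<alpha> * x) * sin (pi * \<alpha>)"
        using sin_pi_pos elim by (intro mult_right_mono) (auto intro: less_imp_le)
      then show ?case by (simp add: mult_ac)
    qed
  qed (use integrable_growth in simp)
  finally show ?thesis .
qed

text \<open>This is \<open>Phi (exp (- x))\<close>, a bound for the modulus of \<open>Psi\<close> on
  the vertical line through \<open>-x\<close>. It tends to 0 by dominated convergence, without a
  rate, since \<open>M\<close> may concentrate near 0.\<close>

definition small :: "real \<Rightarrow> real" where "small x = (\<integral>\<alpha>. exp (- (\<alpha> * x)) \<partial>M)"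

lemma small_tendsto: "(small \<longlongrightarrow> 0) at_top"
proof -
  have "((\<lambda>x. \<integral>\<alpha>. exp (- (\<alpha> * x)) \<partial>M) \<longlongrightarrow> (\<integral>\<alpha>. 0 \<partial>M)) at_top"
  proof (rule integral_dominated_convergence_at_top[where w="\<lambda>_. 1"])
    show "AE \<alpha> in M. ((\<lambda>x. exp (- (\<alpha> * x))) \<longlongrightarrow> (0::real)) at_top"
      using AE_M
    proof eventually_elim
      case (elim \<alpha>)
      then show ?case by real_asymp
    qed
    show "\<forall>\<^sub>F x in at_top. AE \<alpha> in M. norm (exp (- (\<alpha> * x))) \<le> (1::real)"
      using eventually_ge_at_top[of 0]
    proof eventually_elim
      case (elim x)
      show ?case using AE_M by eventually_elim (use elim in auto)
    qed
  qed auto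
  then show ?thesis by (simp add: small_def[abs_def])
qed

lemma cmod_Psi_le: "cmod (Psi (Complex (-x) \<theta>)) \<le> small x"
proof -
  have "cmod (Psi (Complex (-x) \<theta>)) \<le> (\<integral>\<alpha>. cmod (exp (of_real \<alpha> * Complex (-x) \<theta>)) \<partial>M)"
    unfolding Psi_def by (rule integral_norm_bound)
  then show ?thesis by (simp add: small_def)
qed

lemma small_nonneg: "small x \<ge> 0"
  unfolding small_def by simp

section \<open>The contour integrals of G\<close>

lemma G_holomorphic: "G holomorphic_on {w. of_real lam + Psi w \<noteq> 0}"
proof -
  have "Psi holomorphic_on UNIV"
    unfolding holomorphic_on_def field_differentiable_def
    using Psi_deriv has_field_derivative_at_within by blast
  then have "Psi holomorphic_on {w. of_real lam + Psi w \<noteq> 0}" by (rule holomorphic_on_subset) simp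
  then show ?thesis unfolding G_def[abs_def] by (intro holomorphic_intros) auto
qed

text \<open>The removable singularity at \<open>ln s\<close> lies on the boundary of the strip, so
  an open domain of holomorphy around the closed strip is required.\<close>

lemma open_denominator: "open {w. of_real lam + Psi w \<noteq> 0}"
proof -
  have "continuous_on UNIV Psi"
    using Psi_deriv by (intro continuous_at_imp_continuous_on) (auto intro: DERIV_isCont)
  then show ?thesis by (intro open_Collect_neq continuous_intros)
qed

lemma G_real: "G (of_real x) = of_real (1 / (lam + (\<integral>\<alpha>. exp (\<alpha> * x) \<partial>M)))"
  by (simp add: G_def Psi_of_real)

lemma Im_G_pi: "Im (G (Complex x pi)) = - spectral x"
proof -
  have "of_real lam + Psi (Complex x pi) = Complex (lam + Clog x) (Slog x)"
    by (simp add: Psi_pi complex_eq_iff)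
  then show ?thesis unfolding G_def by (simp add: Im_divide spectral_def)
qed

lemma spectral_nonneg: "spectral x \<ge> 0"
  using Slog_pos[of x] by (simp add: spectral_def)

text \<open>The difference is -Psi / (lam (lam + Psi)), and the threshold on \<open>small x\<close>
  keeps \<open>lam + Psi\<close> at modulus at least lam/2.\<close>

lemma G_left:
  assumes "0 \<le> \<theta>" "\<theta> \<le> pi" and "small x \<le> lam / 2"
  shows "cmod (G (Complex (-x) \<theta>) - of_real (1 / lam)) \<le> 2 * small x / lam\<^sup>2"
proof -
  let ?P = "Psi (Complex (-x) \<theta>)"
  have nz: "of_real lam + ?P \<noteq> 0" using denominator_nonzero[of "Complex (-x) \<theta>"] assms by simp
  have "cmod (of_real lam + ?P) \<ge> lam - cmod ?P"
    using norm_diff_ineq[of "of_real lam" ?P] lam_pos by simp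
  then have ge: "cmod (of_real lam + ?P) \<ge> lam / 2" using cmod_Psi_le[of x \<theta>] assms(3) by linarith
  have "G (Complex (-x) \<theta>) - of_real (1 / lam) = - ?P / (of_real lam * (of_real lam + ?P))"
    unfolding G_def using nz lam_pos by (simp add: field_simps)
  then have "cmod (G (Complex (-x) \<theta>) - of_real (1 / lam)) = cmod ?P / (lam * cmod (of_real lam + ?P))"
    using lam_pos by (simp add: norm_divide norm_mult)
  also have "\<dots> \<le> small x / (lam * (lam / 2))"
    using ge cmod_Psi_le[of x \<theta>] lam_pos small_nonneg[of x] by (intro frac_le) auto
  finally show ?thesis by (simp add: power2_eq_square mult_ac)
qed

lemma small_threshold: obtains x0 where "x0 \<ge> 1" "\<And>x. x \<ge> x0 \<Longrightarrow> small x \<le> lam / 2"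
proof -
  have "\<forall>\<^sub>F x in at_top. small x < lam / 2"
    using order_tendstoD(2)[OF small_tendsto, of "lam / 2"] lam_pos by simp
  then obtain x1 where "\<And>x. x \<ge> x1 \<Longrightarrow> small x < lam / 2" unfolding eventually_at_top_linorder by blast
  then show ?thesis by (intro that[of "max 1 x1"]) (auto intro: less_imp_le)
qed

text \<open>The contour argument for \<open>G\<close>, whose limit at the left end is 1/lam. This
  total mass is what normalises the solution at time 0.\<close>

lemma integral_spectral: "has_bochner_integral lborel spectral (pi * (1 / lam))"
proof -
  obtain x0 where x0: "x0 \<ge> 1" "\<And>x. x \<ge> x0 \<Longrightarrow> small x \<le> lam / 2"
    using small_threshold by blast
  have "has_bochner_integral lborel (\<lambda>x. - Im (G (Complex x pi))) (pi * (1 / lam))"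
  \<comment> \<open>The two summands of the error control the left and the right side
    respectively.\<close>
  proof (rule strip_integral[where ?x0.0=x0 and e="\<lambda>x. 2 * small x / lam\<^sup>2 + 1 / (x * growth)"])
    show "G holomorphic_on {w. 0 \<le> Im w \<and> Im w \<le> pi}"
      by (rule holomorphic_on_subset[OF G_holomorphic]) (use denominator_nonzero in auto)
    show "Im (G (of_real x)) = 0" for x unfolding G_real by (rule Im_complex_of_real)
    show "((\<lambda>x. 2 * small x / lam\<^sup>2 + 1 / (x * growth)) \<longlongrightarrow> 0) at_top"
    proof -
      have "((\<lambda>x. 1 / (x * growth)) \<longlongrightarrow> 0) at_top" using growth_pos by real_asymp
      moreover have "((\<lambda>x. 2 * small x / lam\<^sup>2) \<longlongrightarrow> 0) at_top"
      proof -
        have "((\<lambda>x. 2 * small x / lam\<^sup>2) \<longlongrightarrow> 2 * 0 / lam\<^sup>2) at_top"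
          by (intro tendsto_intros small_tendsto) (use lam_pos in auto)
        then show ?thesis by simp
      qed
      ultimately show ?thesis using tendsto_add by fastforce
    qed
    fix x \<theta> assume x: "x \<ge> x0" and \<theta>: "0 \<le> \<theta>" "\<theta> \<le> pi"
    show "cmod (G (Complex (-x) \<theta>) - of_real (1 / lam)) \<le> 2 * small x / lam\<^sup>2 + 1 / (x * growth)"
      using G_left[OF \<theta> x0(2)[OF x]] growth_pos x x0(1) by (simp add: add_increasing2)
    have "cmod (G (Complex x \<theta>)) \<le> 1 / Slog x" by (rule cmod_G_le[OF \<theta>])
    also have "\<dots> \<le> 1 / (x * growth)"
      using Slog_ge[of x] growth_pos Slog_pos[of x] x x0(1) by (intro divide_left_mono) auto
    finally show "cmod (G (Complex x \<theta>)) \<le> 2 * small x / lam\<^sup>2 + 1 / (x * growth)"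
      using small_nonneg[of x] by (simp add: add_increasing)
  qed (simp add: Im_G_pi spectral_nonneg)
  then show ?thesis by (simp add: Im_G_pi)
qed

lemma Phi_nonneg: "s > 0 \<Longrightarrow> Phi s \<ge> 0"
  unfolding Phi_def by (rule integral_nonneg_AE) simp

text \<open>On the upper edge exp w = -exp x, so the quotient (G w - G (ln s)) / (s - exp w) has
  imaginary part -spectral x / (s + exp x). At the left end exp w tends to 0, which produces the
  value.\<close>

lemma integral_spectral_resolvent:
  assumes s: "s > 0"
  shows "has_bochner_integral lborel (\<lambda>x. spectral x / (s + exp x)) (pi * ((1 / lam - 1 / (lam + Phi s)) / s))"
proof -
  obtain x0 where x0: "x0 \<ge> 1" "\<And>x. x \<ge> x0 \<Longrightarrow> small x \<le> lam / 2"
    using small_threshold by blast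
  define c :: complex where "c = of_real (ln s)"
  define g where "g = 1 / (lam + Phi s)"
  have Gc: "G c = of_real g" unfolding c_def G_def g_def using Phi_eq[OF s] by simp
  have expc: "exp c = of_real s" unfolding c_def using s by (simp add: exp_of_real)
  have dexp: "deriv exp c = of_real s" using DERIV_imp_deriv[OF DERIV_exp[of c]] expc by simp
  define U where "U = {w. of_real lam + Psi w \<noteq> 0}"
  \<comment> \<open>\<open>A\<close> and \<open>B\<close> are the divided differences of
    \<open>G\<close> and \<open>exp\<close> at \<open>c\<close>, filled in by the derivative;
    \<open>Q\<close> is the contour integrand with its singularity removed.\<close>
  define A where "A = (\<lambda>w. if w = c then deriv G c else (G w - G c) / (w - c))"
  define B where "B = (\<lambda>w. if w = c then deriv exp c else (exp w - exp c) / (w - c))"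
  define Q where "Q = (\<lambda>w. - (A w / B w))"
  have A: "A holomorphic_on U" unfolding A_def U_def by (rule pole_lemma_open[OF G_holomorphic open_denominator])
  have B: "B holomorphic_on UNIV" unfolding B_def by (rule pole_lemma_open) (auto intro: holomorphic_intros)
  have strip: "{w. 0 \<le> Im w \<and> Im w \<le> pi} \<subseteq> U" unfolding U_def using denominator_nonzero by auto
  \<comment> \<open>The strip has height pi, less than the period of \<open>exp\<close>, so
    \<open>exp w\<close> takes the value \<open>s\<close> only at \<open>c\<close> and
    \<open>B\<close> has no zero.\<close>
  have exp_eq: "w = c" if "0 \<le> Im w" "Im w \<le> pi" "exp w = exp c" for w
  proof -
    have "Im c = 0" by (simp add: c_def)
    then have "\<bar>Im w - Im c\<bar> < 2 * pi" using that(1,2) pi_gt_zero by linarith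
    then show ?thesis
      using exp_complex_eqI[of w c] that(3) by simp
  qed
  have Bnz: "B w \<noteq> 0" if "0 \<le> Im w" "Im w \<le> pi" for w
    using exp_eq[OF that] s by (auto simp: B_def dexp)
  have Q: "Q w = (G w - of_real g) / (of_real s - exp w)" if "0 \<le> Im w" "Im w \<le> pi" "w \<noteq> c" for w
  proof -
    have "Q w = - ((G w - of_real g) / (w - c) / ((exp w - of_real s) / (w - c)))"
      using that(3) by (simp add: Q_def A_def B_def Gc expc)
    also have "\<dots> = - ((G w - of_real g) / (exp w - of_real s))" using that(3) by simp
    also have "\<dots> = (G w - of_real g) / (of_real s - exp w)" by (metis minus_diff_eq minus_divide_right)
    finally show ?thesis .
  qed
  have Qpi: "Im (Q (Complex x pi)) = - (spectral x / (s + exp x))" for x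
  proof -
    have "exp (Complex x pi) = - of_real (exp x)" by (simp add: complex_eq_iff Re_exp Im_exp)
    moreover have "Complex x pi \<noteq> c" using pi_neq_zero by (simp add: c_def complex_eq_iff)
    ultimately have "Q (Complex x pi) = (G (Complex x pi) - of_real g) / of_real (s + exp x)"
      by (subst Q) auto
    then show ?thesis by (simp only: Im_divide_of_real) (simp add: Im_G_pi)
  qed
  \<comment> \<open>The first summand is the error at the left end, using \<open>s / 2\<close> as
    lower bound for the modulus of \<open>s - exp w\<close>; the second bounds \<open>Q\<close> at
    the right end, where \<open>exp x - s\<close> does this.\<close>
  define E where "E = (\<lambda>x. 2 / s\<^sup>2 * (s * (2 * small x / lam\<^sup>2) + exp (-x) * \<bar>1 / lam - g\<bar>)
      + (1 / (x * growth) + \<bar>g\<bar>) / (exp x - s))"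
  have "\<forall>\<^sub>F x in at_top. exp x > s \<and> exp (- x) < s / 2"
    using s by (intro eventually_conj; real_asymp)
  then obtain x1 where x1: "\<And>x. x \<ge> x1 \<Longrightarrow> exp x > s \<and> exp (- x) < s / 2"
    unfolding eventually_at_top_linorder by blast
  have "has_bochner_integral lborel (\<lambda>x. - Im (Q (Complex x pi))) (pi * ((1 / lam - g) / s))"
  proof (rule strip_integral[where ?x0.0="max x0 x1" and e=E])
    show "Q holomorphic_on {w. 0 \<le> Im w \<and> Im w \<le> pi}"
      unfolding Q_def using holomorphic_on_subset[OF A strip] holomorphic_on_subset[OF B] Bnz
      by (intro holomorphic_intros) auto
    show "Im (Q (of_real x)) = 0" for x
    proof (cases "of_real x = c")
      case False
      have "Q (of_real x) = of_real ((1 / (lam + (\<integral>\<alpha>. exp (\<alpha> * x) \<partial>M)) - g) / (s - exp x))"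
        using False by (subst Q) (simp_all add: G_real exp_of_real)
      then show ?thesis by (simp only: Im_complex_of_real)
    next
      \<comment> \<open>At \<open>c\<close> itself \<open>Q\<close> is minus a quotient of
        derivatives, which must be checked to be real separately.\<close>
      case True
      have "Psi c = of_real (Phi s)" unfolding c_def by (rule Phi_eq[OF s])
      have "(Psi has_field_derivative of_real (\<integral>\<alpha>. \<alpha> * exp (\<alpha> * ln s) \<partial>M)) (at c)"
        using Psi_deriv[of c] by (simp add: c_def exp_of_real[symmetric] integral_complex_of_real[symmetric] del: integral_complex_of_real)
      then have "(G has_field_derivative - of_real (\<integral>\<alpha>. \<alpha> * exp (\<alpha> * ln s) \<partial>M) / (of_real lam + Psi c)\<^sup>2) (at c)"
        unfolding G_def[abs_def] using denominator_nonzero[of c]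
        by (auto intro!: derivative_eq_intros simp: c_def power2_eq_square)
      from DERIV_imp_deriv[OF this] have "deriv G c = of_real (- (\<integral>\<alpha>. \<alpha> * exp (\<alpha> * ln s) \<partial>M) / (lam + Phi s)\<^sup>2)"
        using \<open>Psi c = _\<close> by simp
      then have "Q c = of_real (- ((- (\<integral>\<alpha>. \<alpha> * exp (\<alpha> * ln s) \<partial>M) / (lam + Phi s)\<^sup>2) / s))"
        by (simp add: Q_def A_def B_def dexp)
      then show ?thesis unfolding True by (simp only: Im_complex_of_real)
    qed
    show "(E \<longlongrightarrow> 0) at_top"
    proof -
      have 1: "((\<lambda>x. (1 / (x * growth) + \<bar>g\<bar>) / (exp x - s)) \<longlongrightarrow> 0) at_top" using growth_pos by real_asymp
      have 2: "((\<lambda>x::real. exp (-x)) \<longlongrightarrow> 0) at_top" by real_asymp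
      have "(E \<longlongrightarrow> 2 / s\<^sup>2 * (s * (2 * 0 / lam\<^sup>2) + 0 * \<bar>1 / lam - g\<bar>) + 0) at_top"
        unfolding E_def by (intro tendsto_intros small_tendsto 1 2) (use lam_pos in auto)
      then show ?thesis by simp
    qed
    show "Im (Q (Complex y pi)) \<le> 0" for y using spectral_nonneg[of y] s by (simp add: Qpi add_pos_pos)
    fix x \<theta> assume x: "x \<ge> max x0 x1" and \<theta>: "0 \<le> \<theta>" "\<theta> \<le> pi"
    have xx: "exp x > s" "exp (-x) < s / 2" "x \<ge> x0" "x \<ge> 1" using x x1[of x] x0(1) by auto
    have t1: "(1 / (x * growth) + \<bar>g\<bar>) / (exp x - s) \<ge> 0" using xx growth_pos by auto
    have t2: "2 / s\<^sup>2 * (s * (2 * small x / lam\<^sup>2) + exp (-x) * \<bar>1 / lam - g\<bar>) \<ge> 0"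
      using s small_nonneg[of x] by auto
    have cexp: "cmod (exp (Complex y \<theta>)) = exp y" for y by simp
    show "cmod (Q (Complex (-x) \<theta>) - of_real ((1 / lam - g) / s)) \<le> E x"
    proof -
      let ?w = "Complex (-x) \<theta>"
      have ge: "cmod (of_real s - exp ?w) \<ge> s / 2"
        using norm_triangle_ineq2[of "of_real s" "exp ?w"] cexp[of "-x"] xx s by simp
      then have nz: "of_real s - exp ?w \<noteq> 0" using s by auto
      then have "?w \<noteq> c" using expc by auto
      then have "Q ?w - of_real ((1 / lam - g) / s) =
          (G ?w - of_real g) / (of_real s - exp ?w) - (of_real (1 / lam) - of_real g) / of_real s"
        using \<theta> by (subst Q) auto
      also have "\<dots> = (of_real s * (G ?w - of_real (1 / lam)) + exp ?w * (of_real (1 / lam) - of_real g))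
          / (of_real s * (of_real s - exp ?w))"
        using nz s lam_pos by (simp add: divide_simps) (simp add: algebra_simps)
      finally have "cmod (Q ?w - of_real ((1 / lam - g) / s)) =
          cmod (of_real s * (G ?w - of_real (1 / lam)) + exp ?w * (of_real (1 / lam) - of_real g))
          / (s * cmod (of_real s - exp ?w))"
        using s by (simp only: norm_divide norm_mult norm_of_real abs_of_pos)
      also have "\<dots> \<le> (s * (2 * small x / lam\<^sup>2) + exp (-x) * \<bar>1 / lam - g\<bar>) / (s * (s / 2))"
      proof (intro frac_le mult_left_mono ge)
        have "cmod (of_real s * (G ?w - of_real (1 / lam)) + exp ?w * (of_real (1 / lam) - of_real g))
          \<le> cmod (of_real s * (G ?w - of_real (1 / lam))) + cmod (exp ?w * (of_real (1 / lam) - of_real g))"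
          by (rule norm_triangle_ineq)
        also have "cmod (exp ?w * (of_real (1 / lam) - of_real g)) = exp (-x) * \<bar>1 / lam - g\<bar>"
          unfolding norm_mult cexp of_real_diff[symmetric] norm_of_real ..
        also have "cmod (of_real s * (G ?w - of_real (1 / lam))) \<le> s * (2 * small x / lam\<^sup>2)"
          unfolding norm_mult norm_of_real abs_of_pos[OF s]
          by (intro mult_left_mono G_left[OF \<theta> x0(2)[OF xx(3)]]) (use s in simp)
        finally show "cmod (of_real s * (G ?w - of_real (1 / lam)) + exp ?w * (of_real (1 / lam) - of_real g))
          \<le> s * (2 * small x / lam\<^sup>2) + exp (-x) * \<bar>1 / lam - g\<bar>" by simp
      qed (use s small_nonneg[of x] in auto)
      also have "\<dots> = 2 / s\<^sup>2 * (s * (2 * small x / lam\<^sup>2) + exp (-x) * \<bar>1 / lam - g\<bar>)"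
        by (simp add: power2_eq_square)
      also have "\<dots> \<le> E x" unfolding E_def using t1 by simp
      finally show ?thesis .
    qed
    show "cmod (Q (Complex x \<theta>)) \<le> E x"
    proof -
      let ?w = "Complex x \<theta>"
      have ge: "cmod (of_real s - exp ?w) \<ge> exp x - s"
        using norm_triangle_ineq2[of "exp ?w" "of_real s"] cexp[of x] s by (simp add: norm_minus_commute)
      then have nz: "of_real s - exp ?w \<noteq> 0" using xx by auto
      then have "?w \<noteq> c" using expc by auto
      then have "cmod (Q ?w) = cmod (G ?w - of_real g) / cmod (of_real s - exp ?w)"
        using \<theta> by (subst Q) (auto simp: norm_divide)
      also have "\<dots> \<le> (1 / (x * growth) + \<bar>g\<bar>) / (exp x - s)"
      proof (intro frac_le ge)
        have "cmod (G ?w) \<le> 1 / Slog x" by (rule cmod_G_le[OF \<theta>])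
        also have "\<dots> \<le> 1 / (x * growth)"
          using Slog_ge[of x] growth_pos xx Slog_pos[of x] by (intro divide_left_mono) auto
        finally show "cmod (G ?w - of_real g) \<le> 1 / (x * growth) + \<bar>g\<bar>"
          using norm_triangle_ineq4[of "G ?w" "of_real g"] by simp
      qed (use xx growth_pos in auto)
      also have "\<dots> \<le> E x" unfolding E_def using t2 by simp
      finally show ?thesis .
    qed
  qed
  then show ?thesis by (simp add: Qpi g_def)
qed

end

section \<open>Laplace transforms of the solution and of the kernel\<close>

text \<open>Fubini for nonnegative integrands with known inner integrals \<open>J\<close>:
  integrability of \<open>J\<close> gives integrability on the product.\<close>

lemma has_bochner_integral_swap:
  fixes f :: "'a \<Rightarrow> real \<Rightarrow> real"
  assumes N: "sigma_finite_measure N"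
    and f[measurable]: "(\<lambda>(x, t). f x t) \<in> borel_measurable (N \<Otimes>\<^sub>M lborel)"
    and fx: "AE x in N. has_bochner_integral lborel (f x) (J x) \<and> (\<forall>t. f x t \<ge> 0)"
    and J: "has_bochner_integral N J c"
  shows "has_bochner_integral lborel (\<lambda>t. \<integral>x. f x t \<partial>N) c"
proof -
  interpret N: sigma_finite_measure N by fact
  interpret pair_sigma_finite N lborel by unfold_locales
  have [measurable]: "J \<in> borel_measurable N" using J by (auto simp: has_bochner_integral_iff)
  have eqJ: "AE x in N. J x = (\<integral>t. norm (f x t) \<partial>lborel)" "AE x in N. J x = (\<integral>t. f x t \<partial>lborel)"
    using fx by (eventually_elim, simp add: has_bochner_integral_iff)+
  have int: "integrable (N \<Otimes>\<^sub>M lborel) (\<lambda>(x, t). f x t)"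
  proof (rule Fubini_integrable[OF f])
    have "integrable N J" using J by (simp add: has_bochner_integral_iff)
    then have "integrable N (\<lambda>x. \<integral>t. norm (f x t) \<partial>lborel)"
      by (subst integrable_cong_AE[where g=J]) (use eqJ(1) in \<open>auto elim: eventually_mono\<close>)
    then show "integrable N (\<lambda>x. \<integral>t. norm (case (x, t) of (x, t) \<Rightarrow> f x t) \<partial>lborel)" by simp
    show "AE x in N. integrable lborel (\<lambda>t. case (x, t) of (x, t) \<Rightarrow> f x t)"
      using fx by eventually_elim (simp add: has_bochner_integral_iff)
  qed
  have "(\<integral>t. \<integral>x. f x t \<partial>N \<partial>lborel) = (\<integral>x. \<integral>t. f x t \<partial>lborel \<partial>N)"
    using Fubini_integral[OF int] by simp
  also have "\<dots> = (\<integral>x. J x \<partial>N)"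
    by (rule integral_cong_AE) (use eqJ(2) in \<open>auto elim: eventually_mono\<close>)
  finally show ?thesis
    using integrable_snd[OF int] J by (simp add: has_bochner_integral_iff)
qed

lemma has_bochner_integral_of_has_integral:
  fixes f :: "real \<Rightarrow> real"
  assumes "(f has_integral I) S" "\<And>x. x \<in> S \<Longrightarrow> f x \<ge> 0"
    and "(\<lambda>x. indicator S x * f x) \<in> borel_measurable borel"
  shows "has_bochner_integral lborel (\<lambda>x. indicator S x * f x) I"
proof (rule has_bochner_integral_nn_integral)
  show "(\<integral>\<^sup>+x. ennreal (indicator S x * f x) \<partial>lborel) = ennreal I"
    using nn_integral_has_integral_lebesgue[OF assms(2,1)]
    by (simp add: ennreal_mult' ennreal_indicator)
  show "0 \<le> I" using has_integral_nonneg[OF assms(1,2)] .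
  show "AE x in lborel. 0 \<le> indicator S x * f x" using assms(2) by (auto simp: indicator_def)
qed (use assms in simp)

lemma has_bochner_integral_exp_Ioi:
  assumes "a > 0"
  shows "has_bochner_integral lborel (\<lambda>t. indicator {0<..} t * exp (- (a * t))) (1 / a :: real)"
proof -
  have "has_bochner_integral lborel (\<lambda>t. indicator {0..} t * exp (- (a * t))) (1 / a)"
    using has_integral_exp_minus_to_infinity[OF assms, of 0]
    by (intro has_bochner_integral_of_has_integral) simp_all
  moreover have "AE t in lborel. indicator {0..} t * exp (- (a * t)) = indicator {0<..} t * exp (- (a * t))"
    using AE_lborel_singleton[of 0] by eventually_elim (auto simp: indicator_def)
  ultimately show ?thesis
    by (subst has_bochner_integral_cong_AE[where g="\<lambda>t. indicator {0..} t * exp (- (a * t))"])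
      (auto elim: eventually_mono)
qed

lemma has_bochner_integral_exp_Icc:
  assumes "a > 0" "t \<ge> 0"
  shows "has_bochner_integral lborel (\<lambda>s. indicator {0..t} s * (a * exp (- (a * s)))) (1 - exp (- (a * t)) :: real)"
proof (rule has_bochner_integral_of_has_integral)
  have "((\<lambda>s. a * exp (- (a * s))) has_integral (- exp (- (a * t))) - (- exp (- (a * 0)))) {0..t}"
    by (rule fundamental_theorem_of_calculus[OF assms(2)])
      (auto intro!: derivative_eq_intros simp: has_real_derivative_iff_has_vector_derivative[symmetric])
  then show "((\<lambda>s. a * exp (- (a * s))) has_integral 1 - exp (- (a * t))) {0..t}" by simp
qed (use assms in auto)

text \<open>The Gamma integral rescaled by \<open>z\<close>.\<close>

lemma has_bochner_integral_powr_exp: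
  fixes \<alpha> z :: real
  assumes "\<alpha> < 1" "z > 0"
  shows "has_bochner_integral lborel (\<lambda>t. indicator {0<..} t * (exp (- (z * t)) * (t powr (- \<alpha>) / Gamma (1 - \<alpha>))))
           (z powr (\<alpha> - 1))"
proof -
  have Gpos: "Gamma (1 - \<alpha>) > 0" using assms by (intro Gamma_real_pos) simp
  have "((\<lambda>t. t powr (- \<alpha>) / exp t) has_integral Gamma (1 - \<alpha>)) {0..}"
    using Gamma_integral_real[of "1 - \<alpha>"] assms by simp
  then have "has_bochner_integral lborel (\<lambda>t. indicator {0..} t * (t powr (- \<alpha>) / exp t)) (Gamma (1 - \<alpha>))"
    by (rule has_bochner_integral_of_has_integral) auto
  from lborel_has_bochner_integral_real_affine_iff[THEN iffD1, OF _ this, of z 0]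
  have "has_bochner_integral lborel (\<lambda>t. indicator {0..} (z * t) * ((z * t) powr (- \<alpha>) / exp (z * t))) (Gamma (1 - \<alpha>) / z)"
    using assms by (simp add: divide_inverse mult.commute)
  from has_bochner_integral_mult_right[OF this, of "z powr \<alpha> / Gamma (1 - \<alpha>)"]
  have "has_bochner_integral lborel (\<lambda>t. z powr \<alpha> / Gamma (1 - \<alpha>) * (indicator {0..} (z * t) * ((z * t) powr (- \<alpha>) / exp (z * t))))
      (z powr \<alpha> / z)"
    using Gpos by simp
  moreover have "z powr \<alpha> / z = z powr (\<alpha> - 1)" using assms by (simp add: powr_diff)
  moreover have "z powr \<alpha> / Gamma (1 - \<alpha>) * (indicator {0..} (z * t) * ((z * t) powr (- \<alpha>) / exp (z * t))) =
      indicator {0<..} t * (exp (- (z * t)) * (t powr (- \<alpha>) / Gamma (1 - \<alpha>)))" for t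
  proof (cases "t > 0")
    case True
    then show ?thesis using assms
      by (simp add: powr_mult powr_minus exp_minus field_simps)
  next
    case False
    then show ?thesis using assms by (cases "t = 0") (auto simp: indicator_def zero_le_mult_iff)
  qed
  ultimately show ?thesis by simp
qed

context distributed_order
begin

text \<open>The formula of the theorem for initial value 1, in the variable x = ln r.\<close>

definition V :: "real \<Rightarrow> real" where
  "V t = lam / pi * (\<integral>x. exp (- (exp x * t)) * spectral x \<partial>lborel)"

text \<open>Minus the derivative of \<open>V\<close> for positive \<open>t\<close>, as obtained by
  differentiating under the integral; the function h of the uniqueness argument.\<close>

definition rate :: "real \<Rightarrow> real" where
  "rate t = lam / pi * (\<integral>x. exp (- (exp x * t)) * (exp x * spectral x) \<partial>lborel)"

definition kernel :: "real \<Rightarrow> real" where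
  "kernel t = (\<integral>\<alpha>. t powr (- \<alpha>) / Gamma (1 - \<alpha>) \<partial>M)"

lemma spectral_measurable [measurable]: "spectral \<in> borel_measurable borel"
  using integral_spectral borel_measurable_integrable[of lborel spectral] by (simp add: has_bochner_integral_iff)

lemma spectral_integrable: "integrable lborel spectral" and integral_spectral_eq: "(\<integral>x. spectral x \<partial>lborel) = pi / lam"
  using integral_spectral by (simp_all add: has_bochner_integral_iff)

text \<open>The reciprocal Gamma function is continuous everywhere, so writing the quotient with
  \<open>rGamma\<close> avoids the poles.\<close>

lemma kernel_measurable_pair [measurable]:
  "(\<lambda>(\<alpha>, t). t powr (- \<alpha>) / Gamma (1 - \<alpha>)) \<in> borel_measurable (borel \<Otimes>\<^sub>M (borel :: real measure))"
proof -
  have [measurable]: "(\<lambda>\<alpha>. rGamma (1 - \<alpha>) :: real) \<in> borel_measurable borel"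
    by (intro borel_measurable_continuous_onI continuous_on_compose2[OF continuous_on_rGamma[of UNIV]] continuous_intros) auto
  have "(\<lambda>(\<alpha>, t). t powr (- \<alpha>) * rGamma (1 - \<alpha>)) \<in> borel_measurable (borel \<Otimes>\<^sub>M (borel :: real measure))"
    by measurable
  then show ?thesis by (simp add: rGamma_inverse_Gamma divide_inverse)
qed

text \<open>For each order alpha the transform is z to the power alpha - 1, which integrates against
  \<open>M\<close> to \<open>Phi z / z\<close>.\<close>

lemma laplace_kernel:
  assumes z: "z > 0"
  shows "has_bochner_integral lborel (\<lambda>t. indicator {0<..} t * (exp (- (z * t)) * kernel t)) (Phi z / z)"
proof -
  have "has_bochner_integral lborel (\<lambda>t. \<integral>\<alpha>. indicator {0<..} t * (exp (- (z * t)) * (t powr (- \<alpha>) / Gamma (1 - \<alpha>))) \<partial>M) (Phi z / z)"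
  proof (rule has_bochner_integral_swap[where J="\<lambda>\<alpha>. z powr (\<alpha> - 1)"])
    show "sigma_finite_measure M" by unfold_locales
    have "(\<lambda>(\<alpha>, t). indicator {0<..} t * (exp (- (z * t)) * (t powr (- \<alpha>) / Gamma (1 - \<alpha>))))
        \<in> borel_measurable (borel \<Otimes>\<^sub>M (borel :: real measure))"
      using kernel_measurable_pair by measurable
    then show "(\<lambda>(\<alpha>, t). indicator {0<..} t * (exp (- (z * t)) * (t powr (- \<alpha>) / Gamma (1 - \<alpha>))))
        \<in> borel_measurable (M \<Otimes>\<^sub>M lborel)"
      by (subst measurable_cong_sets[OF sets_pair_measure_cong[of M borel lborel borel] refl]) auto
    show "AE \<alpha> in M. has_bochner_integral lborel (\<lambda>t. indicator {0<..} t * (exp (- (z * t)) * (t powr (- \<alpha>) / Gamma (1 - \<alpha>)))) (z powr (\<alpha> - 1))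
        \<and> (\<forall>t. indicator {0<..} t * (exp (- (z * t)) * (t powr (- \<alpha>) / Gamma (1 - \<alpha>))) \<ge> 0)"
      using AE_M
    proof eventually_elim
      case (elim \<alpha>)
      then have "Gamma (1 - \<alpha>) > 0" by (intro Gamma_real_pos) simp
      then show ?case using has_bochner_integral_powr_exp[of \<alpha> z] elim z by (auto simp: indicator_def)
    qed
    have "integrable M (\<lambda>\<alpha>. exp (\<alpha> * ln z))" by (rule integrable_exp)
    then have "integrable M (\<lambda>\<alpha>. z powr \<alpha> / z)" using z by (simp add: powr_def)
    then have "has_bochner_integral M (\<lambda>\<alpha>. z powr \<alpha> / z) (Phi z / z)"
      by (simp add: has_bochner_integral_iff Phi_def)
    then show "has_bochner_integral M (\<lambda>\<alpha>. z powr (\<alpha> - 1)) (Phi z / z)"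
      using z by (simp add: powr_diff)
  qed
  then show ?thesis by (simp only: kernel_def integral_mult_right_zero)
qed

lemma kernel_nonneg: "kernel t \<ge> 0"
  unfolding kernel_def
proof (rule integral_nonneg_AE)
  show "AE \<alpha> in M. 0 \<le> t powr (- \<alpha>) / Gamma (1 - \<alpha>)"
    using AE_M
  proof eventually_elim
    case (elim \<alpha>)
    then have "Gamma (1 - \<alpha>) > 0" by (intro Gamma_real_pos) simp
    then show ?case by simp
  qed
qed

lemma kernel_measurable [measurable]: "kernel \<in> borel_measurable borel"
proof -
  have "(\<lambda>(t, \<alpha>). t powr (- \<alpha>) / Gamma (1 - \<alpha>)) \<in> borel_measurable ((borel :: real measure) \<Otimes>\<^sub>M borel)"
    using measurable_compose[OF measurable_pair_swap' kernel_measurable_pair] by (simp add: split_beta')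
  then have "(\<lambda>(t, \<alpha>). t powr (- \<alpha>) / Gamma (1 - \<alpha>)) \<in> borel_measurable ((borel :: real measure) \<Otimes>\<^sub>M M)"
    by (subst measurable_cong_sets[OF sets_pair_measure_cong[of borel borel M borel] refl]) auto
  then show ?thesis unfolding kernel_def[abs_def] by (rule borel_measurable_lebesgue_integral)
qed

text \<open>exp(-r t) has transform 1/(z + r), so the transform of \<open>V\<close> is the resolvent
  integral of the spectral density.\<close>

lemma laplace_V:
  assumes z: "z > 0"
  shows "has_bochner_integral lborel (\<lambda>t. indicator {0<..} t * (exp (- (z * t)) * V t)) (Phi z / (z * (lam + Phi z)))"
proof -
  have "has_bochner_integral lborel (\<lambda>t. \<integral>x. indicator {0<..} t * exp (- ((z + exp x) * t)) * spectral x \<partial>lborel)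
      (pi * ((1 / lam - 1 / (lam + Phi z)) / z))"
  proof (rule has_bochner_integral_swap[where J="\<lambda>x. spectral x / (z + exp x)"])
    show "has_bochner_integral lborel (\<lambda>x. spectral x / (z + exp x)) (pi * ((1 / lam - 1 / (lam + Phi z)) / z))"
      by (rule integral_spectral_resolvent[OF z])
    show "AE x in lborel. has_bochner_integral lborel (\<lambda>t. indicator {0<..} t * exp (- ((z + exp x) * t)) * spectral x) (spectral x / (z + exp x))
        \<and> (\<forall>t. indicator {0<..} t * exp (- ((z + exp x) * t)) * spectral x \<ge> 0)"
    proof (intro AE_I2 conjI allI)
      fix x t
      show "indicator {0<..} t * exp (- ((z + exp x) * t)) * spectral x \<ge> 0" using spectral_nonneg[of x] by simp
      have "z + exp x > 0" using z by (simp add: add_pos_pos)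
      from has_bochner_integral_mult_left[OF has_bochner_integral_exp_Ioi[OF this], of "spectral x"]
      show "has_bochner_integral lborel (\<lambda>t. indicator {0<..} t * exp (- ((z + exp x) * t)) * spectral x) (spectral x / (z + exp x))"
        by simp
    qed
  qed (simp_all add: lborel.sigma_finite_measure_axioms)
  from has_bochner_integral_mult_right[OF this, of "lam / pi"]
  have "has_bochner_integral lborel (\<lambda>t. lam / pi * (\<integral>x. indicator {0<..} t * exp (- ((z + exp x) * t)) * spectral x \<partial>lborel))
      (lam / pi * (pi * ((1 / lam - 1 / (lam + Phi z)) / z)))" .
  moreover have "lam / pi * (\<integral>x. indicator {0<..} t * exp (- ((z + exp x) * t)) * spectral x \<partial>lborel) =
      indicator {0<..} t * (exp (- (z * t)) * V t)" for t
  proof -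
    have e: "indicator {0<..} t * exp (- ((z + exp x) * t)) * spectral x =
        indicator {0<..} t * exp (- (z * t)) * (exp (- (exp x * t)) * spectral x)" for x
      by (simp add: distrib_right exp_diff exp_minus exp_add field_simps)
    show ?thesis by (simp only: e integral_mult_right_zero V_def) simp
  qed
  moreover have "lam / pi * (pi * ((1 / lam - 1 / (lam + Phi z)) / z)) = Phi z / (z * (lam + Phi z))"
  proof -
    have pos: "lam + Phi z > 0" using Phi_nonneg[OF z] lam_pos by simp
    have "1 / lam - 1 / (lam + Phi z) = Phi z / (lam * (lam + Phi z))"
      using pos lam_pos by (simp add: divide_simps)
    moreover have "1 - Phi z / (lam + Phi z) = lam / (lam + Phi z)"
      using pos by (simp add: divide_simps)
    ultimately show ?thesis using lam_pos z by (simp add: right_diff_distrib)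
  qed
  ultimately show ?thesis by simp
qed

text \<open>With r = exp x, the factor r/(z + r) is 1 - z/(z + r), which reduces everything to the
  two known contour integrals and avoids integrating exp x * spectral x by itself.\<close>

lemma laplace_rate:
  assumes z: "z > 0"
  shows "has_bochner_integral lborel (\<lambda>t. indicator {0<..} t * (exp (- (z * t)) * rate t)) (lam / (lam + Phi z))"
proof -
  let ?c = "pi * (1 / lam) - z * (pi * ((1 / lam - 1 / (lam + Phi z)) / z))"
  have "has_bochner_integral lborel (\<lambda>t. \<integral>x. indicator {0<..} t * exp (- ((z + exp x) * t)) * (exp x * spectral x) \<partial>lborel) ?c"
  proof (rule has_bochner_integral_swap[where J="\<lambda>x. spectral x - z * (spectral x / (z + exp x))"])
    show "has_bochner_integral lborel (\<lambda>x. spectral x - z * (spectral x / (z + exp x))) ?c"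
      by (intro has_bochner_integral_diff has_bochner_integral_mult_right integral_spectral integral_spectral_resolvent[OF z])
    show "AE x in lborel. has_bochner_integral lborel (\<lambda>t. indicator {0<..} t * exp (- ((z + exp x) * t)) * (exp x * spectral x))
         (spectral x - z * (spectral x / (z + exp x)))
        \<and> (\<forall>t. indicator {0<..} t * exp (- ((z + exp x) * t)) * (exp x * spectral x) \<ge> 0)"
    proof (intro AE_I2 conjI allI)
      fix x t
      show "indicator {0<..} t * exp (- ((z + exp x) * t)) * (exp x * spectral x) \<ge> 0" using spectral_nonneg[of x] by simp
      have pos: "z + exp x > 0" using z by (simp add: add_pos_pos)
      have "spectral x - z * (spectral x / (z + exp x)) = 1 / (z + exp x) * (exp x * spectral x)"
        using pos by (simp add: field_simps)
      with has_bochner_integral_mult_left[OF has_bochner_integral_exp_Ioi[OF pos], of "exp x * spectral x"]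
      show "has_bochner_integral lborel (\<lambda>t. indicator {0<..} t * exp (- ((z + exp x) * t)) * (exp x * spectral x)) (spectral x - z * (spectral x / (z + exp x)))"
        by simp
    qed
  qed (simp_all add: lborel.sigma_finite_measure_axioms)
  from has_bochner_integral_mult_right[OF this, of "lam / pi"]
  have "has_bochner_integral lborel (\<lambda>t. lam / pi * (\<integral>x. indicator {0<..} t * exp (- ((z + exp x) * t)) * (exp x * spectral x) \<partial>lborel))
      (lam / pi * ?c)" .
  moreover have "lam / pi * (\<integral>x. indicator {0<..} t * exp (- ((z + exp x) * t)) * (exp x * spectral x) \<partial>lborel) =
      indicator {0<..} t * (exp (- (z * t)) * rate t)" for t
  proof -
    have e: "indicator {0<..} t * exp (- ((z + exp x) * t)) * (exp x * spectral x) =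
        indicator {0<..} t * exp (- (z * t)) * (exp (- (exp x * t)) * (exp x * spectral x))" for x
      by (simp add: distrib_right exp_diff exp_minus exp_add field_simps)
    show ?thesis by (simp only: e integral_mult_right_zero rate_def) simp
  qed
  moreover have "lam / pi * ?c = lam / (lam + Phi z)"
  proof -
    have pos: "lam + Phi z > 0" using Phi_nonneg[OF z] lam_pos by simp
    have "1 / lam - 1 / (lam + Phi z) = Phi z / (lam * (lam + Phi z))"
      using pos lam_pos by (simp add: divide_simps)
    moreover have "1 - Phi z / (lam + Phi z) = lam / (lam + Phi z)"
      using pos by (simp add: divide_simps)
    ultimately show ?thesis using lam_pos z by (simp add: right_diff_distrib)
  qed
  ultimately show ?thesis by simp
qed

section \<open>Regularity of V and its derivative\<close>

lemma rate_nonneg: "rate t \<ge> 0"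
  unfolding rate_def using lam_pos spectral_nonneg
  by (intro mult_nonneg_nonneg Bochner_Integration.integral_nonneg) auto

lemma rate_measurable [measurable]: "rate \<in> borel_measurable borel"
  unfolding rate_def[abs_def] by measurable

lemma V_measurable [measurable]: "V \<in> borel_measurable borel"
  unfolding V_def[abs_def] by measurable

lemma integrable_exp_spectral:
  assumes "t \<ge> 0"
  shows "integrable lborel (\<lambda>x. exp (- (exp x * t)) * spectral x)"
proof (rule Bochner_Integration.integrable_bound[OF spectral_integrable])
  show "AE x in lborel. norm (exp (- (exp x * t)) * spectral x) \<le> norm (spectral x)"
    using assms by (intro AE_I2) (simp add: abs_mult mult_left_le_one_le)
qed simp

lemma V_0: "V 0 = 1"
  using lam_pos by (simp add: V_def integral_spectral_eq)

lemma integral_rate: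
  assumes t: "t \<ge> 0"
  shows "has_bochner_integral lborel (\<lambda>s. indicator {0..t} s * rate s) (1 - V t)"
proof -
  let ?c = "pi * (1 / lam) - (\<integral>x. exp (- (exp x * t)) * spectral x \<partial>lborel)"
  have "has_bochner_integral lborel (\<lambda>s. \<integral>x. indicator {0..t} s * (exp x * exp (- (exp x * s))) * spectral x \<partial>lborel) ?c"
  proof (rule has_bochner_integral_swap[where J="\<lambda>x. spectral x - exp (- (exp x * t)) * spectral x"])
    show "has_bochner_integral lborel (\<lambda>x. spectral x - exp (- (exp x * t)) * spectral x) ?c"
      by (intro has_bochner_integral_diff integral_spectral has_bochner_integral_integrable integrable_exp_spectral t)
    show "AE x in lborel. has_bochner_integral lborel (\<lambda>s. indicator {0..t} s * (exp x * exp (- (exp x * s))) * spectral x)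
         (spectral x - exp (- (exp x * t)) * spectral x)
        \<and> (\<forall>s. indicator {0..t} s * (exp x * exp (- (exp x * s))) * spectral x \<ge> 0)"
    proof (intro AE_I2 conjI allI)
      fix x s
      show "indicator {0..t} s * (exp x * exp (- (exp x * s))) * spectral x \<ge> 0" using spectral_nonneg[of x] by simp
      from has_bochner_integral_mult_left[OF has_bochner_integral_exp_Icc[OF exp_gt_zero t], of x "spectral x"]
      show "has_bochner_integral lborel (\<lambda>s. indicator {0..t} s * (exp x * exp (- (exp x * s))) * spectral x)
         (spectral x - exp (- (exp x * t)) * spectral x)" by (simp add: left_diff_distrib)
    qed
  qed (simp_all add: lborel.sigma_finite_measure_axioms)
  from has_bochner_integral_mult_right[OF this, of "lam / pi"]
  have "has_bochner_integral lborel (\<lambda>s. lam / pi * (\<integral>x. indicator {0..t} s * (exp x * exp (- (exp x * s))) * spectral x \<partial>lborel))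
      (lam / pi * ?c)" .
  moreover have "lam / pi * (\<integral>x. indicator {0..t} s * (exp x * exp (- (exp x * s))) * spectral x \<partial>lborel) = indicator {0..t} s * rate s" for s
  proof -
    have e: "indicator {0..t} s * (exp x * exp (- (exp x * s))) * spectral x = indicator {0..t} s * (exp (- (exp x * s)) * (exp x * spectral x))" for x
      by simp
    show ?thesis by (simp only: e integral_mult_right_zero rate_def) simp
  qed
  moreover have "lam / pi * ?c = 1 - V t" using lam_pos by (simp add: V_def right_diff_distrib)
  ultimately show ?thesis by simp
qed

lemma set_integrable_rate: "set_integrable lborel {0..t} rate"
proof (cases "t \<ge> 0")
  case True
  from integral_rate[OF this] show ?thesis by (simp add: has_bochner_integral_iff set_integrable_def)
qed (simp add: set_integrable_def)

lemma V_eq: "t \<ge> 0 \<Longrightarrow> V t = 1 - (LINT s:{0..t}|lborel. rate s)"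
  using integral_rate[of t] by (simp add: has_bochner_integral_iff set_lebesgue_integral_def)

lemma mult_exp_le:
  fixes y t :: real
  assumes "t > 0"
  shows "exp (- (y * t)) * y \<le> 1 / t"
proof -
  have "y * t \<le> exp (y * t)" using exp_ge_add_one_self[of "y * t"] by linarith
  then have "exp (- (y * t)) * (y * t) \<le> exp (- (y * t)) * exp (y * t)" by (intro mult_left_mono) auto
  also have "\<dots> = 1" by (simp add: exp_minus)
  finally show ?thesis using assms by (simp add: field_simps)
qed

text \<open>For arguments above t/2 the factor exp x is absorbed by the decaying exponential at the
  cost of 2/t, so a multiple of \<open>spectral\<close> dominates.\<close>

lemma isCont_rate:
  assumes t: "t > 0"
  shows "isCont rate t"
proof -
  have "isCont (\<lambda>t. \<integral>x. exp (- (exp x * t)) * (exp x * spectral x) \<partial>lborel) t"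
    unfolding continuous_at_sequentially
  proof (intro allI impI)
    fix T :: "nat \<Rightarrow> real" assume T: "T \<longlonglongrightarrow> t"
    from order_tendstoD(1)[OF T, of "t / 2"] t have "\<forall>\<^sub>F n in sequentially. t / 2 < T n" by simp
    then obtain N where N: "\<And>n. n \<ge> N \<Longrightarrow> t / 2 < T n" unfolding eventually_sequentially by blast
    have "(\<lambda>n. \<integral>x. exp (- (exp x * T (n + N))) * (exp x * spectral x) \<partial>lborel) \<longlonglongrightarrow>
        (\<integral>x. exp (- (exp x * t)) * (exp x * spectral x) \<partial>lborel)"
    proof (rule integral_dominated_convergence[where w="\<lambda>x. 2 / t * spectral x"])
      show "integrable lborel (\<lambda>x. 2 / t * spectral x)" using spectral_integrable by simp
      show "AE x in lborel. (\<lambda>n. exp (- (exp x * T (n + N))) * (exp x * spectral x)) \<longlonglongrightarrow> exp (- (exp x * t)) * (exp x * spectral x)"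
        by (intro AE_I2 tendsto_intros LIMSEQ_ignore_initial_segment T)
      show "AE x in lborel. norm (exp (- (exp x * T (n + N))) * (exp x * spectral x)) \<le> 2 / t * spectral x" for n
      proof (intro AE_I2)
        fix x
        have Tn: "t / 2 < T (n + N)" using N by simp
        have "exp (- (exp x * T (n + N))) * exp x \<le> 1 / T (n + N)" using Tn t by (intro mult_exp_le) linarith
        also have "\<dots> \<le> 1 / (t / 2)" using Tn t by (intro divide_left_mono) auto
        finally have "exp (- (exp x * T (n + N))) * exp x * spectral x \<le> 2 / t * spectral x"
          using spectral_nonneg[of x] by (intro mult_right_mono) auto
        then show "norm (exp (- (exp x * T (n + N))) * (exp x * spectral x)) \<le> 2 / t * spectral x"
          using spectral_nonneg[of x] by (simp add: abs_mult mult.assoc)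
      qed
    qed simp_all
    then show "((\<lambda>t. \<integral>x. exp (- (exp x * t)) * (exp x * spectral x) \<partial>lborel) \<circ> T) \<longlonglongrightarrow>
        (\<integral>x. exp (- (exp x * t)) * (exp x * spectral x) \<partial>lborel)"
      unfolding o_def by (rule LIMSEQ_offset)
  qed
  then show ?thesis unfolding rate_def[abs_def] by (intro continuous_intros)
qed

text \<open>The primitive starts at t/2 because continuity of \<open>rate\<close> is known only away
  from 0.\<close>

lemma DERIV_V:
  assumes t: "t > 0"
  shows "(V has_real_derivative - rate t) (at t)"
proof -
  have seti: "set_integrable lborel {a..b} rate" if "a \<ge> 0" for a b
    using set_integrable_rate[of b] by (rule set_integrable_subset) (use that in auto)
  have split: "V x = V (t / 2) - integral {t / 2..x} rate" if "x \<ge> t / 2" for x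
  proof -
    have "(LINT s:{0..x}|lborel. rate s) = (LINT s:{0..t/2}|lborel. rate s) + (LINT s:{t/2<..x}|lborel. rate s)"
    proof -
      have "{0..x} = {0..t/2} \<union> {t/2<..x}" using that t by auto
      moreover have "set_integrable lborel {t/2<..x} rate"
        using seti[of "t/2" x] by (rule set_integrable_subset) (use t in auto)
      ultimately show ?thesis
        using set_integral_Un[OF _ seti[of 0 "t/2"], of "{t/2<..x}"] by force
    qed
    also have "(LINT s:{t/2<..x}|lborel. rate s) = (LINT s:{t/2..x}|lborel. rate s)"
      by (rule set_integral_discrete_difference[where X="{t/2}"]) auto
    also have "\<dots> = integral {t/2..x} rate"
      using t by (intro set_borel_integral_eq_integral(2) seti) auto
    finally show ?thesis using V_eq[of x] V_eq[of "t/2"] t that by simp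
  qed
  have cont: "continuous_on {t/2..t+1} rate"
    using t by (intro continuous_at_imp_continuous_on ballI isCont_rate) auto
  have "((\<lambda>x. integral {t/2..x} rate) has_real_derivative rate t) (at t within {t/2..t+1})"
    using t by (intro integral_has_real_derivative cont) auto
  then have "((\<lambda>x. integral {t/2..x} rate) has_real_derivative rate t) (at t)"
    using t at_within_interior[of t "{t/2..t+1}"] by (simp add: interior_atLeastAtMost_real)
  then have "((\<lambda>x. V (t/2) - integral {t/2..x} rate) has_real_derivative - rate t) (at t)"
    by (auto intro!: derivative_eq_intros)
  then show ?thesis
  proof (rule has_field_derivative_transform_within_open[OF _ open_greaterThan])
    show "t \<in> {t/2<..}" using t by simp
    show "V (t/2) - integral {t/2..x} rate = V x" if "x \<in> {t/2<..}" for x using split[of x] that by simp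
  qed
qed

end

section \<open>Existence\<close>

text \<open>Truncation: |h| is at most its excess over \<open>n\<close> plus \<open>n\<close>. For
  large \<open>n\<close> the excess has integral below epsilon/2, and the constant contributes at
  most n delta.\<close>

lemma abs_cont_on_indefinite_integral:
  assumes h: "set_integrable lborel {a..b} h"
    and w: "\<And>t. t \<in> {a..b} \<Longrightarrow> w t = c + (LINT s:{a..t}|lborel. h s)"
  shows "abs_cont_on a b w"
  unfolding abs_cont_on_def
proof (intro allI impI)
  fix \<epsilon> :: real assume \<epsilon>: "\<epsilon> > 0"
  define g where "g = (\<lambda>n::nat. \<lambda>s. max 0 (\<bar>h s\<bar> - real n))"
  let ?h = "\<lambda>s. indicator {a..b} s * h s"
  have ih: "integrable lborel ?h" using h by (simp add: set_integrable_def)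
  then have [measurable]: "?h \<in> borel_measurable borel" using borel_measurable_integrable by fastforce
  have geq: "indicator {a..b} s * g n s = max 0 (\<bar>?h s\<bar> - real n)" for n s
    by (auto simp: g_def indicator_def)
  have ig: "integrable lborel (\<lambda>s. indicator {a..b} s * g n s)" for n
    unfolding geq by (rule Bochner_Integration.integrable_bound[OF ih]) (simp_all add: max_def)
  then have sg: "set_integrable lborel {a..b} (g n)" for n by (simp add: set_integrable_def)
  have "(\<lambda>n. \<integral>s. indicator {a..b} s * g n s \<partial>lborel) \<longlonglongrightarrow> (\<integral>s. 0 \<partial>(lborel :: real measure))"
  proof (rule integral_dominated_convergence[where w="\<lambda>s. \<bar>?h s\<bar>"])
    show "AE s in lborel. (\<lambda>n. indicator {a..b} s * g n s) \<longlonglongrightarrow> 0"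
    proof (intro AE_I2 tendsto_eventually)
      fix s
      obtain N where N: "\<bar>?h s\<bar> \<le> real N" using real_arch_simple by blast
      show "\<forall>\<^sub>F n in sequentially. indicator {a..b} s * g n s = 0"
        using eventually_ge_at_top[of N] unfolding geq
      proof eventually_elim
        case (elim n)
        then have "\<bar>?h s\<bar> \<le> real n" using N by linarith
        then show ?case by simp
      qed
    qed
    show "AE s in lborel. norm (indicator {a..b} s * g n s) \<le> \<bar>?h s\<bar>" for n
      unfolding geq by (intro AE_I2) (simp add: max_def)
    show "(\<lambda>s. indicator {a..b} s * g n s) \<in> borel_measurable lborel" for n
      using ig by (rule borel_measurable_integrable)
  qed (use ih in auto)
  then have "(\<lambda>n. LINT s:{a..b}|lborel. g n s) \<longlonglongrightarrow> 0" by (simp add: set_lebesgue_integral_def)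
  from order_tendstoD(2)[OF this, of "\<epsilon> / 2"] \<epsilon> obtain n where n: "(LINT s:{a..b}|lborel. g n s) < \<epsilon> / 2"
    by (auto simp: eventually_sequentially)
  \<comment> \<open>The summand 1 covers n = 0.\<close>
  define \<delta> where "\<delta> = \<epsilon> / (2 * (real n + 1))"
  have \<delta>: "\<delta> > 0" "real n * \<delta> \<le> \<epsilon> / 2"
    using \<epsilon> by (simp_all add: \<delta>_def field_simps)
  have incr: "\<bar>w v - w u\<bar> \<le> (LINT s:{u..v}|lborel. g n s) + real n * (v - u)" if "a \<le> u" "u \<le> v" "v \<le> b" for u v
  proof -
    have sub: "set_integrable lborel S h" if "S \<in> sets borel" "S \<subseteq> {a..b}" for S
      using h by (rule set_integrable_subset) (use that in auto)
    have "{a..v} = {a..u} \<union> {u<..v}" using that by auto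
    then have "(LINT s:{a..v}|lborel. h s) = (LINT s:{a..u}|lborel. h s) + (LINT s:{u<..v}|lborel. h s)"
      using set_integral_Un[OF _ sub[of "{a..u}"] sub[of "{u<..v}"]] that by force
    moreover have "(LINT s:{u<..v}|lborel. h s) = (LINT s:{u..v}|lborel. h s)"
      by (rule set_integral_discrete_difference[where X="{u}"]) auto
    ultimately have "w v - w u = (LINT s:{u..v}|lborel. h s)" using w[of u] w[of v] that by simp
    also have "\<bar>\<dots>\<bar> \<le> (LINT s:{u..v}|lborel. \<bar>h s\<bar>)"
      using set_integral_norm_bound[OF sub[of "{u..v}"]] that by auto
    also have "\<dots> \<le> (LINT s:{u..v}|lborel. g n s + real n)"
    proof (rule set_integral_mono)
      show "set_integrable lborel {u..v} (\<lambda>s. \<bar>h s\<bar>)"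
        using set_integrable_abs[OF sub[of "{u..v}"]] that by auto
      show "set_integrable lborel {u..v} (\<lambda>s. g n s + real n)"
        by (intro set_integral_add set_integrable_subset[OF sg] borel_integrable_atLeastAtMost') (use that in auto)
    qed (simp add: g_def)
    also have "\<dots> = (LINT s:{u..v}|lborel. g n s) + (LINT s:{u..v}|lborel. real n)"
      by (intro set_integral_add set_integrable_subset[OF sg] borel_integrable_atLeastAtMost') (use that in auto)
    also have "(LINT s:{u..v}|lborel. real n) = real n * (v - u)"
      using that by (simp add: set_lebesgue_integral_def)
    finally show ?thesis .
  qed
  show "\<exists>\<delta>>0. \<forall>(m::nat) x y. (\<forall>i<m. a \<le> x i \<and> x i \<le> y i \<and> y i \<le> b) \<and>
        (\<forall>i<m. \<forall>j<m. i \<noteq> j \<longrightarrow> y i \<le> x j \<or> y j \<le> x i) \<and> (\<Sum>i<m. y i - x i) < \<delta> \<longrightarrow>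
        (\<Sum>i<m. \<bar>w (y i) - w (x i)\<bar>) < \<epsilon>"
  proof (intro exI conjI allI impI, fact \<delta>(1))
    fix m :: nat and x y :: "nat \<Rightarrow> real"
    assume asm: "(\<forall>i<m. a \<le> x i \<and> x i \<le> y i \<and> y i \<le> b) \<and>
        (\<forall>i<m. \<forall>j<m. i \<noteq> j \<longrightarrow> y i \<le> x j \<or> y j \<le> x i) \<and> (\<Sum>i<m. y i - x i) < \<delta>"
    define xs where "xs = map (\<lambda>i. (x i, y i)) [0..<m]"
    have xs: "intervals a b xs"
      using asm by (auto simp: intervals_def xs_def sorted_wrt_map sorted_wrt_iff_nth_less nonoverlapping_def)
    have sum_xs: "(\<Sum>p\<leftarrow>xs. k p) = (\<Sum>i<m. k (x i, y i))" for k :: "real \<times> real \<Rightarrow> real"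
      by (simp add: xs_def o_def sum_list_distinct_conv_sum_set atLeast0LessThan)
    have "(\<Sum>i<m. \<bar>w (y i) - w (x i)\<bar>) \<le> (\<Sum>i<m. (LINT s:{x i..y i}|lborel. g n s) + real n * (y i - x i))"
      using asm by (intro sum_mono incr) auto
    also have "\<dots> = (\<Sum>p\<leftarrow>xs. LINT s:{fst p..snd p}|lborel. g n s) + real n * (\<Sum>i<m. y i - x i)"
      by (simp add: sum_xs sum.distrib sum_distrib_left)
    also have "\<dots> \<le> (LINT s:{a..b}|lborel. g n s) + real n * \<delta>"
      using asm by (intro add_mono sum_set_integral_intervals_le[OF xs sg] mult_left_mono) (auto simp: g_def)
    also have "\<dots> < \<epsilon>" using n \<delta>(2) by simp
    finally show "(\<Sum>i<m. \<bar>w (y i) - w (x i)\<bar>) < \<epsilon>" .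
  qed
qed

text \<open>An exponential weight passes through a convolution, so weighted functions stay
  integrable and shifted transforms remain transforms of convolutions.\<close>

lemma convolution_exp_mult:
  "convolution (\<lambda>t. exp (- (a * t)) * f t) (\<lambda>t. exp (- (a * t)) * g t) t = exp (- (a * t)) * convolution f g t"
proof -
  have z: "exp (- (a * (t - \<tau>))) * f (t - \<tau>) * (exp (- (a * \<tau>)) * g \<tau>) = exp (- (a * t)) * (f (t - \<tau>) * g \<tau>)" for \<tau>
  proof -
    have e: "exp (- (a * t)) = exp (- (a * (t - \<tau>))) * exp (- (a * \<tau>))"
      by (simp add: exp_add[symmetric] algebra_simps)
    show ?thesis unfolding e by (simp only: mult_ac)
  qed
  show ?thesis by (simp only: convolution_def z integral_mult_right_zero)
qed

lemma convolution_causal: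
  assumes "\<And>x. x \<le> 0 \<Longrightarrow> f x = 0" "\<And>x. x \<le> 0 \<Longrightarrow> g x = 0" "t \<le> 0"
  shows "convolution f g t = 0"
proof -
  have z: "f (t - \<tau>) * g \<tau> = 0" for \<tau>
    using assms by (cases "\<tau> \<le> 0") auto
  show ?thesis by (simp only: convolution_def z Bochner_Integration.integral_zero)
qed

context distributed_order
begin

text \<open>Both sides have transform \<open>lam * Phi z / (z * (lam + Phi z))\<close>. The weight
  exp(-t) makes all functions integrable on the line, so that \<open>lerch\<close> applies to the
  weighted difference.\<close>

lemma AE_convolution_kernel_rate:
  "AE t in lborel. 0 < t \<longrightarrow>
     integrable lborel (\<lambda>\<tau>. indicator {0<..<t} \<tau> * (kernel (t - \<tau>) * rate \<tau>)) \<and>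
     (\<integral>\<tau>. indicator {0<..<t} \<tau> * (kernel (t - \<tau>) * rate \<tau>) \<partial>lborel) = lam * V t"
proof -
  define k where "k = (\<lambda>z t. indicator {0<..} t * (exp (- (z * t)) * kernel t))"
  define h where "h = (\<lambda>z t. indicator {0<..} t * (exp (- (z * t)) * rate t))"
  define v where "v = (\<lambda>z t. indicator {0<..} t * (exp (- (z * t)) * V t))"
  have k: "integrable lborel (k z)" "(\<integral>t. k z t \<partial>lborel) = Phi z / z"
    and h: "integrable lborel (h z)" "(\<integral>t. h z t \<partial>lborel) = lam / (lam + Phi z)"
    and v: "integrable lborel (v z)" "(\<integral>t. v z t \<partial>lborel) = Phi z / (z * (lam + Phi z))" if "z > 0" for z
    using laplace_kernel[OF that] laplace_rate[OF that] laplace_V[OF that]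
    by (simp_all add: has_bochner_integral_iff k_def h_def v_def)
  define f where "f = (\<lambda>t. convolution (k 1) (h 1) t - lam * v 1 t)"
  have "AE t in lborel. f t = 0"
  proof (rule lerch)
    show "integrable lborel f"
      unfolding f_def by (intro Bochner_Integration.integrable_diff integrable_convolution integrable_mult_right k h v) simp_all
    show "f t = 0" if "t < 0" for t
    proof -
      have "convolution (k 1) (h 1) t = 0"
        by (rule convolution_causal) (use that in \<open>auto simp: k_def h_def\<close>)
      then show ?thesis using that by (simp add: f_def v_def)
    qed
    fix n :: nat
    \<comment> \<open>The weight shifts the transform variable by 1, keeping it positive even for n
      = 0.\<close>
    let ?z = "real n + 1"
    have z: "?z > 0" by simp
    have kz: "k ?z = (\<lambda>t. exp (- (real n * t)) * k 1 t)" and hz: "h ?z = (\<lambda>t. exp (- (real n * t)) * h 1 t)"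
      and vz: "v ?z = (\<lambda>t. exp (- (real n * t)) * v 1 t)"
      by (auto simp: k_def h_def v_def fun_eq_iff distrib_right exp_diff exp_minus exp_add field_simps)
    have "exp (- (real n * t)) * f t = convolution (k ?z) (h ?z) t - lam * v ?z t" for t
      unfolding kz hz vz convolution_exp_mult by (simp add: f_def right_diff_distrib)
    then have "(\<integral>t. exp (- (real n * t)) * f t \<partial>lborel) = (\<integral>t. convolution (k ?z) (h ?z) t - lam * v ?z t \<partial>lborel)"
      by (simp only:)
    also have "\<dots> = (\<integral>t. convolution (k ?z) (h ?z) t \<partial>lborel) - lam * (\<integral>t. v ?z t \<partial>lborel)"
      using integrable_convolution[OF k(1)[OF z] h(1)[OF z]] v(1)[OF z] by simp
    also have "\<dots> = Phi ?z / ?z * (lam / (lam + Phi ?z)) - lam * (Phi ?z / (?z * (lam + Phi ?z)))"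
      by (simp only: integral_convolution[OF k(1)[OF z] h(1)[OF z]] k(2)[OF z] h(2)[OF z] v(2)[OF z])
    also have "\<dots> = 0" by simp
    finally show "(\<integral>t. exp (- (real n * t)) * f t \<partial>lborel) = 0" .
  qed
  moreover have "AE t in lborel. integrable lborel (\<lambda>\<tau>. k 1 (t - \<tau>) * h 1 \<tau>)"
    by (intro AE_integrable_convolution k h) simp_all
  ultimately show ?thesis
  proof eventually_elim
    case (elim t)
    show ?case
    proof
      assume t: "0 < t"
      have eq: "k 1 (t - \<tau>) * h 1 \<tau> = exp (- t) * (indicator {0<..<t} \<tau> * (kernel (t - \<tau>) * rate \<tau>))" for \<tau>
        by (auto simp: k_def h_def indicator_def exp_add[symmetric])
      have "integrable lborel (\<lambda>\<tau>. exp t * (k 1 (t - \<tau>) * h 1 \<tau>))"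
        using elim(2) by (rule integrable_mult_right)
      then have 1: "integrable lborel (\<lambda>\<tau>. indicator {0<..<t} \<tau> * (kernel (t - \<tau>) * rate \<tau>))"
        by (simp add: eq mult.assoc[symmetric] exp_add[symmetric])
      have "exp (- t) * (\<integral>\<tau>. indicator {0<..<t} \<tau> * (kernel (t - \<tau>) * rate \<tau>) \<partial>lborel) = convolution (k 1) (h 1) t"
        by (simp only: convolution_def eq integral_mult_right_zero)
      also have "\<dots> = exp (- t) * (lam * V t)" using elim(1) t by (simp add: f_def v_def)
      finally have 2: "(\<integral>\<tau>. indicator {0<..<t} \<tau> * (kernel (t - \<tau>) * rate \<tau>) \<partial>lborel) = lam * V t" by simp
      show "integrable lborel (\<lambda>\<tau>. indicator {0<..<t} \<tau> * (kernel (t - \<tau>) * rate \<tau>)) \<and>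
        (\<integral>\<tau>. indicator {0<..<t} \<tau> * (kernel (t - \<tau>) * rate \<tau>) \<partial>lborel) = lam * V t"
        using 1 2 by blast
    qed
  qed
qed

lemma V_is_dsol:
  assumes dk: "\<And>s. s > 0 \<Longrightarrow> dkernel \<mu> s = kernel s"
    and v: "\<And>t. t \<ge> 0 \<Longrightarrow> v t = v0 * V t"
  shows "is_dsol \<mu> lam v0 v"
proof -
  have dv: "deriv v t = - v0 * rate t" if t: "t > 0" for t
  proof (rule DERIV_imp_deriv)
    have "((\<lambda>t. v0 * V t) has_real_derivative - v0 * rate t) (at t)"
      using DERIV_V[OF t] by (auto intro!: derivative_eq_intros)
    then show "(v has_real_derivative - v0 * rate t) (at t)"
    proof (rule has_field_derivative_transform_within_open[OF _ open_greaterThan])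
      show "t \<in> {0<..}" using t by simp
    qed (simp add: v)
  qed
  have ac: "abs_cont_on 0 T v" for T
  proof (rule abs_cont_on_indefinite_integral[where h="\<lambda>s. - v0 * rate s" and c=v0])
    show "set_integrable lborel {0..T} (\<lambda>s. - v0 * rate s)"
      by (intro set_integrable_mult_right set_integrable_rate)
    show "v t = v0 + (LINT s:{0..t}|lborel. - v0 * rate s)" if "t \<in> {0..T}" for t
    proof -
      have "(LINT s:{0..t}|lborel. - v0 * rate s) = - v0 * (LINT s:{0..t}|lborel. rate s)"
        by (rule set_integral_mult_right)
      moreover have "v t = v0 * (1 - (LINT s:{0..t}|lborel. rate s))" using that by (simp add: v V_eq)
      ultimately show ?thesis by (simp add: algebra_simps)
    qed
  qed
  have "AE t in lborel. 0 < t \<longrightarrow> set_integrable lborel {0..t} (\<lambda>\<tau>. dkernel \<mu> (t - \<tau>) * deriv v \<tau>)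
      \<and> dcaputo \<mu> v t + lam * v t = 0"
    using AE_convolution_kernel_rate
  proof eventually_elim
    case (elim t)
    show ?case
    proof
      assume t: "0 < t"
      \<comment> \<open>\<open>deriv v\<close> at 0 and \<open>dkernel\<close> at 0 carry no
        information; they enter only at the two points 0 and \<open>t\<close>, which are
        null.\<close>
      let ?f = "\<lambda>\<tau>. indicator {0..t} \<tau> *\<^sub>R (dkernel \<mu> (t - \<tau>) * deriv v \<tau>)"
      let ?g = "\<lambda>\<tau>. - v0 * (indicator {0<..<t} \<tau> * (kernel (t - \<tau>) * rate \<tau>))"
      have fg: "?f \<tau> = ?g \<tau>" if "\<tau> \<notin> {0, t}" for \<tau>
        using that by (cases "0 < \<tau> \<and> \<tau> < t") (auto simp: dk dv indicator_def)
      have "integrable lborel ?g" using elim t by (intro integrable_mult_right) blast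
      then have 1: "integrable lborel ?f"
        by (subst integrable_discrete_difference[where X="{0, t}" and g="?g"]) (use fg in auto)
      have "integral\<^sup>L lborel ?f = integral\<^sup>L lborel ?g"
        by (rule integral_discrete_difference[where X="{0, t}"]) (use fg in auto)
      also have "\<dots> = - v0 * (lam * V t)"
        using elim t by (simp only: integral_mult_right_zero)
      finally have "dcaputo \<mu> v t = - v0 * (lam * V t)"
        by (simp only: dcaputo_def set_lebesgue_integral_def)
      then have "dcaputo \<mu> v t + lam * v t = 0" using t by (simp add: v)
      with 1 show "set_integrable lborel {0..t} (\<lambda>\<tau>. dkernel \<mu> (t - \<tau>) * deriv v \<tau>)
          \<and> dcaputo \<mu> v t + lam * v t = 0"
        by (simp only: set_integrable_def simp_thms)
    qed
  qed
  then show ?thesis unfolding is_dsol_def using ac by (simp add: v V_0)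
qed

end

section \<open>Uniqueness\<close>

lemma convolution_scale_left: "convolution (\<lambda>x. c * f x) g t = c * convolution f g t"
  by (simp only: convolution_def mult.assoc integral_mult_right_zero)

lemma convolution_scale_right: "convolution f (\<lambda>x. c * g x) t = c * convolution f g t"
  by (simp only: convolution_def mult.left_commute[of _ c] integral_mult_right_zero)

lemma convolution_diff_left_AE:
  assumes "integrable lborel f" "integrable lborel f'" "integrable lborel g"
  shows "AE t in lborel. convolution (\<lambda>x. f x - f' x) g t = convolution f g t - convolution f' g t"
  using AE_integrable_convolution[OF assms(1,3)] AE_integrable_convolution[OF assms(2,3)]
  by eventually_elim (simp add: convolution_def left_diff_distrib)

context distributed_order
begin

text \<open>All functions are cut off to the open interval from 0 to \<open>T\<close>: this makes
  them integrable, and by causality leaves convolutions at times below \<open>T\<close>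
  unchanged.\<close>

lemma dsol_unique:
  assumes dk: "\<And>s. s > 0 \<Longrightarrow> dkernel \<mu> s = kernel s"
    and w: "is_dsol \<mu> lam v0 w" and t0: "t0 \<ge> 0"
  shows "w t0 = v0 * V t0"
proof (cases "t0 = 0")
  case True
  then show ?thesis using w by (simp add: is_dsol_def V_0)
next
  case False
  with t0 have t0: "t0 > 0" by simp
  \<comment> \<open>Puts \<open>t0\<close> in the interior, so that continuity can reach it from an
    almost everywhere statement.\<close>
  define T where "T = t0 + 1"
  have T: "T > 0" "t0 \<in> {0<..<T}" using t0 by (auto simp: T_def)
  from w have w0: "w 0 = v0" and acw: "abs_cont_on 0 T w" using T by (auto simp: is_dsol_def)
  obtain f where f: "integrable lborel f" "\<And>t. t \<in> {0..T} \<Longrightarrow> w t = w 0 + (LINT s:{0..t}|lborel. f s)"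
    "AE t in lborel. t \<in> {0<..<T} \<longrightarrow> (w has_real_derivative f t) (at t)"
  proof (rule abs_cont_on_FTC[OF acw less_imp_le[OF T(1)]], goal_cases)
    case (1 f)
    show ?case by (rule that[OF 1(2,3,4)])
  qed
  have [measurable]: "f \<in> borel_measurable borel" using borel_measurable_integrable[OF f(1)] by simp
  define I where "I = (\<lambda>s. indicator {0<..<T} s :: real)"
  \<comment> \<open>The derivative of u = w - v0 V; the sign is plus because the derivative of
    \<open>V\<close> is \<open>- rate\<close>.\<close>
  define F where "F = (\<lambda>s. I s * (f s + v0 * rate s))"
  define H where "H = (\<lambda>s. I s * rate s)"
  define K where "K = (\<lambda>s. I s * kernel s)"
  define VV where "VV = (\<lambda>s. I s * V s)"
  have I[measurable]: "I \<in> borel_measurable borel" by (simp add: I_def)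
  have meas[measurable]: "F \<in> borel_measurable borel" "H \<in> borel_measurable borel"
      "K \<in> borel_measurable borel" "VV \<in> borel_measurable borel"
    unfolding F_def H_def K_def VV_def by measurable
  have zero: "I x = 0" "F x = 0" "H x = 0" "K x = 0" "VV x = 0" if "x \<le> 0" for x
    using that by (auto simp: I_def F_def H_def K_def VV_def)
  have I_bound: "integrable lborel (\<lambda>s. I s * g s)" if "integrable lborel g" for g
    unfolding I_def using set_integrable_lborel_subset[OF that, of "{0<..<T}"] by (simp add: set_integrable_def)
  have I_int: "integrable lborel I"
  proof -
    have "emeasure lborel {0<..<T} < \<infinity>" using T(1) by simp
    then show ?thesis unfolding I_def by (intro integrable_real_indicator) auto
  qed
  have H_int: "integrable lborel H"
  proof -
    have "set_integrable lborel {0<..<T} rate"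
      by (rule set_integrable_subset[OF set_integrable_rate[of T]]) auto
    then show ?thesis by (simp add: H_def[abs_def] I_def set_integrable_def)
  qed
  have F_int: "integrable lborel F"
  proof -
    have "F = (\<lambda>s. I s * f s + v0 * H s)" by (auto simp: F_def H_def fun_eq_iff distrib_left)
    then show ?thesis using I_bound[OF f(1)] H_int by simp
  qed
  have K_int: "integrable lborel K"
  \<comment> \<open>Local integrability of the kernel is read off its transform at z = 1: on the
    cut-off interval exp(T - t) is at least 1.\<close>
  proof (rule Bochner_Integration.integrable_bound)
    show "integrable lborel (\<lambda>t. exp T * (indicator {0<..} t * (exp (- (1 * t)) * kernel t)))"
      using laplace_kernel[of 1] by (intro integrable_mult_right) (simp add: has_bochner_integral_iff)
    show "AE t in lborel. norm (K t) \<le> norm (exp T * (indicator {0<..} t * (exp (- (1 * t)) * kernel t)))"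
    proof (intro AE_I2)
      fix t
      show "norm (K t) \<le> norm (exp T * (indicator {0<..} t * (exp (- (1 * t)) * kernel t)))"
      proof (cases "t \<in> {0<..<T}")
        case True
        have "1 * kernel t \<le> exp (T - t) * kernel t" using True kernel_nonneg by (intro mult_right_mono) auto
        then show ?thesis using True kernel_nonneg[of t]
          by (simp add: K_def I_def abs_mult mult.assoc[symmetric] exp_add[symmetric])
      qed (simp add: K_def I_def)
    qed
  qed simp
  have V_le: "0 \<le> V t \<and> V t \<le> 1" if "t \<ge> 0" for t
  proof
    show "0 \<le> V t" unfolding V_def using lam_pos spectral_nonneg
      by (intro mult_nonneg_nonneg Bochner_Integration.integral_nonneg) auto
    have "(LINT s:{0..t}|lborel. rate s) \<ge> 0"
      unfolding set_lebesgue_integral_def using rate_nonneg by (intro Bochner_Integration.integral_nonneg) simp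
    then show "V t \<le> 1" using V_eq[OF that] by simp
  qed
  have VV_int: "integrable lborel VV"
    by (rule Bochner_Integration.integrable_bound[OF I_int]) (use V_le in \<open>auto simp: VV_def I_def indicator_def\<close>)
  \<comment> \<open>Integrating \<open>F\<close> from 0 recovers u, because u vanishes at 0; the
    outer cut-off restores a function supported in the interval.\<close>
  define U where "U = (\<lambda>t. I t * convolution I F t)"
  have IF_int: "integrable lborel (convolution I F)" by (intro integrable_convolution I_int F_int)
  have U_int: "integrable lborel U" unfolding U_def by (rule I_bound[OF IF_int])
  have [measurable]: "U \<in> borel_measurable borel" using borel_measurable_integrable[OF U_int] by simp
  have U_zero: "U x = 0" if "x \<le> 0" for x using zero(1)[OF that] by (simp add: U_def)
  have conv_I: "convolution I g t = (LINT s:{0..t}|lborel. g' s)"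
    if "\<And>s. s \<in> {0<..<T} \<Longrightarrow> g s = g' s" "\<And>s. s \<le> 0 \<Longrightarrow> g s = 0" "t < T" for g g' t
  proof -
    have "I (t - \<tau>) * g \<tau> = indicator {0..t} \<tau> *\<^sub>R g' \<tau>" if "\<tau> \<notin> {0, t}" for \<tau>
      using that \<open>t < T\<close> \<open>\<And>s. s \<in> {0<..<T} \<Longrightarrow> g s = g' s\<close> \<open>\<And>s. s \<le> 0 \<Longrightarrow> g s = 0\<close>
      by (cases "0 < \<tau> \<and> \<tau> < t") (auto simp: I_def indicator_def)
    then show ?thesis unfolding convolution_def set_lebesgue_integral_def
      by (intro integral_discrete_difference[where X="{0, t}"]) auto
  qed
  have U_eq: "U t = w t - v0 * V t" if t: "t \<in> {0<..<T}" for t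
  proof -
    have "convolution I F t = (LINT s:{0..t}|lborel. f s + v0 * rate s)"
      by (rule conv_I) (use t in \<open>auto simp: F_def I_def\<close>)
    also have "\<dots> = (LINT s:{0..t}|lborel. f s) + v0 * (LINT s:{0..t}|lborel. rate s)"
      by (subst set_integral_add)
        (auto intro!: set_integrable_lborel_subset f(1) set_integrable_mult_right set_integrable_rate)
    also have "\<dots> = w t - v0 * V t"
    proof -
      have "V t = 1 - (LINT s:{0..t}|lborel. rate s)" using t by (intro V_eq) simp
      moreover have "w t = v0 + (LINT s:{0..t}|lborel. f s)" using f(2)[of t] t w0 by simp
      ultimately show ?thesis by (simp only:) (simp add: algebra_simps)
    qed
    finally show ?thesis using t by (simp add: U_def I_def)
  qed
  \<comment> \<open>At \<open>T\<close> the cut-off is 0 while the convolutions need not vanish, so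
    this point is excluded.\<close>
  have AE_T: "AE t in lborel. t \<noteq> T" by (rule AE_lborel_singleton)
  \<comment> \<open>The equation k * u' = -lam u, obtained by subtracting the equation for v0 V from
    that for \<open>w\<close>.\<close>
  have A1: "AE t in lborel. t \<le> T \<longrightarrow> convolution K F t = - lam * U t"
    using AE_convolution_kernel_rate AE_T conjunct2[OF conjunct2[OF w[unfolded is_dsol_def]]]
  proof eventually_elim
    case (elim t)
    show ?case
    proof
      assume "t \<le> T"
      show "convolution K F t = - lam * U t"
      proof (cases "t > 0")
        case False
        then have "convolution K F t = 0" by (intro convolution_causal zero) auto
        then show ?thesis using U_zero[of t] False by simp
      next
        case True
        with elim(2) \<open>t \<le> T\<close> have t: "t \<in> {0<..<T}" by simp
        let ?J = "\<lambda>\<tau>. indicator {0<..<t} \<tau> :: real"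
        let ?d = "\<lambda>\<tau>. indicator {0..t} \<tau> *\<^sub>R (dkernel \<mu> (t - \<tau>) * deriv w \<tau>)"
        let ?k = "\<lambda>\<tau>. ?J \<tau> * (kernel (t - \<tau>) * f \<tau>)"
        let ?h = "\<lambda>\<tau>. ?J \<tau> * (kernel (t - \<tau>) * rate \<tau>)"
        have d_int: "integrable lborel ?d" using elim(3) True by (simp add: set_integrable_def)
        have "AE \<tau> in lborel. \<tau> \<noteq> 0" "AE \<tau> in lborel. \<tau> \<noteq> t" by (rule AE_lborel_singleton)+
        with f(3) have ae: "AE \<tau> in lborel. ?d \<tau> = ?k \<tau>"
        proof eventually_elim
          case (elim \<tau>)
          show ?case
          proof (cases "0 < \<tau> \<and> \<tau> < t")
            case True
            with elim(1) t have "deriv w \<tau> = f \<tau>" by (intro DERIV_imp_deriv) auto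
            with True show ?thesis by (simp add: dk)
          next
            case False
            with elim(2,3) show ?thesis by (auto simp: indicator_def)
          qed
        qed
        have k_meas: "?k \<in> borel_measurable lborel" by measurable
        \<comment> \<open>Measurability of the integrand with \<open>deriv w\<close> comes from its
          integrability, which is part of \<open>is_dsol\<close>; it then transfers integrability to
          the density \<open>f\<close>.\<close>
        have k_int: "integrable lborel ?k"
          using d_int integrable_cong_AE[OF borel_measurable_integrable[OF d_int] k_meas ae] by blast
        have "dcaputo \<mu> w t = integral\<^sup>L lborel ?d" by (simp only: dcaputo_def set_lebesgue_integral_def)
        also have "\<dots> = integral\<^sup>L lborel ?k"
          by (rule integral_cong_AE[OF borel_measurable_integrable[OF d_int] k_meas ae])
        finally have k_eq: "integral\<^sup>L lborel ?k = - lam * w t" using elim(3) True by auto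
        have h: "integrable lborel ?h" "integral\<^sup>L lborel ?h = lam * V t" using elim(1) True by blast+
        have "K (t - \<tau>) * F \<tau> = ?k \<tau> + v0 * ?h \<tau>" for \<tau>
          using t by (cases "0 < \<tau> \<and> \<tau> < t") (auto simp: K_def F_def I_def indicator_def algebra_simps)
        then have "convolution K F t = (\<integral>\<tau>. ?k \<tau> + v0 * ?h \<tau> \<partial>lborel)" by (simp only: convolution_def)
        also have "\<dots> = integral\<^sup>L lborel ?k + v0 * integral\<^sup>L lborel ?h"
          using Bochner_Integration.integral_add[OF k_int integrable_mult_right[OF h(1), of v0]]
          by (simp only: integral_mult_right_zero)
        also have "\<dots> = - lam * U t" unfolding k_eq h(2) U_eq[OF t] by (simp add: algebra_simps)
        finally show ?thesis .
      qed
    qed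
  qed
  \<comment> \<open>The relation h * k = lam v of the uniqueness argument.\<close>
  have A2: "AE t in lborel. t \<le> T \<longrightarrow> convolution H K t = lam * VV t"
    using AE_convolution_kernel_rate AE_T
  proof eventually_elim
    case (elim t)
    show ?case
    proof
      assume "t \<le> T"
      show "convolution H K t = lam * VV t"
      proof (cases "t > 0")
        case False
        then have "convolution H K t = 0" by (intro convolution_causal zero) auto
        then show ?thesis using zero(5)[of t] False by simp
      next
        case True
        with elim(2) \<open>t \<le> T\<close> have t: "t \<in> {0<..<T}" by simp
        have "K (t - \<tau>) * H \<tau> = indicator {0<..<t} \<tau> * (kernel (t - \<tau>) * rate \<tau>)" for \<tau>
          using t by (cases "0 < \<tau> \<and> \<tau> < t") (auto simp: K_def H_def I_def indicator_def)
        then have "convolution K H t = lam * V t" using elim(1) True by (simp only: convolution_def)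
        then show ?thesis using t by (simp add: convolution_commute[of H K] VV_def I_def)
      qed
    qed
  qed
  have VV_eq: "AE t in lborel. t \<le> T \<longrightarrow> VV t = I t - convolution I H t"
    using AE_T
  proof eventually_elim
    case (elim t)
    show ?case
    proof
      assume "t \<le> T"
      with elim have "t < T" by simp
      have "convolution I H t = (LINT s:{0..t}|lborel. rate s)"
        by (rule conv_I) (use \<open>t < T\<close> in \<open>auto simp: H_def I_def\<close>)
      then show "VV t = I t - convolution I H t"
      proof (cases "t > 0")
        case True
        with \<open>convolution I H t = _\<close> show ?thesis using \<open>t < T\<close> V_eq[of t] by (simp add: VV_def I_def)
      next
        case False
        then have "convolution I H t = 0" by (intro convolution_causal zero) auto
        with False show ?thesis by (simp add: zero)
      qed
    qed
  qed
  have cm: "convolution f g \<in> borel_measurable borel" if "integrable lborel f" "integrable lborel g" for f g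
    using borel_measurable_integrable[OF integrable_convolution[OF that]] by simp
  have cz: "convolution f g x = 0" if "\<And>x. x \<le> 0 \<Longrightarrow> f x = 0" "\<And>x. x \<le> 0 \<Longrightarrow> g x = 0" "x < 0" for f g x
    by (rule convolution_causal) (use that in auto)
  note [measurable] = cm[OF K_int F_int] cm[OF H_int K_int] cm[OF I_int H_int] cm[OF I_int F_int]
  \<comment> \<open>\<open>B1\<close> to \<open>B4\<close> replace one convolution factor by an
    almost everywhere equal one, so they hold at every \<open>t\<close> up to
    \<open>T\<close>.\<close>
  have B1: "convolution H (convolution K F) t = - lam * convolution H U t" if "t \<le> T" for t
  proof -
    have "convolution H (convolution K F) t = convolution H (\<lambda>t. - lam * U t) t"
      by (rule convolution_causal_cong[OF _ _ _ _ _ A1 _ _ _ _ that]) (auto simp: zero U_zero cz)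
    then show ?thesis by (simp only: convolution_scale_right)
  qed
  have B2: "convolution (convolution H K) F t = lam * convolution VV F t" if "t \<le> T" for t
  proof -
    have "convolution (convolution H K) F t = convolution (\<lambda>t. lam * VV t) F t"
      by (rule convolution_causal_cong[OF _ _ _ _ A2 _ _ _ _ _ that]) (auto simp: zero cz)
    then show ?thesis by (simp only: convolution_scale_left)
  qed
  have B3: "convolution VV F t = convolution (\<lambda>t. I t - convolution I H t) F t" if "t \<le> T" for t
    by (rule convolution_causal_cong[OF _ _ _ _ VV_eq _ _ _ _ _ that]) (auto simp: zero cz)
  have IH: "convolution I H = convolution H I" by (rule ext) (rule convolution_commute)
  have B4: "convolution H (convolution I F) t = convolution H U t" if "t \<le> T" for t
  proof (rule convolution_causal_cong[OF _ _ _ _ _ _ _ _ _ _ that])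
    show "AE x in lborel. x \<le> T \<longrightarrow> convolution I F x = U x"
      using AE_T
    proof eventually_elim
      case (elim x)
      show ?case
      proof (cases "x > 0")
        case False
        then have "convolution I F x = 0" by (intro convolution_causal zero) auto
        then show ?thesis using False by (simp add: U_zero)
      qed (use elim in \<open>auto simp: U_def I_def\<close>)
    qed
  qed (auto simp: zero U_zero cz)
  \<comment> \<open>Regrouping h * k * u' gives -h * u = v * u'; expanding v and regrouping h * 1 *
    u' gives u - h * u on the right.\<close>
  have "AE t in lborel. t \<in> {0<..<T} \<longrightarrow> U t = 0"
    using convolution_assoc_AE[OF H_int K_int F_int] convolution_assoc_AE[OF H_int I_int F_int]
      convolution_diff_left_AE[OF I_int integrable_convolution[OF I_int H_int] F_int]
  proof eventually_elim
    case (elim t)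
    show ?case
    proof
      assume t: "t \<in> {0<..<T}"
      then have le: "t \<le> T" by simp
      have "convolution VV F t = U t - convolution H U t"
      proof -
        have "convolution I F t = U t" using t by (simp add: U_def I_def)
        then show ?thesis using elim(2,3) B3[OF le] B4[OF le] unfolding IH by linarith
      qed
      then have "- lam * convolution H U t = lam * (U t - convolution H U t)"
        using elim(1) B1[OF le] B2[OF le] by simp
      then show "U t = 0" using lam_pos by (simp add: algebra_simps)
    qed
  qed
  then have ae0: "AE t in lborel. t \<in> {0<..<T} \<longrightarrow> w t - v0 * V t = 0"
    by eventually_elim (simp add: U_eq)
  \<comment> \<open>Continuity turns vanishing almost everywhere into vanishing at
    \<open>t0\<close>.\<close>
  have cont: "continuous_on {0..T} (\<lambda>t. w t - v0 * V t)"
  proof -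
    let ?u = "\<lambda>s. f s + v0 * rate s"
    have int: "set_integrable lborel {0..t} ?u" for t
      by (intro set_integral_add set_integrable_lborel_subset f(1) set_integrable_mult_right set_integrable_rate) simp
    have "continuous_on {0..T} (\<lambda>t. integral {0..t} ?u)"
      by (intro indefinite_integral_continuous_1 set_borel_integral_eq_integral(1) int)
    moreover have "integral {0..t} ?u = w t - v0 * V t" if "t \<in> {0..T}" for t
    proof -
      have "integral {0..t} ?u = (LINT s:{0..t}|lborel. ?u s)"
        by (rule set_borel_integral_eq_integral(2)[OF int, symmetric])
      also have "\<dots> = (LINT s:{0..t}|lborel. f s) + v0 * (LINT s:{0..t}|lborel. rate s)"
        by (subst set_integral_add)
          (auto intro!: set_integrable_lborel_subset f(1) set_integrable_mult_right set_integrable_rate)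
      also have "\<dots> = w t - v0 * V t"
      proof -
        have "V t = 1 - (LINT s:{0..t}|lborel. rate s)" using that by (intro V_eq) simp
        moreover have "w t = v0 + (LINT s:{0..t}|lborel. f s)" using f(2)[of t] that w0 by simp
        ultimately show ?thesis by (simp only:) (simp add: algebra_simps)
      qed
      finally show ?thesis .
    qed
    ultimately show ?thesis by (rule continuous_on_eq)
  qed
  have "t0 \<in> {t \<in> {0..T}. w t - v0 * V t = 0}"
  proof (rule mem_closed_if_AE_lebesgue_open[of "{0<..<T}"])
    show "closed {t \<in> {0..T}. w t - v0 * V t = 0}"
      using continuous_closed_preimage_constant[OF cont, of 0] by simp
    show "AE t\<in>{0<..<T} in lebesgue. t \<in> {t \<in> {0..T}. w t - v0 * V t = 0}"
      unfolding AE_completion_iff using ae0 by eventually_elim auto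
  qed (use T in auto)
  then show ?thesis by simp
qed

end

section \<open>The representation formula\<close>

context distributed_order
begin

text \<open>The substitution r = exp x, carried out for absolutely integrable functions and
  transferred back to the Borel measure by measurability.\<close>

lemma V_substitution:
  assumes t: "t \<ge> 0"
  shows "(LINT r:{0<..}|lborel. exp (- r * t) / r * Slog (ln r) / ((lam + Clog (ln r))\<^sup>2 + (Slog (ln r))\<^sup>2)) =
    (\<integral>x. exp (- (exp x * t)) * spectral x \<partial>lborel)"
proof -
  let ?f = "\<lambda>r. exp (- r * t) / r * spectral (ln r)"
  have feq: "exp (- r * t) / r * Slog (ln r) / ((lam + Clog (ln r))\<^sup>2 + (Slog (ln r))\<^sup>2) = ?f r" for r
    by (simp add: spectral_def)
  have range: "range (exp :: real \<Rightarrow> real) = {0<..}"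
    by (auto simp: image_iff) (metis exp_ln)
  have simp_f: "\<bar>exp x\<bar> * ?f (exp x) = exp (- (exp x * t)) * spectral x" for x by simp
  have int: "integrable lborel (\<lambda>x. exp (- (exp x * t)) * spectral x)" by (rule integrable_exp_spectral[OF t])
  have "(\<lambda>x. \<bar>exp x\<bar> * ?f (exp x)) absolutely_integrable_on UNIV \<and>
      integral UNIV (\<lambda>x. \<bar>exp x\<bar> * ?f (exp x)) = (\<integral>x. exp (- (exp x * t)) * spectral x \<partial>lborel)
     \<longleftrightarrow> ?f absolutely_integrable_on (range exp) \<and>
      integral (range exp) ?f = (\<integral>x. exp (- (exp x * t)) * spectral x \<partial>lborel)"
    by (rule has_absolute_integral_change_of_variables_1') (auto intro!: derivative_eq_intros simp: inj_on_def)
  moreover have "(\<lambda>x. exp (- (exp x * t)) * spectral x) absolutely_integrable_on UNIV"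
    using int by (simp add: set_integrable_def integrable_completion)
  moreover have "integral UNIV (\<lambda>x. exp (- (exp x * t)) * spectral x) = (\<integral>x. exp (- (exp x * t)) * spectral x \<partial>lborel)"
    by (rule integral_lborel[OF int])
  ultimately have f: "?f absolutely_integrable_on {0<..}"
      "integral {0<..} ?f = (\<integral>x. exp (- (exp x * t)) * spectral x \<partial>lborel)"
    unfolding simp_f range by blast+
  have "(\<lambda>r. indicator {0<..} r *\<^sub>R ?f r) \<in> borel_measurable lborel" by measurable
  then have "set_integrable lborel {0<..} ?f"
    using f(1) unfolding set_integrable_def by (simp only: integrable_completion)
  from set_borel_integral_eq_integral(2)[OF this] f(2) show ?thesis
    unfolding feq by (simp only:)
qed

end

theorem theorem2:
  fixes \<mu> :: "real \<Rightarrow> real" and lam v0 :: real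
  assumes "lam > 0"
    and "set_borel_measurable lborel {0..1} \<mu>"
    and "\<forall>\<alpha>\<in>{0..1}. \<mu> \<alpha> \<ge> 0"
    and "set_integrable lborel {0..1} \<mu>"
    and "(LINT \<alpha>:{0..1}|lborel. \<mu> \<alpha>) > 0"
    and "set_integrable lborel {0..1} (\<lambda>\<alpha>. \<mu> \<alpha> / \<alpha>)"
  shows "let S = (\<lambda>r. LINT \<alpha>:{0..1}|lborel. r powr \<alpha> * sin (pi * \<alpha>) * \<mu> \<alpha>);
             C = (\<lambda>r. LINT \<alpha>:{0..1}|lborel. r powr \<alpha> * cos (pi * \<alpha>) * \<mu> \<alpha>);
             v = (\<lambda>t. v0 * lam / pi *
                    (LINT r:{0<..}|lborel. exp (- r * t) / r * S r / ((lam + C r)\<^sup>2 + (S r)\<^sup>2)))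
         in is_dsol \<mu> lam v0 v \<and> (\<forall>w. is_dsol \<mu> lam v0 w \<longrightarrow> (\<forall>t\<ge>0. w t = v t))"
proof -
  \<comment> \<open>Measurability and sign of \<open>\<mu>\<close> are given only on
    \<open>{0..1}\<close>; the indicator extends both to the line.\<close>
  let ?m = "\<lambda>\<alpha>. indicator {0..1} \<alpha> * \<mu> \<alpha>"
  define M where "M = density lborel (\<lambda>\<alpha>. ennreal (?m \<alpha>))"
  have m_int: "integrable lborel ?m" using assms(4) by (simp add: set_integrable_def)
  have m_meas: "?m \<in> borel_measurable lborel" by (rule borel_measurable_integrable[OF m_int])
  have m_meas' [measurable]: "?m \<in> borel_measurable borel" using m_meas by (simp only: measurable_lborel2)
  have m_nonneg: "?m \<alpha> \<ge> 0" for \<alpha> using assms(3) by (auto simp: indicator_def)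
  have m_nn: "(\<integral>\<^sup>+\<alpha>. ennreal (?m \<alpha>) \<partial>lborel) = ennreal (LINT \<alpha>:{0..1}|lborel. \<mu> \<alpha>)"
    using nn_integral_eq_integral[OF m_int] m_nonneg by (simp add: set_lebesgue_integral_def)
  have m_em: "(\<lambda>\<alpha>. ennreal (?m \<alpha>)) \<in> borel_measurable lborel" using m_meas by (rule measurable_compose) simp
  have M_space: "emeasure M (space M) = ennreal (LINT \<alpha>:{0..1}|lborel. \<mu> \<alpha>)"
    unfolding M_def using m_nn m_em by (simp add: emeasure_density)
  interpret distributed_order M lam
  proof (intro distributed_order.intro distributed_order_axioms.intro finite_measureI)
    show "emeasure M (space M) \<noteq> \<infinity>" "emeasure M (space M) \<noteq> 0"
      unfolding M_space using assms(5) by auto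
    show "sets M = sets borel" by (simp add: M_def)
    have "AE \<alpha> in lborel. \<alpha> \<noteq> 0" "AE \<alpha> in lborel. \<alpha> \<noteq> (1::real)" by (rule AE_lborel_singleton)+
    then show "AE \<alpha> in M. 0 < \<alpha> \<and> \<alpha> < 1"
      unfolding M_def AE_density[OF m_em]
      by eventually_elim (auto simp: indicator_def split: if_splits)
  qed (use assms(1) in auto)
  have M_integral: "(\<integral>\<alpha>. g \<alpha> \<partial>M) = (LINT \<alpha>:{0..1}|lborel. g \<alpha> * \<mu> \<alpha>)"
    if "g \<in> borel_measurable borel" for g
  proof -
    have "(\<integral>\<alpha>. g \<alpha> \<partial>M) = (\<integral>\<alpha>. ?m \<alpha> *\<^sub>R g \<alpha> \<partial>lborel)"
      unfolding M_def by (rule integral_density) (use that m_meas m_nonneg in auto)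
    then show ?thesis by (simp add: set_lebesgue_integral_def mult_ac)
  qed
  have S: "(LINT \<alpha>:{0..1}|lborel. r powr \<alpha> * sin (pi * \<alpha>) * \<mu> \<alpha>) = Slog (ln r)" if "r > 0" for r
    unfolding Slog_def using that by (subst M_integral) (auto simp: powr_def)
  have C: "(LINT \<alpha>:{0..1}|lborel. r powr \<alpha> * cos (pi * \<alpha>) * \<mu> \<alpha>) = Clog (ln r)" if "r > 0" for r
    unfolding Clog_def using that by (subst M_integral) (auto simp: powr_def)
  \<comment> \<open>\<open>dkernel\<close> integrates over the open unit interval and
    \<open>M\<close> lives on the closed one; the endpoints are null.\<close>
  have dk: "dkernel \<mu> s = kernel s" for s
  proof -
    have "(\<lambda>\<alpha>. s powr (- \<alpha>) / Gamma (1 - \<alpha>)) \<in> borel_measurable borel"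
      using measurable_compose[OF measurable_Pair2'[of s borel borel] measurable_compose[OF measurable_pair_swap' kernel_measurable_pair]]
      by simp
    from M_integral[OF this]
    have "kernel s = (LINT \<alpha>:{0..1}|lborel. s powr (- \<alpha>) / Gamma (1 - \<alpha>) * \<mu> \<alpha>)" by (simp only: kernel_def)
    also have "\<dots> = (LINT \<alpha>:{0<..<1}|lborel. s powr (- \<alpha>) / Gamma (1 - \<alpha>) * \<mu> \<alpha>)"
      by (rule set_integral_Ioo_eq_Icc[symmetric])
    finally show ?thesis unfolding dkernel_def by (simp add: mult_ac)
  qed
  define v where "v = (\<lambda>t. v0 * lam / pi *
      (LINT r:{0<..}|lborel. exp (- r * t) / r * (LINT \<alpha>:{0..1}|lborel. r powr \<alpha> * sin (pi * \<alpha>) * \<mu> \<alpha>) /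
        ((lam + (LINT \<alpha>:{0..1}|lborel. r powr \<alpha> * cos (pi * \<alpha>) * \<mu> \<alpha>))\<^sup>2 +
         (LINT \<alpha>:{0..1}|lborel. r powr \<alpha> * sin (pi * \<alpha>) * \<mu> \<alpha>)\<^sup>2)))"
  have v: "v t = v0 * V t" if "t \<ge> 0" for t
  proof -
    have "v t = v0 * lam / pi * (LINT r:{0<..}|lborel. exp (- r * t) / r * Slog (ln r) / ((lam + Clog (ln r))\<^sup>2 + (Slog (ln r))\<^sup>2))"
      unfolding v_def by (intro arg_cong2[where f="(*)"] refl set_lebesgue_integral_cong) (simp_all add: S C)
    then show ?thesis unfolding V_substitution[OF that] by (simp add: V_def)
  qed
  have "is_dsol \<mu> lam v0 v \<and> (\<forall>w. is_dsol \<mu> lam v0 w \<longrightarrow> (\<forall>t\<ge>0. w t = v t))"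
  proof (intro conjI allI impI)
    show "is_dsol \<mu> lam v0 v" by (rule V_is_dsol[OF dk v])
    show "w t = v t" if "is_dsol \<mu> lam v0 w" "0 \<le> t" for w t
      using dsol_unique[OF dk that] v[OF that(2)] by simp
  qed
  then show ?thesis unfolding v_def Let_def .
qed

end
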